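(* Let $(X_{v,t})_{v\in\mathcal{T}_t,\,t\geq 0}$ be the supercritical branching Lévy process described in the context, with $\mathcal{T}_t$ the set of particles alive at time $t$, $X_{v,t}$ the position of particle $v$ at time $t$, and movement rate $r$. Conditional on the event $\{\lim_{t\rightarrow\infty}|\mathcal{T}_t|=\infty\}$, the limit $$ \lim_{t\rightarrow\infty}\frac{1}{|\mathcal{T}_t|}\sum_{v\in\mathcal{T}_t}\left(X_{v,t}-rt\right) $$ exists and is finite almost surely.
   Context: Ingredients for one particle. Let $(Z_{\emptyset,s})_{s\geq 0}$ be a real-valued Lévy process with $Z_{\emptyset,0}=0$ and $\mathbb{E}[Z_{\emptyset,1}^2]<\infty$. Let $A_\emptyset$ be an exponentially distributed random variable (lifetime of the particle). Let $N_\emptyset$ be a random variable with values in $\{0,1,2,\dots\}$ (number of offspring) with $\mathbb{E}[N_\emptyset]>1$ and $\mathbb{E}[N_\emptyset^2]<\infty$, and let $(D_i)_{i=1}^{N_\emptyset}$ be real-valued random variables (displacements of the offspring from the parent's death position) with $$\mathbb{E}\left[\left(\sum_{i=1}^{N_\emptyset}D_i\right)^2\right]<\infty\quad\text{and}\quad\mathbb{E}\left[\sum_{i=1}^{N_\emptyset}D_i^2\right]<\infty.$$ The three objects $(Z_{\emptyset,s})_{s\geq 0}$, $A_\emptyset$ and $(D_i)_{i=1}^{N_\emptyset}$ (the last including $N_\emptyset$) are independent, but the $D_i$ need not be independent of each other nor of $N_\emptyset$. Particle labels. Let $\mathcal{T}=\bigcup_{n\in\mathbb{N}\cup\{0\}}\mathbb{N}^n$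 with $\mathbb{N}=\{1,2,\dots\}$ and $\mathbb{N}^0=\{\emptyset\}$, where $\emptyset$ is the initial particle. For $v=(v_1,\dots,v_n)\in\mathcal{T}$ and $i\in\mathbb{N}$ write $vi=(v_1,\dots,v_n,i)$; $v$ is the parent of $vi$. For $u=(u_i)_{i=1}^m$ and $v=(v_i)_{i=1}^n$ in $\mathcal{T}$, write $u\prec v$ if $m<n$ and $(u_i)_{i=1}^m=(v_i)_{i=1}^m$, and write $u\preceq v$ if $u\prec v$ or $u=v$. The process. Let $\left[(Z_{v,s})_{s\geq0},A_v,(D_{vi})_{i=1}^{N_v}\right]$, $v\in\mathcal{T}$, be i.i.d. copies of $\left[(Z_{\emptyset,s})_{s\geq0},A_\emptyset,(D_i)_{i=1}^{N_\emptyset}\right]$. The set of all particles ever to exist is $$\mathcal{T}^*=\left\{(v_i)_{i=1}^n\in\mathcal{T}:v_{m+1}\leq N_{(v_i)_{i=1}^m}\text{ for }m=0,1,\dots,n-1\right\}.$$ The set of particles alive at time $t\geq 0$ is $$\mathcal{T}_t=\left\{v\in\mathcal{T}^*:\sum_{u\prec v}A_u\leq t<\sum_{u\preceq v}A_u\right\}.$$ A particle $v\in\mathcal{T}_t$ has position at time $t$ $$X_{v,t}=\sum_{\emptyset\prec u\preceq v}D_u+\sum_{\emptyset\preceq u\prec v}Z_{u,A_u}+Z_{v,\,t-\sum_{\emptyset\preceq u\prec v}A_u}.$$ Rates. The branching rate is $\lambda=\mathbb{E}[A_\emptyset]^{-1}$, and the movement rate is $$r=\mathbb{E}[Z_{\emptyset,1}]+\lambda\,\mathbb{E}\left[\sum_{i=1}^{N_\emptyset}D_i\right].$$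 *)

theory Defs
  imports "HOL-Probability.Probability" "HOL-Library.Sublist"
begin

section \<open>Levy processes\<close>

definition cadlag :: "(real \<Rightarrow> real) \<Rightarrow> bool" where
  "cadlag f \<longleftrightarrow>
     (\<forall>s\<ge>0. continuous (at_right s) f) \<and> (\<forall>s>0. \<exists>l. (f \<longlongrightarrow> l) (at_left s))"

text \<open>
  Continuity in probability is not listed: it follows from stationarity of the increments
  and almost sure right-continuity at 0. Only times \<open>s \<ge> 0\<close> are constrained.
\<close>

locale levy_process = prob_space M for M :: "'a measure" +
  fixes X :: "real \<Rightarrow> 'a \<Rightarrow> real"
  assumes random_variable_X: "\<And>s. 0 \<le> s \<Longrightarrow> random_variable borel (X s)"
    and start_zero: "AE \<omega> in M. X 0 \<omega> = 0"
    and indep_increments: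
      "\<And>(n::nat) (s::nat \<Rightarrow> real). 0 \<le> s 0 \<Longrightarrow> (\<And>i. i < n \<Longrightarrow> s i \<le> s (Suc i)) \<Longrightarrow>
         indep_vars (\<lambda>_. borel) (\<lambda>i \<omega>. X (s (Suc i)) \<omega> - X (s i) \<omega>) {..<n}"
    and stationary_increments:
      "\<And>s h. 0 \<le> s \<Longrightarrow> 0 \<le> h \<Longrightarrow>
         distr M borel (\<lambda>\<omega>. X (s + h) \<omega> - X s \<omega>) = distr M borel (X h)"
    and cadlag_paths: "AE \<omega> in M. cadlag (\<lambda>s. X s \<omega>)"


section \<open>The ingredients attached to a particle\<close>

text \<open>
  Particles are labelled by finite lists of positive naturals; \<open>[]\<close> is the initial particle and
  \<open>v @ [i]\<close> the \<open>i\<close>-th child of \<open>v\<close>. The relations \<open>u \<prec> v\<close> and \<open>u \<preceq> v\<close> are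
  \<^const>\<open>strict_prefix\<close> and \<^const>\<open>prefix\<close>. Throughout, \<open>Z v s\<close> is the Levy motion of \<open>v\<close>,
  \<open>A v\<close> its lifetime, \<open>N v\<close> its number of offspring and \<open>D v\<close> its displacement from the death
  position of its parent; \<open>D []\<close> is never used.
\<close>

definition labels :: "nat list set" where
  "labels = lists {1..}"

abbreviation path_space :: "(real \<Rightarrow> real) measure" where
  "path_space \<equiv> PiM {0..} (\<lambda>_. borel)"

abbreviation offspring_space :: "(nat \<times> (nat \<Rightarrow> real)) measure" where
  "offspring_space \<equiv> count_space UNIV \<Otimes>\<^sub>M PiM UNIV (\<lambda>_. borel)"

definition motion :: "(nat list \<Rightarrow> real \<Rightarrow> 'a \<Rightarrow> real) \<Rightarrow> nat list \<Rightarrow> 'a \<Rightarrow> (real \<Rightarrow> real)" where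
  "motion Z v \<omega> = (\<lambda>s\<in>{0..}. Z v s \<omega>)"

text \<open>
  The finite random sequence \<open>(D (v @ [i]))\<close>, \<open>i = 1, \<dots>, N v\<close>, of random length is encoded as its
  length together with its extension by zero. Hence nothing is assumed about \<open>D (v @ [i])\<close> where
  \<open>i > N v\<close>.
\<close>

definition offspring ::
    "(nat list \<Rightarrow> 'a \<Rightarrow> nat) \<Rightarrow> (nat list \<Rightarrow> 'a \<Rightarrow> real) \<Rightarrow> nat list \<Rightarrow> 'a \<Rightarrow> nat \<times> (nat \<Rightarrow> real)" where
  "offspring N D v \<omega> = (N v \<omega>, \<lambda>i. if i \<in> {1..N v \<omega>} then D (v @ [i]) \<omega> else 0)"

definition particle_data ::
    "(nat list \<Rightarrow> real \<Rightarrow> 'a \<Rightarrow> real) \<Rightarrow> (nat list \<Rightarrow> 'a \<Rightarrow> real) \<Rightarrow> (nat list \<Rightarrow> 'a \<Rightarrow> nat) \<Rightarrow>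
     (nat list \<Rightarrow> 'a \<Rightarrow> real) \<Rightarrow> nat list \<Rightarrow> 'a \<Rightarrow>
     (real \<Rightarrow> real) \<times> real \<times> nat \<times> (nat \<Rightarrow> real)" where
  "particle_data Z A N D v \<omega> = (motion Z v \<omega>, A v \<omega>, offspring N D v \<omega>)"

abbreviation particle_space :: "((real \<Rightarrow> real) \<times> real \<times> nat \<times> (nat \<Rightarrow> real)) measure" where
  "particle_space \<equiv> path_space \<Otimes>\<^sub>M borel \<Otimes>\<^sub>M offspring_space"


section \<open>Supercritical branching Levy processes\<close>

text \<open>
  Equality of laws on \<^const>\<open>path_space\<close> does not transfer path regularity from \<open>Z []\<close> to its
  copies, so every \<open>Z v\<close> is required to be a Levy process. \<open>indep_ingredients\<close> is the mutual
  independence of the three sigma-algebras generated by the motion, the lifetime and the offspring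
  of the initial particle; \<open>indep_vars\<close> is not applicable as their value types differ.
\<close>

locale branching_levy_process = prob_space M for M :: "'a measure" +
  fixes Z :: "nat list \<Rightarrow> real \<Rightarrow> 'a \<Rightarrow> real"
    and A :: "nat list \<Rightarrow> 'a \<Rightarrow> real"
    and N :: "nat list \<Rightarrow> 'a \<Rightarrow> nat"
    and D :: "nat list \<Rightarrow> 'a \<Rightarrow> real"
  assumes levy: "\<And>v. v \<in> labels \<Longrightarrow> levy_process M (Z v)"
    and Z_square_integrable: "integrable M (\<lambda>\<omega>. (Z [] 1 \<omega>)\<^sup>2)"
    and A_exponential: "\<exists>l>0. distributed M lborel (A []) (exponential_density l)"
    and N_square_integrable: "integrable M (\<lambda>\<omega>. (real (N [] \<omega>))\<^sup>2)"
    and supercritical: "expectation (\<lambda>\<omega>. real (N [] \<omega>)) > 1"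
    and D_sum_square_integrable: "integrable M (\<lambda>\<omega>. (\<Sum>i=1..N [] \<omega>. D [i] \<omega>)\<^sup>2)"
    and D_square_sum_integrable: "integrable M (\<lambda>\<omega>. \<Sum>i=1..N [] \<omega>. (D [i] \<omega>)\<^sup>2)"
    and indep_ingredients:
      "indep_sets
         (\<lambda>k. [{motion Z [] -` B \<inter> space M | B. B \<in> sets path_space},
               {A [] -` B \<inter> space M | B. B \<in> sets borel},
               {offspring N D [] -` B \<inter> space M | B. B \<in> sets offspring_space}] ! k) {..<3}"
    and indep_particles: "indep_vars (\<lambda>_. particle_space) (particle_data Z A N D) labels"
    and identically_distributed:
      "\<And>v. v \<in> labels \<Longrightarrow>
         distr M particle_space (particle_data Z A N D v) =
         distr M particle_space (particle_data Z A N D [])"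

definition particles :: "(nat list \<Rightarrow> 'a \<Rightarrow> nat) \<Rightarrow> 'a \<Rightarrow> nat list set" where
  "particles N \<omega> = {v \<in> labels. \<forall>m<length v. v ! m \<le> N (take m v) \<omega>}"

text \<open>
  For a branching Levy process, almost surely \<open>alive A N t \<omega>\<close> is finite for all \<open>t\<close> (no explosion),
  so that \<^const>\<open>card\<close> and sums over this set have their intended meaning.
\<close>

definition alive ::
    "(nat list \<Rightarrow> 'a \<Rightarrow> real) \<Rightarrow> (nat list \<Rightarrow> 'a \<Rightarrow> nat) \<Rightarrow> real \<Rightarrow> 'a \<Rightarrow> nat list set" where
  "alive A N t \<omega> =
     {v \<in> particles N \<omega>. (\<Sum>u | strict_prefix u v. A u \<omega>) \<le> t \<and> t < (\<Sum>u | prefix u v. A u \<omega>)}"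

definition position ::
    "(nat list \<Rightarrow> real \<Rightarrow> 'a \<Rightarrow> real) \<Rightarrow> (nat list \<Rightarrow> 'a \<Rightarrow> real) \<Rightarrow> (nat list \<Rightarrow> 'a \<Rightarrow> real) \<Rightarrow>
     nat list \<Rightarrow> real \<Rightarrow> 'a \<Rightarrow> real" where
  "position Z A D v t \<omega> =
     (\<Sum>u | strict_prefix [] u \<and> prefix u v. D u \<omega>)
     + (\<Sum>u | strict_prefix u v. Z u (A u \<omega>) \<omega>)
     + Z v (t - (\<Sum>u | strict_prefix u v. A u \<omega>)) \<omega>"

definition branching_rate :: "'a measure \<Rightarrow> (nat list \<Rightarrow> 'a \<Rightarrow> real) \<Rightarrow> real" where
  "branching_rate M A = inverse (integral\<^sup>L M (A []))"

definition movement_rate ::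
    "'a measure \<Rightarrow> (nat list \<Rightarrow> real \<Rightarrow> 'a \<Rightarrow> real) \<Rightarrow> (nat list \<Rightarrow> 'a \<Rightarrow> real) \<Rightarrow>
     (nat list \<Rightarrow> 'a \<Rightarrow> nat) \<Rightarrow> (nat list \<Rightarrow> 'a \<Rightarrow> real) \<Rightarrow> real" where
  "movement_rate M Z A N D =
     integral\<^sup>L M (Z [] 1)
     + branching_rate M A * integral\<^sup>L M (\<lambda>\<omega>. \<Sum>i=1..N [] \<omega>. D [i] \<omega>)"

end

theory Submission
  imports Defs "HOL-Real_Asymp.Real_Asymp"
begin

text \<open>
  Let \<open>\<alpha> = \<lambda> (E N - 1)\<close>. Both \<open>exp (- \<alpha> t) |T_t|\<close> and
  \<open>exp (- \<alpha> t) \<Sum>(X_v - r t)\<close> are martingales that telescope into a sum over the particles born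
  up to time \<open>t\<close>, the term of a particle being what its own motion, death and offspring add.
  Realise the tree on a product space with one coordinate per particle. Given all other
  coordinates, the increments of a term have mean zero, so by Fubini different terms are orthogonal
  and no filtration is needed. The second moments of the increments after time \<open>k\<close> are
  \<open>O(exp (- \<alpha> k / 2))\<close>; Kolmogorov's maximal inequality on dyadic grids, the Borel-Cantelli lemma and
  right-continuity then give almost sure limits \<open>W\<close> and \<open>Y\<close> of the two martingales.

  The quotient converges to \<open>Y / W\<close> once \<open>W \<noteq> 0\<close>. On \<open>|T_s| \<ge> K\<close> the variance of the later
  increments of the first martingale, relative to the square of its value at time \<open>s\<close>, is
  \<open>O(1 / K)\<close>. By Chebyshev's inequality the probability that the population exceeds \<open>K\<close> and
  nevertheless \<open>W = 0\<close> is \<open>O(1 / K)\<close>, and \<open>K\<close> is arbitrary.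
\<close>

section \<open>Maximal inequality and resampling\<close>

text \<open>The obstacle is that finiteness of the population is itself a conclusion: the sums over
  the tree may a priori be infinite. Every estimate is therefore made for the finite label sets
  \<open>labels_upto n\<close>, uniformly in \<open>n\<close>. Non-explosion follows from one of
  these estimates; afterwards, for almost every sample point and each bounded time range, the
  restricted sums are exact from some \<open>n\<close> on, so bounds pass to the full tree as bounds
  on a lower limit of events. The discounts come from the equation m \<lambda> / (\<lambda> +
  \<theta>) = 1 with m = E N, solved by \<theta> = \<alpha>: at any larger rate the discounted
  generations contract geometrically. Squares carry the rate 2 \<alpha> up to birth. Of this, 3
  \<alpha> / 2 is kept for the contraction and \<alpha> / 2 is left as decay in time; within one
  particle the surplus pays for the quadratic growth of second moments. Adaptedness is expressed by
  substitution in one coordinate: a quantity known at time s does not change when a particle not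
  dead by s is replaced by a representative that agrees with it up to its age at s.\<close>

lemma (in prob_space) maximal_inequality:
  fixes S :: "nat \<Rightarrow> 'a \<Rightarrow> real"
  assumes int: "\<And>j. j \<le> n \<Longrightarrow> integrable M (S j)"
    and sq: "integrable M (\<lambda>\<omega>. (S n \<omega>)\<^sup>2)"
    and eps: "0 < \<epsilon>"
    and orth: "\<And>j. j \<le> n \<Longrightarrow> expectation (\<lambda>\<omega>. (S n \<omega> - S j \<omega>) *
      (if \<epsilon> < \<bar>S j \<omega>\<bar> \<and> (\<forall>i<j. \<bar>S i \<omega>\<bar> \<le> \<epsilon>) then sgn (S j \<omega>) else 0)) = 0"
  shows "prob {\<omega> \<in> space M. \<exists>j\<le>n. \<epsilon> < \<bar>S j \<omega>\<bar>} \<le> expectation (\<lambda>\<omega>. (S n \<omega>)\<^sup>2) / \<epsilon>\<^sup>2"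
proof -
  define F where "F j \<omega> \<longleftrightarrow> \<epsilon> < \<bar>S j \<omega>\<bar> \<and> (\<forall>i<j. \<bar>S i \<omega>\<bar> \<le> \<epsilon>)" for j \<omega>
  \<comment> \<open>The martingale property enters through these bounded multipliers, one for each
    possible first exceedance time \<open>j\<close>: \<open>orth\<close> says that the later
    increment integrates to zero against them.\<close>
  define H where "H j \<omega> = (if F j \<omega> then sgn (S j \<omega>) else 0)" for j \<omega>
  let ?E = "{\<omega> \<in> space M. \<exists>j\<le>n. \<epsilon> < \<bar>S j \<omega>\<bar>}"
  have Sm[measurable]: "S j \<in> borel_measurable M" if "j \<le> n" for j
    using int[OF that] by auto
  have Fm: "Measurable.pred M (F j)" if "j \<le> n" for j
  proof -
    note [measurable] = Sm[OF that]
    have [measurable]: "S i \<in> borel_measurable M" if "i < j" for i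
      using Sm[of i] that \<open>j \<le> n\<close> by simp
    have "Measurable.pred M (\<lambda>\<omega>. \<forall>i\<in>{..<j}. \<bar>S i \<omega>\<bar> \<le> \<epsilon>)"
      by (intro pred_intros_finite) auto
    then show ?thesis unfolding F_def[abs_def] lessThan_iff Ball_def by measurable
  qed
  have Hm: "H j \<in> borel_measurable M" if "j \<le> n" for j
    using Fm[OF that] Sm[OF that] unfolding H_def[abs_def] by measurable
  have Em: "?E \<in> sets M"
  proof -
    have "?E = (\<Union>j\<in>{..n}. {\<omega> \<in> space M. \<epsilon> < \<bar>S j \<omega>\<bar>})" by auto
    also have "\<dots> \<in> sets M" using Sm by (intro sets.finite_UN) auto
    finally show ?thesis .
  qed
  have ind: "indicator ?E \<omega> = (\<Sum>j\<le>n. if F j \<omega> then 1 else 0 :: real)" if "\<omega> \<in> space M" for \<omega>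
  proof (cases "\<omega> \<in> ?E")
    case True
    then have ex: "\<exists>j. j \<le> n \<and> \<epsilon> < \<bar>S j \<omega>\<bar>" by auto
    define k where "k = (LEAST j. j \<le> n \<and> \<epsilon> < \<bar>S j \<omega>\<bar>)"
    have k: "k \<le> n" "\<epsilon> < \<bar>S k \<omega>\<bar>" using LeastI_ex[OF ex] by (auto simp: k_def)
    have less: "\<bar>S i \<omega>\<bar> \<le> \<epsilon>" if "i < k" for i
      using not_less_Least[OF that[unfolded k_def]] that k(1) by auto
    have "F j \<omega> \<longleftrightarrow> j = k" if "j \<le> n" for j
      using k less that unfolding F_def by (metis not_less linorder_neqE_nat)
    then have "(\<Sum>j\<le>n. if F j \<omega> then 1 else 0 :: real) = (\<Sum>j\<le>n. if j = k then 1 else 0)"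
      by (intro sum.cong) auto
    then show ?thesis using True k by simp
  next
    case False
    then have "\<not> F j \<omega>" if "j \<le> n" for j using that \<open>\<omega> \<in> space M\<close> by (auto simp: F_def)
    then show ?thesis using False by simp
  qed
  have HS: "integrable M (\<lambda>\<omega>. (S n \<omega> - S j \<omega>) * H j \<omega>)" if "j \<le> n" for j
  proof (rule Bochner_Integration.integrable_bound)
    show "integrable M (\<lambda>\<omega>. S n \<omega> - S j \<omega>)" using int that by auto
    show "(\<lambda>\<omega>. (S n \<omega> - S j \<omega>) * H j \<omega>) \<in> borel_measurable M" using Hm that by measurable
  qed (auto simp: H_def sgn_if)
  \<comment> \<open>Expanding the square of
    \<open>S n \<omega> - \<epsilon> * sgn (S j \<omega>)\<close> and using that
    \<open>S j \<omega> * sgn (S j \<omega>)\<close> exceeds \<epsilon> on \<open>F j\<close> gives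
    the bound pointwise. Summed over the disjoint events \<open>F j\<close> and integrated, the last
    term drops out by \<open>orth\<close>.\<close>
  have key: "\<epsilon>\<^sup>2 * (if F j \<omega> then 1 else 0) \<le>
      (S n \<omega>)\<^sup>2 * (if F j \<omega> then 1 else 0) - 2 * \<epsilon> * ((S n \<omega> - S j \<omega>) * H j \<omega>)" for j \<omega>
  proof (cases "F j \<omega>")
    case True
    then have h: "H j \<omega> = sgn (S j \<omega>)" "\<epsilon> < \<bar>S j \<omega>\<bar>" by (auto simp: H_def F_def)
    have "0 \<le> (S n \<omega> - \<epsilon> * sgn (S j \<omega>))\<^sup>2" by simp
    also have "\<dots> = (S n \<omega>)\<^sup>2 - 2 * \<epsilon> * (S n \<omega> * sgn (S j \<omega>)) + \<epsilon>\<^sup>2"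
      using h(2) eps by (auto simp: power2_eq_square sgn_if algebra_simps)
    finally have 1: "2 * \<epsilon> * (S n \<omega> * sgn (S j \<omega>)) \<le> (S n \<omega>)\<^sup>2 + \<epsilon>\<^sup>2" by simp
    have "\<epsilon> * \<epsilon> \<le> \<epsilon> * \<bar>S j \<omega>\<bar>" using h(2) eps by (intro mult_left_mono) auto
    moreover have "S j \<omega> * sgn (S j \<omega>) = \<bar>S j \<omega>\<bar>" by (simp add: abs_sgn)
    ultimately have "2 * \<epsilon>\<^sup>2 \<le> 2 * \<epsilon> * (S j \<omega> * sgn (S j \<omega>))" by (simp add: power2_eq_square)
    with 1 True h(1) show ?thesis by (simp add: algebra_simps)
  qed (simp add: H_def)
  have "\<epsilon>\<^sup>2 * prob ?E = expectation (\<lambda>\<omega>. \<epsilon>\<^sup>2 * indicator ?E \<omega>)"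
    using Em by simp
  also have "\<dots> \<le> expectation (\<lambda>\<omega>. (S n \<omega>)\<^sup>2 - (\<Sum>j\<le>n. 2 * \<epsilon> * ((S n \<omega> - S j \<omega>) * H j \<omega>)))"
  proof (rule integral_mono)
    show "integrable M (\<lambda>\<omega>. \<epsilon>\<^sup>2 * indicator ?E \<omega> :: real)"
      using integrable_real_indicator[OF Em] by (intro integrable_mult_right) (simp add: less_top[symmetric])
    show "integrable M (\<lambda>\<omega>. (S n \<omega>)\<^sup>2 - (\<Sum>j\<le>n. 2 * \<epsilon> * ((S n \<omega> - S j \<omega>) * H j \<omega>)))"
      using sq HS by (intro Bochner_Integration.integrable_diff Bochner_Integration.integrable_sum integrable_mult_right) auto
    fix \<omega> assume \<omega>: "\<omega> \<in> space M"
    have "\<epsilon>\<^sup>2 * indicator ?E \<omega> \<le> (S n \<omega>)\<^sup>2 * indicator ?E \<omega> - (\<Sum>j\<le>n. 2 * \<epsilon> * ((S n \<omega> - S j \<omega>) * H j \<omega>))"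
      unfolding ind[OF \<omega>] sum_distrib_left sum_subtractf[symmetric] by (intro sum_mono key)
    also have "\<dots> \<le> (S n \<omega>)\<^sup>2 - (\<Sum>j\<le>n. 2 * \<epsilon> * ((S n \<omega> - S j \<omega>) * H j \<omega>))"
      by (auto simp: indicator_def)
    finally show "\<epsilon>\<^sup>2 * indicator ?E \<omega> \<le> (S n \<omega>)\<^sup>2 - (\<Sum>j\<le>n. 2 * \<epsilon> * ((S n \<omega> - S j \<omega>) * H j \<omega>))" .
  qed
  also have "\<dots> = expectation (\<lambda>\<omega>. (S n \<omega>)\<^sup>2) - (\<Sum>j\<le>n. 2 * \<epsilon> * expectation (\<lambda>\<omega>. (S n \<omega> - S j \<omega>) * H j \<omega>))"
    using sq HS by (subst Bochner_Integration.integral_diff) (auto intro!: Bochner_Integration.integrable_sum)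
  also have "\<dots> = expectation (\<lambda>\<omega>. (S n \<omega>)\<^sup>2)"
    using orth by (simp add: H_def F_def)
  finally show ?thesis using eps by (simp add: field_simps)
qed

text \<open>The intersections increase with \<open>m\<close> and each lies in the single event
  \<open>E m\<close>, so a bound uniform in \<open>n\<close> survives in the lower limit. This is
  how bounds for finite label sets reach the whole tree: at a given point the restricted quantities
  are eventually the true ones, but from an index that depends on the point.\<close>

lemma (in prob_space) prob_liminf_le:
  assumes E: "\<And>n::nat. E n \<in> events" and le: "\<And>n. prob (E n) \<le> C"
  shows "(\<Union>m. \<Inter>n\<in>{m..}. E n) \<in> events" "prob (\<Union>m. \<Inter>n\<in>{m..}. E n) \<le> C"
proof -
  have m: "(\<Inter>n\<in>{m..}. E n) \<in> events" for m using E by (intro sets.countable_INT') auto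
  then show "(\<Union>m. \<Inter>n\<in>{m..}. E n) \<in> events" by auto
  have "(\<lambda>m. prob (\<Inter>n\<in>{m..}. E n)) \<longlonglongrightarrow> prob (\<Union>m. \<Inter>n\<in>{m..}. E n)"
    using m by (intro finite_Lim_measure_incseq) (auto simp: incseq_def)
  moreover have "prob (\<Inter>n\<in>{m..}. E n) \<le> C" for m
    using finite_measure_mono[of "\<Inter>n\<in>{m..}. E n" "E m"] E[of m] le[of m] by fastforce
  ultimately show "prob (\<Union>m. \<Inter>n\<in>{m..}. E n) \<le> C"
    by (intro LIMSEQ_le_const2) auto
qed

section \<open>Replacing one coordinate of a product measure by an independent copy\<close>

context product_prob_space
begin

lemma measurable_fun_upd_PiM:
  "i \<in> I \<Longrightarrow> (\<lambda>(x, w). w(i := x)) \<in> M i \<Otimes>\<^sub>M PiM I M \<rightarrow>\<^sub>M PiM I M"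
  using measurable_fun_upd[where I=I and J="I" and i=i and M=M] 
  by (auto intro!: measurable_fun_upd simp: split_beta' insert_absorb)

text \<open>Overwriting coordinate \<open>i\<close> by an independent copy preserves the product
  law, so coordinate \<open>i\<close> may be integrated out first with all others fixed. This is
  conditioning on the other coordinates without conditional expectations.\<close>

lemma nn_integral_resample:
  assumes i: "i \<in> I" and f[measurable]: "f \<in> borel_measurable (PiM I M)"
  shows "(\<integral>\<^sup>+w. f w \<partial>PiM I M) = (\<integral>\<^sup>+w. (\<integral>\<^sup>+x. f (w(i := x)) \<partial>M i) \<partial>PiM I M)"
proof -
  note upd[measurable] = measurable_fun_upd_PiM[OF i]
  interpret pair_sigma_finite "M i" "PiM I M" ..
  have "(\<integral>\<^sup>+w. f w \<partial>PiM I M) = (\<integral>\<^sup>+w. f w \<partial>distr (M i \<Otimes>\<^sub>M PiM I M) (PiM I M) (\<lambda>(x, w). w(i := x)))"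
    using distr_pair_PiM_eq_PiM[of I M i] i by (simp add: insert_absorb prob_space_axioms M.prob_space_axioms)
  also have "\<dots> = (\<integral>\<^sup>+p. f ((\<lambda>(x, w). w(i := x)) p) \<partial>(M i \<Otimes>\<^sub>M PiM I M))"
    by (rule nn_integral_distr) auto
  also have "\<dots> = (\<integral>\<^sup>+w. (\<integral>\<^sup>+x. f (w(i := x)) \<partial>M i) \<partial>PiM I M)"
    using nn_integral_snd[of "\<lambda>p. f ((\<lambda>(x, w). w(i := x)) p)"] by (simp add: split_beta')
  finally show ?thesis .
qed

lemma integral_resample:
  fixes f :: "_ \<Rightarrow> real"
  assumes i: "i \<in> I" and f: "integrable (PiM I M) f"
  shows "(\<integral>w. f w \<partial>PiM I M) = (\<integral>w. (\<integral>x. f (w(i := x)) \<partial>M i) \<partial>PiM I M)"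
proof -
  note upd[measurable] = measurable_fun_upd_PiM[OF i]
  have fm[measurable]: "f \<in> borel_measurable (PiM I M)" using f by auto
  interpret pair_sigma_finite "M i" "PiM I M" ..
  have eq: "distr (M i \<Otimes>\<^sub>M PiM I M) (PiM I M) (\<lambda>(x, w). w(i := x)) = PiM I M"
    using distr_pair_PiM_eq_PiM[of I M i] i by (simp add: insert_absorb prob_space_axioms M.prob_space_axioms)
  have int: "integrable (M i \<Otimes>\<^sub>M PiM I M) (\<lambda>p. f ((\<lambda>(x, w). w(i := x)) p))"
    by (rule integrable_distr[OF upd]) (simp add: eq f)
  have "(\<integral>w. f w \<partial>PiM I M) = (\<integral>w. f w \<partial>distr (M i \<Otimes>\<^sub>M PiM I M) (PiM I M) (\<lambda>(x, w). w(i := x)))"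
    by (simp add: eq)
  also have "\<dots> = (\<integral>p. f ((\<lambda>(x, w). w(i := x)) p) \<partial>(M i \<Otimes>\<^sub>M PiM I M))"
    by (rule integral_distr) auto
  also have "\<dots> = (\<integral>w. (\<integral>x. f (w(i := x)) \<partial>M i) \<partial>PiM I M)"
    using integral_snd[of "\<lambda>x w. f (w(i := x))"] int by (simp add: split_beta')
  finally show ?thesis .
qed

end

section \<open>Levy processes: random times and moments\<close>

text \<open>
  Evaluation of a path at a random time is not measurable on \<^const>\<open>PiM\<close>, whose sets depend on
  countably many times only. The following version sees the path at rational times only, and agrees
  with evaluation for right-continuous paths.
\<close>

definition eval_right :: "(real \<Rightarrow> real) \<Rightarrow> real \<Rightarrow> real" where
  "eval_right z a = lim (\<lambda>n. z (max 0 ((real_of_int \<lfloor>real (Suc n) * a\<rfloor> + 1) / real (Suc n))))"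

text \<open>Functions of \<open>stopped s z\<close> play the role of functions measurable with
  respect to the past up to age \<open>s\<close>. A negative age, which later means a particle not
  yet born, is treated as age 0.\<close>

definition stopped :: "real \<Rightarrow> (real \<Rightarrow> real) \<Rightarrow> real \<Rightarrow> real" where
  "stopped s z = (\<lambda>r\<in>{0..}. z (min r (max 0 s)))"

text \<open>The \<open>+ 1\<close> puts every grid point strictly to the right of \<open>a\<close>,
  so that right-continuity of a path is what evaluation along the grid calls for.\<close>

lemma filterlim_grid_at_right:
  "filterlim (\<lambda>n. (real_of_int \<lfloor>real (Suc n) * a\<rfloor> + 1) / real (Suc n)) (at_right a) sequentially"
proof (rule tendsto_imp_filterlim_at_right)
  let ?g = "\<lambda>n. (real_of_int \<lfloor>real (Suc n) * a\<rfloor> + 1) / real (Suc n)"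
  have gt: "a < ?g n" for n
  proof -
    have "real (Suc n) * a < real_of_int \<lfloor>real (Suc n) * a\<rfloor> + 1" by linarith
    then show ?thesis by (simp add: field_simps del: of_nat_Suc)
  qed
  have le: "?g n \<le> a + 1 / real (Suc n)" for n
  proof -
    have "real_of_int \<lfloor>real (Suc n) * a\<rfloor> \<le> real (Suc n) * a" by linarith
    then show ?thesis by (simp add: field_simps del: of_nat_Suc)
  qed
  have "(\<lambda>n. a + 1 / real (Suc n)) \<longlonglongrightarrow> a"
    using tendsto_add[OF tendsto_const[of a] LIMSEQ_inverse_real_of_nat] by (simp add: inverse_eq_divide)
  from tendsto_sandwich[OF _ _ tendsto_const this, of ?g]
  show "?g \<longlonglongrightarrow> a"
    using gt le by (simp add: less_imp_le del: of_nat_Suc)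
  show "\<forall>\<^sub>F n in sequentially. a < ?g n" using gt by (auto intro!: always_eventually simp del: of_nat_Suc)
qed

lemma eval_right_eq:
  assumes "0 \<le> a" "continuous (at_right a) z"
  shows "eval_right z a = z a"
proof -
  let ?g = "\<lambda>n. (real_of_int \<lfloor>real (Suc n) * a\<rfloor> + 1) / real (Suc n)"
  have g: "\<forall>\<^sub>F n in sequentially. a < ?g n"
    using filterlim_grid_at_right[of a, unfolded filterlim_at] by (auto elim!: eventually_mono)
  have "(z \<longlongrightarrow> z a) (at_right a)" using assms(2) by (simp add: continuous_within)
  from filterlim_compose[OF this filterlim_grid_at_right]
  have "(\<lambda>n. z (?g n)) \<longlonglongrightarrow> z a" .
  moreover have "\<forall>\<^sub>F n in sequentially. z (max 0 (?g n)) = z (?g n)"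
    using g by eventually_elim (use assms(1) in simp)
  ultimately have "(\<lambda>n. z (max 0 (?g n))) \<longlonglongrightarrow> z a"
    by (simp add: tendsto_cong)
  then show ?thesis unfolding eval_right_def by (rule limI)
qed

lemma eval_right_cong:
  assumes "0 \<le> a" "a < b" "\<And>s. a < s \<Longrightarrow> s < b \<Longrightarrow> z s = z' s"
  shows "eval_right z a = eval_right z' a"
proof -
  let ?g = "\<lambda>n. (real_of_int \<lfloor>real (Suc n) * a\<rfloor> + 1) / real (Suc n)"
  have "\<forall>\<^sub>F s in at_right a. a < s \<and> s < b"
    using assms(2) eventually_at_right by blast
  then have "\<forall>\<^sub>F n in sequentially. a < ?g n \<and> ?g n < b"
    using filterlim_grid_at_right[of a] unfolding filterlim_iff by blast
  then have "\<forall>\<^sub>F n in sequentially. z (max 0 (?g n)) = z' (max 0 (?g n))"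
    by eventually_elim (use assms in auto)
  then have "((\<lambda>n. z (max 0 (?g n))) \<longlonglongrightarrow> L) \<longleftrightarrow> ((\<lambda>n. z' (max 0 (?g n))) \<longlonglongrightarrow> L)" for L
    by (rule tendsto_cong)
  then show ?thesis unfolding eval_right_def lim_def by simp
qed

lemma eval_right_const: "0 \<le> a \<Longrightarrow> a < b \<Longrightarrow> (\<And>s. a < s \<Longrightarrow> s < b \<Longrightarrow> z s = k) \<Longrightarrow> eval_right z a = k"
  using eval_right_cong[of a b z "\<lambda>_. k"] eval_right_eq[of a "\<lambda>_. k"] by simp

text \<open>The delicate point is \<open>a = s\<close>: the stopped path is constant to the right of
  \<open>s\<close>, whereas \<open>eval_right z s\<close> looks beyond \<open>s\<close>. The
  hypothesis at \<open>s\<close> reconciles the two; under the law of the motion it holds almost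
  surely.\<close>

lemma eval_right_stopped:
  assumes "0 \<le> a" "a \<le> s" and right: "eval_right z s = z s"
  shows "eval_right (stopped s z) a = eval_right z a"
proof (cases "a < s")
  case True
  then show ?thesis using assms by (intro eval_right_cong[of a s]) (auto simp: stopped_def)
next
  case False
  then have "a = s" using assms by simp
  have "eval_right (stopped s z) a = z s"
    using assms \<open>a = s\<close> by (intro eval_right_const[of a "a + 1"]) (auto simp: stopped_def)
  then show ?thesis using right \<open>a = s\<close> by simp
qed

lemma eval_right_restrict [simp]: "eval_right (restrict z {0..}) a = eval_right z a"
  unfolding eval_right_def by simp

text \<open>For negative \<open>s\<close> the coordinate lies outside the index set, where every
  element of the extensional product takes the value \<open>undefined\<close>; hence it is
  constant.\<close>

lemma path_component_measurable: "(\<lambda>z. z s) \<in> borel_measurable path_space"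
proof (cases "0 \<le> s")
  case False
  then have "(\<lambda>z. z s) \<in> borel_measurable path_space \<longleftrightarrow> (\<lambda>z. undefined :: real) \<in> borel_measurable path_space"
    by (intro measurable_cong) (auto simp: space_PiM PiE_iff extensional_def)
  then show ?thesis by simp
qed simp

text \<open>For fixed \<open>n\<close> the grid point is determined by an integer, so the path is
  read at countably many fixed times and each reading is a coordinate.\<close>

lemma eval_right_measurable [measurable]:
  "(\<lambda>(z, a). eval_right z a) \<in> borel_measurable (path_space \<Otimes>\<^sub>M borel)"
proof -
  have "(\<lambda>p. (fst p) (max 0 ((real_of_int \<lfloor>real (Suc n) * snd p\<rfloor> + 1) / real (Suc n))))
    \<in> borel_measurable (path_space \<Otimes>\<^sub>M borel)" for n
  proof (rule measurable_compose_countable[where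
        f = "\<lambda>i p. fst p (max 0 ((real_of_int i + 1) / real (Suc n)))" and g = "\<lambda>p. \<lfloor>real (Suc n) * snd p\<rfloor>"])
    fix i :: int
    show "(\<lambda>p. fst p (max 0 ((real_of_int i + 1) / real (Suc n)))) \<in> borel_measurable (path_space \<Otimes>\<^sub>M borel)"
      by (rule measurable_compose[OF measurable_fst path_component_measurable])
    show "(\<lambda>p. \<lfloor>real (Suc n) * snd p\<rfloor>) \<in> path_space \<Otimes>\<^sub>M borel \<rightarrow>\<^sub>M count_space UNIV"
      by measurable
  qed
  then show ?thesis unfolding eval_right_def split_beta' by (intro borel_measurable_lim_metric)
qed

lemma stopped_measurable [measurable]: "stopped s \<in> path_space \<rightarrow>\<^sub>M path_space"
  unfolding stopped_def by (intro measurable_restrict path_component_measurable)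

text \<open>By independence and Fubini, \<open>(u + V)\<^sup>2\<close> is integrable for almost
  every value \<open>u\<close> of \<open>U\<close>, and one such \<open>u\<close> suffices to
  dominate the square of \<open>V\<close>. The lemma carries square integrability from an integer
  time down to earlier times.\<close>

lemma (in prob_space) integrable_square_summand:
  fixes U V :: "'a \<Rightarrow> real"
  assumes ind: "indep_var borel U borel V" and int: "integrable M (\<lambda>\<omega>. (U \<omega> + V \<omega>)\<^sup>2)"
  shows "integrable M (\<lambda>\<omega>. (V \<omega>)\<^sup>2)"
proof -
  have [measurable]: "U \<in> borel_measurable M" "V \<in> borel_measurable M"
    using ind by (auto dest: indep_var_rv1 indep_var_rv2)
  interpret U: prob_space "distr M borel U" by (rule prob_space_distr) simp
  interpret V: prob_space "distr M borel V" by (rule prob_space_distr) simp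
  interpret P: pair_sigma_finite "distr M borel U" "distr M borel V" ..
  have "distr M borel U \<Otimes>\<^sub>M distr M borel V = distr M (borel \<Otimes>\<^sub>M borel) (\<lambda>\<omega>. (U \<omega>, V \<omega>))"
    using ind unfolding indep_var_distribution_eq by simp
  then have "integrable (distr M borel U \<Otimes>\<^sub>M distr M borel V) (\<lambda>(u, v). (u + v)\<^sup>2)"
    using int by (simp add: integrable_distr_eq split_beta')
  then have "AE u in distr M borel U. integrable (distr M borel V) (\<lambda>v. (u + v)\<^sup>2)"
    using P.AE_integrable_fst[of "\<lambda>u v. (u + v)\<^sup>2"] by simp
  then obtain u where u: "integrable (distr M borel V) (\<lambda>v. (u + v)\<^sup>2)"
    using U.AE_False by (metis (mono_tags, lifting) U.prob_space_axioms eventually_mono)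
  have "integrable (distr M borel V) (\<lambda>v. v\<^sup>2)"
  proof (rule Bochner_Integration.integrable_bound)
    show "integrable (distr M borel V) (\<lambda>v. 2 * (u + v)\<^sup>2 + 2 * u\<^sup>2)" using u by simp
    have "v\<^sup>2 \<le> 2 * (u + v)\<^sup>2 + 2 * u\<^sup>2" for v :: real
      using zero_le_power2[of "v + 2 * u"] by (simp add: power2_eq_square algebra_simps)
    then show "AE v in distr M borel V. norm (v\<^sup>2) \<le> norm (2 * (u + v)\<^sup>2 + 2 * u\<^sup>2)" by simp
  qed simp
  then show ?thesis by (simp add: integrable_distr_eq)
qed

lemma integrable_square_add:
  fixes f g :: "'a \<Rightarrow> real"
  assumes [measurable]: "f \<in> borel_measurable M" "g \<in> borel_measurable M"
    and "integrable M (\<lambda>x. (f x)\<^sup>2)" "integrable M (\<lambda>x. (g x)\<^sup>2)"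
  shows "integrable M (\<lambda>x. (f x + g x)\<^sup>2)"
proof (rule Bochner_Integration.integrable_bound)
  show "integrable M (\<lambda>x. 2 * (f x)\<^sup>2 + 2 * (g x)\<^sup>2)" using assms by simp
  have "(a + b)\<^sup>2 \<le> 2 * a\<^sup>2 + 2 * b\<^sup>2" for a b :: real
    using zero_le_power2[of "a - b"] by (simp add: power2_eq_square algebra_simps)
  then show "AE x in M. norm ((f x + g x)\<^sup>2) \<le> norm (2 * (f x)\<^sup>2 + 2 * (g x)\<^sup>2)" by simp
qed simp

lemma integrable_mult_L2:
  fixes f g :: "'a \<Rightarrow> real"
  assumes [measurable]: "f \<in> borel_measurable M" "g \<in> borel_measurable M"
    and "integrable M (\<lambda>x. (f x)\<^sup>2)" "integrable M (\<lambda>x. (g x)\<^sup>2)"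
  shows "integrable M (\<lambda>x. f x * g x)"
proof (rule Bochner_Integration.integrable_bound)
  show "integrable M (\<lambda>x. (f x)\<^sup>2 + (g x)\<^sup>2)" using assms by simp
  have "\<bar>a * b\<bar> \<le> a\<^sup>2 + b\<^sup>2" for a b :: real
    using sum_squares_bound[of "\<bar>a\<bar>" "\<bar>b\<bar>"] by (simp add: abs_mult)
      (metis abs_mult abs_ge_zero add_nonneg_nonneg dual_order.trans mult_2 le_add_same_cancel1 mult.assoc zero_le_mult_iff)
  then show "AE x in M. norm (f x * g x) \<le> norm ((f x)\<^sup>2 + (g x)\<^sup>2)" by simp
qed simp

section \<open>Increments of a Levy process are independent of the past\<close>

context levy_process
begin

definition path_law :: "(real \<Rightarrow> real) measure" where
  "path_law = distr M path_space (\<lambda>\<omega>. \<lambda>s\<in>{0..}. X s \<omega>)"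

lemma path_measurable [measurable]: "(\<lambda>\<omega>. \<lambda>s\<in>{0..}. X s \<omega>) \<in> M \<rightarrow>\<^sub>M path_space"
  using random_variable_X by (intro measurable_restrict) auto

text \<open>The locale gives independence of consecutive increments along one partition. The points
  of \<open>J\<close>, together with 0 and \<open>s\<close>, are sorted into such a partition ending
  in \<open>t\<close>; the values at \<open>J\<close> are then partial sums of the increments before
  the last one.\<close>

lemma indep_increment_finite:
  assumes J: "finite J" "J \<subseteq> {0..s}" and s: "0 \<le> s" "s \<le> t"
    and A: "A \<in> sets borel" and B: "B \<in> sets (PiM J (\<lambda>_. borel))"
  shows "prob ((\<lambda>\<omega>. X t \<omega> - X s \<omega>) -` A \<inter> space M \<inter> ((\<lambda>\<omega>. \<lambda>j\<in>J. X j \<omega> - X 0 \<omega>) -` B \<inter> space M)) =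
    prob ((\<lambda>\<omega>. X t \<omega> - X s \<omega>) -` A \<inter> space M) *
    prob ((\<lambda>\<omega>. \<lambda>j\<in>J. X j \<omega> - X 0 \<omega>) -` B \<inter> space M)"
proof -
  define K where "K = insert 0 (insert s J)"
  define l where "l = sorted_list_of_set K"
  define n where "n = length l"
  \<comment> \<open>Beyond the sorted list the partition continues with \<open>t\<close>, so
    \<open>T (n - 1) = s\<close> and the increment with index \<open>n - 1\<close> is the one from
    \<open>s\<close> to \<open>t\<close>.\<close>
  define T where "T i = (if i < n then l ! i else t)" for i
  have K: "finite K" "K \<noteq> {}" "K \<subseteq> {0..s}" "0 \<in> K" "s \<in> K" using J s by (auto simp: K_def)
  have l: "set l = K" "sorted l" "distinct l" using K by (auto simp: l_def)
  then have n: "n > 0" using K by (auto simp: n_def)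
  have T_in: "T i \<in> {0..s}" if "i < n" for i
    using that nth_mem[of i l] K(3) l(1) by (auto simp: T_def n_def)
  have T0: "T 0 = 0"
  proof -
    obtain k where k: "k < n" "l ! k = 0" using K(4) l(1) by (metis in_set_conv_nth n_def)
    then have "T 0 \<le> 0" using l(2) n by (simp add: T_def n_def sorted_nth_mono[of l 0 k, simplified])
         (metis le0 sorted_nth_mono)
    then show ?thesis using T_in[OF n] by auto
  qed
  have Tn: "T (n - 1) = s"
  proof -
    obtain k where k: "k < n" "l ! k = s" using K(5) l(1) by (metis in_set_conv_nth n_def)
    then have "l ! k \<le> l ! (n - 1)" using l(2) n by (intro sorted_nth_mono) (auto simp: n_def)
    then show ?thesis using T_in[of "n - 1"] n k by (auto simp: T_def)
  qed
  have mono: "T i \<le> T (Suc i)" if "i < n" for i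
  proof (cases "Suc i < n")
    case True then show ?thesis using l(2) by (simp add: T_def n_def sorted_nth_mono)
  next
    case False then show ?thesis using that T_in[OF that] s by (simp add: T_def)
  qed
  define Y where "Y i \<omega> = X (T (Suc i)) \<omega> - X (T i) \<omega>" for i \<omega>
  have ind: "indep_vars (\<lambda>_. borel) Y {..<n}"
    unfolding Y_def[abs_def] using T0 mono by (intro indep_increments) auto
  have R: "indep_var (PiM {n - 1} (\<lambda>_. borel)) (\<lambda>\<omega>. restrict (\<lambda>i. Y i \<omega>) {n - 1})
      (PiM {..<n - 1} (\<lambda>_. borel)) (\<lambda>\<omega>. restrict (\<lambda>i. Y i \<omega>) {..<n - 1})"
    using n by (intro indep_var_restrict[OF ind]) auto
  have "\<exists>k\<le>n - 1. T k = j" if "j \<in> J" for j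
  proof -
    have "j \<in> set l" using that l(1) by (simp add: K_def)
    then obtain k where "k < n" "l ! k = j" by (metis in_set_conv_nth n_def)
    then show ?thesis by (intro exI[of _ k]) (auto simp: T_def)
  qed
  then obtain k where k: "\<And>j. j \<in> J \<Longrightarrow> k j \<le> n - 1 \<and> T (k j) = j" by metis
  let ?R1 = "\<lambda>\<omega>. restrict (\<lambda>i. Y i \<omega>) {n - 1}" and ?R2 = "\<lambda>\<omega>. restrict (\<lambda>i. Y i \<omega>) {..<n - 1}"
  let ?f1 = "\<lambda>f. f (n - 1) :: real" and ?f2 = "\<lambda>f. \<lambda>j\<in>J. \<Sum>i<k j. f i :: real"
  have f1: "?f1 \<in> borel_measurable (PiM {n - 1} (\<lambda>_. borel))" by measurable
  have f2: "?f2 \<in> PiM {..<n - 1} (\<lambda>_. borel) \<rightarrow>\<^sub>M PiM J (\<lambda>_. borel)"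
  proof (intro measurable_restrict borel_measurable_sum)
    fix j i assume "j \<in> J" "i \<in> {..<k j}"
    then have "i \<in> {..<n - 1}" using k[of j] by auto
    then show "(\<lambda>f. f i) \<in> borel_measurable (PiM {..<n - 1} (\<lambda>_. borel :: real measure))" by measurable
  qed
  have e1: "?f1 (?R1 \<omega>) = X t \<omega> - X s \<omega>" for \<omega>
    using n Tn by (auto simp: Y_def T_def)
  have e2: "?f2 (?R2 \<omega>) = (\<lambda>j\<in>J. X j \<omega> - X 0 \<omega>)" for \<omega>
  proof -
    have "(\<Sum>i<k j. restrict (\<lambda>i. Y i \<omega>) {..<n - 1} i) = X j \<omega> - X 0 \<omega>" if "j \<in> J" for j
    proof -
      have "(\<Sum>i<k j. restrict (\<lambda>i. Y i \<omega>) {..<n - 1} i) = (\<Sum>i<k j. X (T (Suc i)) \<omega> - X (T i) \<omega>)"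
        using k[OF that] by (intro sum.cong) (auto simp: Y_def)
      also have "\<dots> = X (T (k j)) \<omega> - X (T 0) \<omega>" by (rule sum_lessThan_telescope)
      finally show ?thesis using k[OF that] T0 by simp
    qed
    then show ?thesis by (auto simp: fun_eq_iff)
  qed
  have R1: "?R1 \<in> M \<rightarrow>\<^sub>M PiM {n - 1} (\<lambda>_. borel)" and R2: "?R2 \<in> M \<rightarrow>\<^sub>M PiM {..<n - 1} (\<lambda>_. borel)"
    using R by (auto dest: indep_var_rv1 indep_var_rv2)
  let ?A = "?f1 -` A \<inter> space (PiM {n - 1} (\<lambda>_. borel))" and ?B = "?f2 -` B \<inter> space (PiM {..<n - 1} (\<lambda>_. borel))"
  have A': "?R1 -` ?A \<inter> space M = (\<lambda>\<omega>. X t \<omega> - X s \<omega>) -` A \<inter> space M"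
    using measurable_space[OF R1] by (auto simp: e1[simplified])
  have B': "?R2 -` ?B \<inter> space M = (\<lambda>\<omega>. \<lambda>j\<in>J. X j \<omega> - X 0 \<omega>) -` B \<inter> space M"
    using measurable_space[OF R2] unfolding vimage_def by (auto simp only: e2 Int_iff mem_Collect_eq)
  have "prob ((\<lambda>\<omega>. (?R1 \<omega>, ?R2 \<omega>)) -` (?A \<times> ?B) \<inter> space M) =
      prob (?R1 -` ?A \<inter> space M) * prob (?R2 -` ?B \<inter> space M)"
    by (rule indep_varD[OF R measurable_sets[OF f1 A] measurable_sets[OF f2 B]])
  moreover have "(\<lambda>\<omega>. (?R1 \<omega>, ?R2 \<omega>)) -` (?A \<times> ?B) \<inter> space M = (?R1 -` ?A \<inter> space M) \<inter> (?R2 -` ?B \<inter> space M)"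
    by auto
  ultimately show ?thesis unfolding A' B' by simp
qed

text \<open>Cylinder sets form an intersection-stable generator of the past, and on them the claim
  is \<open>indep_increment_finite\<close>. Independence then extends to the generated
  sigma-algebras, and so to any measurable function of the restricted path.\<close>

lemma indep_increment_past:
  assumes s: "0 \<le> s" "s \<le> t" and g[measurable]: "g \<in> borel_measurable (PiM {0..s} (\<lambda>_. borel))"
  shows "indep_var borel (\<lambda>\<omega>. X t \<omega> - X s \<omega>) borel (\<lambda>\<omega>. g (\<lambda>r\<in>{0..s}. X r \<omega>))"
proof -
  let ?D = "\<lambda>\<omega>. X t \<omega> - X s \<omega>" and ?Y = "\<lambda>\<omega>. \<lambda>r\<in>{0..s}. X r \<omega>"
  have Dm[measurable]: "?D \<in> borel_measurable M"
    using random_variable_X s by (intro borel_measurable_diff) auto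
  have Ym[measurable]: "?Y \<in> M \<rightarrow>\<^sub>M PiM {0..s} (\<lambda>_. borel)"
    using random_variable_X by (intro measurable_restrict) auto
  let ?A = "{?D -` A \<inter> space M | A. A \<in> sets borel}"
  let ?B = "{?Y -` B \<inter> space M | B. B \<in> prod_algebra {0..s} (\<lambda>_. borel)}"
  have "indep_set ?A ?B"
  proof (rule indep_setI)
    show "?A \<subseteq> events" using measurable_sets[OF Dm] by auto
    show "?B \<subseteq> events"
      using measurable_sets[OF Ym] prod_algebra_sets_into_space by (auto simp: sets_PiM intro: sigma_sets.Basic)
    fix a b assume "a \<in> ?A" "b \<in> ?B"
    then obtain A B where A: "A \<in> sets borel" "a = ?D -` A \<inter> space M"
      and B: "B \<in> prod_algebra {0..s} (\<lambda>_. borel)" "b = ?Y -` B \<inter> space M" by blast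
    from B(1) obtain J F where J: "finite J" "J \<subseteq> {0..s}" "B = prod_emb {0..s} (\<lambda>_. borel) J (\<Pi>\<^sub>E j\<in>J. F j)"
      "\<And>j. j \<in> J \<Longrightarrow> F j \<in> sets borel"
      by (elim prod_algebraE) auto
    let ?Y' = "\<lambda>\<omega>. \<lambda>j\<in>J. X j \<omega> - X 0 \<omega>"
    have F: "(\<Pi>\<^sub>E j\<in>J. F j) \<in> sets (PiM J (\<lambda>_. borel))" using J by (intro sets_PiM_I_finite) auto
    have Y'm[measurable]: "?Y' \<in> M \<rightarrow>\<^sub>M PiM J (\<lambda>_. borel)"
      using random_variable_X J(2) by (intro measurable_restrict borel_measurable_diff) auto
    \<comment> \<open>Values of the path are exchanged for their differences from
      \<open>X 0\<close>, which is almost surely zero.\<close>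
    have AEb: "AE \<omega> in M. \<omega> \<in> b \<longleftrightarrow> \<omega> \<in> ?Y' -` (\<Pi>\<^sub>E j\<in>J. F j) \<inter> space M"
      using start_zero AE_space
    proof eventually_elim
      case (elim \<omega>)
      then show ?case using J(2) by (auto simp: B(2) J(3) prod_emb_def PiE_iff Int_absorb1)
    qed
    have bm: "b \<in> events" 
      using \<open>?B \<subseteq> events\<close> \<open>b \<in> ?B\<close> by blast
    have am: "a \<in> events" using A measurable_sets[OF Dm] by auto
    have Y'F: "?Y' -` (\<Pi>\<^sub>E j\<in>J. F j) \<inter> space M \<in> events" using measurable_sets[OF Y'm F] .
    have "prob (a \<inter> b) = prob (a \<inter> (?Y' -` (\<Pi>\<^sub>E j\<in>J. F j) \<inter> space M))"
      using AEb am bm Y'F by (intro finite_measure_eq_AE) auto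
    also have "\<dots> = prob (?D -` A \<inter> space M) * prob (?Y' -` (\<Pi>\<^sub>E j\<in>J. F j) \<inter> space M)"
      unfolding A(2) by (rule indep_increment_finite[OF J(1,2) s A(1) F])
    also have "prob (?Y' -` (\<Pi>\<^sub>E j\<in>J. F j) \<inter> space M) = prob b"
      using AEb bm Y'F by (intro finite_measure_eq_AE) auto
    finally show "prob (a \<inter> b) = prob a * prob b" by (simp add: A(2))
  qed
  moreover have "Int_stable ?A"
  proof (rule Int_stableI)
    fix a b assume "a \<in> ?A" "b \<in> ?A"
    then obtain A B where "A \<in> sets borel" "a = ?D -` A \<inter> space M" "B \<in> sets borel" "b = ?D -` B \<inter> space M"
      by blast
    then show "a \<inter> b \<in> ?A" by (intro CollectI exI[of _ "A \<inter> B"]) auto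
  qed
  moreover have "Int_stable ?B"
  proof (rule Int_stableI)
    fix a b assume "a \<in> ?B" "b \<in> ?B"
    then obtain A B where "A \<in> prod_algebra {0..s} (\<lambda>_. borel)" "a = ?Y -` A \<inter> space M"
      "B \<in> prod_algebra {0..s} (\<lambda>_. borel)" "b = ?Y -` B \<inter> space M"
      by blast
    then show "a \<inter> b \<in> ?B"
      using Int_stable_prod_algebra[of "{0..s}" "\<lambda>_. borel :: real measure"]
      by (intro CollectI exI[of _ "A \<inter> B"]) (auto simp: Int_stable_def)
  qed
  ultimately have "indep_set (sigma_sets (space M) ?A) (sigma_sets (space M) ?B)"
    by (rule indep_set_sigma_sets)
  then have I: "indep_sets (case_bool (sigma_sets (space M) ?A) (sigma_sets (space M) ?B)) UNIV"
    by (simp add: indep_set_def)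
  have Ysp: "?Y \<in> space M \<rightarrow> (\<Pi>\<^sub>E i\<in>{0..s}. space borel)" by auto
  have YB: "?Y -` B \<inter> space M \<in> sigma_sets (space M) ?B" if "B \<in> sets (PiM {0..s} (\<lambda>_. borel))" for B
    using sigma_sets_vimage_commute[OF Ysp, of "prod_algebra {0..s} (\<lambda>_. borel)"] that
    unfolding sets_PiM by auto
  have "sigma_sets (space M) {(\<lambda>\<omega>. g (?Y \<omega>)) -` C \<inter> space M | C. C \<in> sets borel} \<subseteq> sigma_sets (space M) ?B"
  proof (rule sigma_sets_mono, safe)
    fix C :: "real set" assume "C \<in> sets borel"
    then have "g -` C \<inter> space (PiM {0..s} (\<lambda>_. borel)) \<in> sets (PiM {0..s} (\<lambda>_. borel))"
      using measurable_sets[OF g] by auto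
    from YB[OF this] show "(\<lambda>\<omega>. g (?Y \<omega>)) -` C \<inter> space M \<in> sigma_sets (space M) ?B"
      using measurable_space[OF Ym] by (simp add: vimage_Int[symmetric] vimage_comp comp_def Int_assoc
          Int_absorb1 subset_vimage_iff image_subset_iff)
  qed
  then have "indep_set (sigma_sets (space M) ?A) (sigma_sets (space M) {(\<lambda>\<omega>. g (?Y \<omega>)) -` C \<inter> space M | C. C \<in> sets borel})"
    unfolding indep_set_def by (intro indep_sets_mono_sets[OF I]) (auto split: bool.split)
  then show ?thesis unfolding indep_var_eq by auto
qed

lemma indep_increment:
  assumes "0 \<le> s" "s \<le> t"
  shows "indep_var borel (\<lambda>\<omega>. X t \<omega> - X s \<omega>) borel (X s)"
  using indep_increment_past[OF assms, of "\<lambda>f. f s"] assms by simp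

lemma distr_increment:
  assumes "0 \<le> s" "s \<le> t"
  shows "distr M borel (\<lambda>\<omega>. X t \<omega> - X s \<omega>) = distr M borel (X (t - s))"
  using stationary_increments[of s "t - s"] assms by simp

lemma increment_measurable: "0 \<le> s \<Longrightarrow> s \<le> t \<Longrightarrow> (\<lambda>\<omega>. X t \<omega> - X s \<omega>) \<in> borel_measurable M"
  using random_variable_X by (intro borel_measurable_diff) auto

lemma integrable_increment_iff:
  fixes h :: "real \<Rightarrow> real"
  assumes "0 \<le> s" "s \<le> t" and [measurable]: "h \<in> borel_measurable borel"
  shows "integrable M (\<lambda>\<omega>. h (X t \<omega> - X s \<omega>)) \<longleftrightarrow> integrable M (\<lambda>\<omega>. h (X (t - s) \<omega>))"
  using distr_increment[OF assms(1,2)] increment_measurable[OF assms(1,2)] random_variable_X[of "t - s"] assms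
  by (subst (1 2) integrable_distr_eq[symmetric, of _ M borel h]) auto

lemma integral_increment:
  fixes h :: "real \<Rightarrow> real"
  assumes "0 \<le> s" "s \<le> t" and [measurable]: "h \<in> borel_measurable borel"
  shows "expectation (\<lambda>\<omega>. h (X t \<omega> - X s \<omega>)) = expectation (\<lambda>\<omega>. h (X (t - s) \<omega>))"
  using distr_increment[OF assms(1,2)] increment_measurable[OF assms(1,2)] random_variable_X[of "t - s"] assms
  by (subst (1 2) integral_distr[symmetric, of _ M borel h]) auto

end

section \<open>Mean and second moment of a Levy process\<close>

locale square_integrable_levy_process = levy_process +
  assumes square_integrable_1: "integrable M (\<lambda>\<omega>. (X 1 \<omega>)\<^sup>2)"
begin

lemma square_integrable_of_nat: "integrable M (\<lambda>\<omega>. (X (real n) \<omega>)\<^sup>2)"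
proof (induction n)
  case 0
  have [measurable]: "X 0 \<in> borel_measurable M" by (simp add: random_variable_X)
  have "integrable M (\<lambda>\<omega>. 0 :: real)" by simp
  then show ?case
    by (rule integrable_cong_AE_imp) (use start_zero in auto)
next
  case (Suc n)
  have "integrable M (\<lambda>\<omega>. (X (real n) \<omega> + (X (real (Suc n)) \<omega> - X (real n) \<omega>))\<^sup>2)"
  proof (rule integrable_square_add)
    show "integrable M (\<lambda>\<omega>. (X (real (Suc n)) \<omega> - X (real n) \<omega>)\<^sup>2)"
      using square_integrable_1 integrable_increment_iff[of "real n" "real (Suc n)" "\<lambda>x. x\<^sup>2"] by simp
    show "(\<lambda>\<omega>. X (real (Suc n)) \<omega> - X (real n) \<omega>) \<in> borel_measurable M"
      by (rule increment_measurable) auto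
  qed (use Suc random_variable_X in auto)
  then show ?case by simp
qed

lemma square_integrable:
  assumes "0 \<le> s"
  shows "integrable M (\<lambda>\<omega>. (X s \<omega>)\<^sup>2)"
proof -
  obtain n :: nat where n: "s \<le> real n" using real_arch_simple by blast
  show ?thesis
    by (rule integrable_square_summand[OF indep_increment[OF assms n]]) (simp add: square_integrable_of_nat)
qed

lemma integrable_X: "0 \<le> s \<Longrightarrow> integrable M (X s)"
  by (rule square_integrable_imp_integrable) (auto simp: random_variable_X square_integrable)

lemma integrable_increment: "0 \<le> s \<Longrightarrow> s \<le> t \<Longrightarrow> integrable M (\<lambda>\<omega>. X t \<omega> - X s \<omega>)"
  by (simp add: integrable_X)

lemma mean_add:
  assumes "0 \<le> s" "0 \<le> h"
  shows "expectation (X (s + h)) = expectation (X s) + expectation (X h)"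
proof -
  have "expectation (\<lambda>\<omega>. X (s + h) \<omega> - X s \<omega>) = expectation (X h)"
    using integral_increment[of s "s + h" "\<lambda>x. x"] assms by simp
  then show ?thesis using assms integrable_X by simp
qed

lemma variance_add:
  assumes "0 \<le> s" "0 \<le> h"
  shows "variance (X (s + h)) = variance (X s) + variance (X h)"
proof -
  let ?D = "\<lambda>\<omega>. X (s + h) \<omega> - X s \<omega>"
  have ind: "indep_var borel ?D borel (X s)" using assms by (intro indep_increment) auto
  have i: "integrable M ?D" "integrable M (X s)" "integrable M (X h)" "integrable M (X (s + h))"
    using assms by (simp_all add: integrable_X)
  have i2: "integrable M (\<lambda>\<omega>. (?D \<omega>)\<^sup>2)" "integrable M (\<lambda>\<omega>. (X s \<omega>)\<^sup>2)" "integrable M (\<lambda>\<omega>. (X h \<omega>)\<^sup>2)"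
    using assms square_integrable integrable_increment_iff[of s "s + h" "\<lambda>x. x\<^sup>2"] by auto
  have m: "expectation ?D = expectation (X h)" "expectation (\<lambda>\<omega>. (?D \<omega>)\<^sup>2) = expectation (\<lambda>\<omega>. (X h \<omega>)\<^sup>2)"
    using integral_increment[of s "s + h" "\<lambda>x. x"] integral_increment[of s "s + h" "\<lambda>x. x\<^sup>2"] assms by simp_all
  have p: "expectation (\<lambda>\<omega>. ?D \<omega> * X s \<omega>) = expectation (X h) * expectation (X s)"
    using indep_var_lebesgue_integral[OF ind i(1,2)] m by simp
  have "expectation (\<lambda>\<omega>. (X (s + h) \<omega>)\<^sup>2) = expectation (\<lambda>\<omega>. (?D \<omega>)\<^sup>2 + 2 * (?D \<omega> * X s \<omega>) + (X s \<omega>)\<^sup>2)"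
    by (intro Bochner_Integration.integral_cong) (auto simp: power2_eq_square algebra_simps)
  also have "\<dots> = expectation (\<lambda>\<omega>. (X h \<omega>)\<^sup>2) + 2 * (expectation (X h) * expectation (X s)) + expectation (\<lambda>\<omega>. (X s \<omega>)\<^sup>2)"
    using i2 indep_var_integrable[OF ind i(1,2)] m p by simp
  finally show ?thesis
    using i i2 square_integrable[of "s + h"] assms mean_add[OF assms]
    by (simp add: variance_eq power2_eq_square algebra_simps prob_space)
qed

lemma additive_of_nat:
  fixes f :: "real \<Rightarrow> real"
  assumes add: "\<And>s h. 0 \<le> s \<Longrightarrow> 0 \<le> h \<Longrightarrow> f (s + h) = f s + f h" and s: "0 \<le> s"
  shows "f (real n * s) = real n * f s"
proof (induction n)
  case 0 show ?case using add[of 0 0] by simp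
next
  case (Suc n)
  have "f (real (Suc n) * s) = f (real n * s + s)" by (simp add: algebra_simps)
  also have "\<dots> = f (real n * s) + f s" using s by (intro add) auto
  finally show ?case using Suc by (simp add: algebra_simps)
qed

lemma variance_mono:
  assumes "0 \<le> s" "s \<le> t" shows "variance (X s) \<le> variance (X t)"
  using variance_add[of s "t - s"] variance_positive[of "X (t - s)"] assms by simp

lemma variance_inverse_nat: "n > 0 \<Longrightarrow> variance (X (1 / real n)) = variance (X 1) / real n"
  using additive_of_nat[of "\<lambda>s. variance (X s)" "1 / real n" n, OF variance_add] by (simp add: field_simps)

text \<open>The mean is additive in time, hence linear on rational times; passing to all times needs
  some continuity. The defect \<open>h\<close> from linearity at \<open>s\<close> is also the limit
  of the means at the times \<open>S n\<close>, which tend to 0. There right-continuity makes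
  \<open>X\<close> small in probability while the variances tend to 0, so these means tend to 0 and
  \<open>h\<close> vanishes.\<close>

lemma mean_eq:
  assumes s: "0 \<le> s"
  shows "expectation (X s) = s * expectation (X 1)"
proof -
  let ?f = "\<lambda>s. expectation (X s)"
  define h where "h = ?f s - s * ?f 1"
  define k where "k n = nat \<lfloor>real (Suc n) * s\<rfloor>" for n
  \<comment> \<open>The remainder of \<open>s\<close> modulo the grid of mesh
    \<open>1 / real (Suc n)\<close>. The mean is linear on the grid, so at \<open>S n\<close> it has
    the same defect as at \<open>s\<close>.\<close>
  define S where "S n = s - real (k n) / real (Suc n)" for n
  have k: "real (k n) \<le> real (Suc n) * s" "real (Suc n) * s \<le> real (k n) + 1" for n
    using s by (auto simp: k_def simp del: of_nat_Suc) (linarith+)?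
  have S0: "0 \<le> S n" for n using k(1)[of n] by (simp add: S_def field_simps del: of_nat_Suc)
  have S1: "S n \<le> 1 / real (Suc n)" for n
  proof -
    have "S n * real (Suc n) \<le> 1" using k(2)[of n] by (simp add: S_def left_diff_distrib right_diff_distrib mult.commute del: of_nat_Suc)
    then show ?thesis by (simp add: pos_le_divide_eq del: of_nat_Suc)
  qed
  have S_lim: "S \<longlonglongrightarrow> 0"
    by (rule tendsto_sandwich[OF _ _ tendsto_const LIMSEQ_inverse_real_of_nat])
       (use S0 S1 in \<open>auto simp: inverse_eq_divide simp del: of_nat_Suc\<close>)
  have f_S: "?f (S n) = h + S n * ?f 1" for n
  proof -
    have 1: "?f 1 = real (Suc n) * ?f (1 / real (Suc n))"
      using additive_of_nat[of ?f "1 / real (Suc n)" "Suc n", OF mean_add] by (simp del: of_nat_Suc)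
    have 2: "?f (real (k n) / real (Suc n)) = real (k n) * ?f (1 / real (Suc n))"
      using additive_of_nat[of ?f "1 / real (Suc n)" "k n", OF mean_add] by (simp del: of_nat_Suc)
    have "?f s = ?f (real (k n) / real (Suc n)) + ?f (S n)"
      using mean_add[of "real (k n) / real (Suc n)" "S n"] S0[of n] by (simp add: S_def)
    then show ?thesis unfolding h_def 2 1 by (simp add: S_def field_simps del: of_nat_Suc)
  qed
  have X_lim: "AE \<omega> in M. (\<lambda>n. min 1 \<bar>X (S n) \<omega>\<bar>) \<longlonglongrightarrow> 0"
    using start_zero cadlag_paths
  proof eventually_elim
    case (elim \<omega>)
    have "continuous (at_right 0) (\<lambda>s. X s \<omega>)" using elim(2) by (auto simp: cadlag_def)
    then have "continuous (at 0 within {0..}) (\<lambda>s. X s \<omega>)" by (simp add: at_within_Ici_at_right)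
    then have "(\<lambda>n. X (S n) \<omega>) \<longlonglongrightarrow> X 0 \<omega>"
      by (rule continuous_within_tendsto_compose) (use S0 S_lim in auto)
    then have "(\<lambda>n. min 1 \<bar>X (S n) \<omega>\<bar>) \<longlonglongrightarrow> min 1 \<bar>X 0 \<omega>\<bar>" by (intro tendsto_intros)
    then show ?case using elim(1) by simp
  qed
  have Xm[measurable]: "X (S n) \<in> borel_measurable M" for n using random_variable_X S0 by simp
  have E_lim: "(\<lambda>n. expectation (\<lambda>\<omega>. min 1 \<bar>X (S n) \<omega>\<bar>)) \<longlonglongrightarrow> expectation (\<lambda>\<omega>. 0)"
    by (rule integral_dominated_convergence[where w = "\<lambda>_. 1"]) (use X_lim in auto)
  \<comment> \<open>Truncating at 1 permits dominated convergence without uniform integrability. The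
    second summand is \<eta> plus the variance bound divided by \<eta>, where \<eta> is the inverse
    square root of \<open>real (Suc n)\<close>.\<close>
  let ?b = "\<lambda>n. expectation (\<lambda>\<omega>. min 1 \<bar>X (S n) \<omega>\<bar>) + (1 + variance (X 1)) / sqrt (real (Suc n))"
  have bound: "min 1 \<bar>?f (S n)\<bar> \<le> ?b n" for n
  proof -
    define \<eta> where "\<eta> = 1 / sqrt (real (Suc n))"
    have \<eta>: "\<eta> > 0" by (simp add: \<eta>_def)
    have iY: "integrable M (\<lambda>\<omega>. (X (S n) \<omega> - ?f (S n))\<^sup>2)"
      using square_integrable[OF S0[of n]] integrable_X[OF S0[of n]]
      by (simp add: power2_diff)
    have im: "integrable M (\<lambda>\<omega>. min 1 \<bar>X (S n) \<omega>\<bar>)"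
      by (rule integrable_const_bound[of _ 1]) auto
    have pw: "min 1 \<bar>c\<bar> \<le> min 1 \<bar>x\<bar> + (\<eta> + (x - c)\<^sup>2 / \<eta>)" for x c :: real
    proof -
      have "\<bar>x - c\<bar> \<le> \<eta> + (x - c)\<^sup>2 / \<eta>"
      proof (cases "\<bar>x - c\<bar> \<le> \<eta>")
        case True then show ?thesis using \<eta> by (simp add: add_increasing2)
      next
        case False
        then have "\<bar>x - c\<bar> * \<eta> \<le> \<bar>x - c\<bar> * \<bar>x - c\<bar>" using \<eta> by (intro mult_left_mono) auto
        then have "\<bar>x - c\<bar> \<le> (x - c)\<^sup>2 / \<eta>" using \<eta> by (simp add: field_simps power2_eq_square abs_mult_self_eq)
        then show ?thesis using \<eta> by simp
      qed
      then show ?thesis by linarith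
    qed
    have "min 1 \<bar>?f (S n)\<bar> = expectation (\<lambda>\<omega>. min 1 \<bar>?f (S n)\<bar>)" by (simp add: prob_space)
    also have "\<dots> \<le> expectation (\<lambda>\<omega>. min 1 \<bar>X (S n) \<omega>\<bar> + (\<eta> + (X (S n) \<omega> - ?f (S n))\<^sup>2 / \<eta>))"
      by (intro integral_mono) (use pw iY im in auto)
    also have "\<dots> = expectation (\<lambda>\<omega>. min 1 \<bar>X (S n) \<omega>\<bar>) + (\<eta> + variance (X (S n)) / \<eta>)"
      using im iY by (simp add: prob_space)
    also have "variance (X (S n)) / \<eta> \<le> (variance (X 1) / real (Suc n)) / \<eta>"
      using variance_mono[OF S0 S1, of n] variance_inverse_nat[of "Suc n"] \<eta> by (intro divide_right_mono) auto
    also have "(variance (X 1) / real (Suc n)) / \<eta> = variance (X 1) / sqrt (real (Suc n))"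
      unfolding \<eta>_def by (simp add: field_simps del: of_nat_Suc)
    finally show ?thesis by (simp add: \<eta>_def add_divide_distrib)
  qed
  have "(\<lambda>n. c / sqrt (real (Suc n))) \<longlonglongrightarrow> 0" for c :: real
    by real_asymp
  with E_lim have "?b \<longlonglongrightarrow> 0" using tendsto_add by fastforce
  moreover have "(\<lambda>n. min 1 \<bar>?f (S n)\<bar>) \<longlonglongrightarrow> min 1 \<bar>h + 0 * ?f 1\<bar>"
    unfolding f_S using S_lim by (intro tendsto_intros)
  ultimately have "min 1 \<bar>h\<bar> \<le> 0"
    using bound by (intro LIMSEQ_le) auto
  then show ?thesis by (auto simp: h_def min_def split: if_splits)
qed

text \<open>Rounding \<open>s\<close> up to an integer gives linear growth of the variance, by
  additivity and monotonicity; the mean contributes the square. Polynomial growth is enough because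
  exponential discounts are applied later.\<close>

lemma second_moment_le:
  assumes s: "0 \<le> s"
  shows "expectation (\<lambda>\<omega>. (X s \<omega>)\<^sup>2) \<le> (2 * variance (X 1) + (expectation (X 1))\<^sup>2) * (1 + s\<^sup>2)"
proof -
  let ?n = "nat \<lceil>s\<rceil>"
  have n: "s \<le> real ?n" "real ?n \<le> s + 1" using s by linarith+
  have v: "0 \<le> variance (X 1)" by (rule variance_positive)
  have "variance (X s) \<le> variance (X (real ?n))" by (rule variance_mono[OF s n(1)])
  also have "\<dots> = real ?n * variance (X 1)"
    using additive_of_nat[of "\<lambda>s. variance (X s)" 1 ?n, OF variance_add] by simp
  also have "\<dots> \<le> (s + 1) * variance (X 1)" using n v by (intro mult_right_mono) auto
  also have "s + 1 \<le> 2 * (1 + s\<^sup>2)"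
  proof -
    have "0 \<le> (s - 1)\<^sup>2" by simp
    then have "2 * s \<le> s\<^sup>2 + 1" by (simp add: power2_diff)
    then show ?thesis using zero_le_power2[of s] by (smt (verit))
  qed
  finally have "variance (X s) \<le> 2 * (1 + s\<^sup>2) * variance (X 1)" using v by (simp add: mult_right_mono)
  moreover have "variance (X s) = expectation (\<lambda>\<omega>. (X s \<omega>)\<^sup>2) - (s * expectation (X 1))\<^sup>2"
    using variance_eq[OF integrable_X[OF s] square_integrable[OF s]] mean_eq[OF s] by simp
  moreover have "(2 * variance (X 1) + (expectation (X 1))\<^sup>2) * (1 + s\<^sup>2) =
      2 * (1 + s\<^sup>2) * variance (X 1) + (s * expectation (X 1))\<^sup>2 + (expectation (X 1))\<^sup>2"
    by (simp add: power_mult_distrib algebra_simps)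
  ultimately show ?thesis using zero_le_power2[of "expectation (X 1)"] by linarith
qed

end

section \<open>A single particle\<close>

type_synonym particle = "(real \<Rightarrow> real) \<times> real \<times> nat \<times> (nat \<Rightarrow> real)"

text \<open>
  The absolute value changes nothing almost surely, but makes birth times monotone along ancestral
  lines at every point of the product space.
\<close>

definition life :: "particle \<Rightarrow> real" where
  "life d = \<bar>fst (snd d)\<bar>"

definition children :: "particle \<Rightarrow> nat" where
  "children d = fst (snd (snd d))"

definition jump :: "particle \<Rightarrow> nat \<Rightarrow> real" where
  "jump d = snd (snd (snd d))"

definition jump_sum :: "nat \<times> (nat \<Rightarrow> real) \<Rightarrow> real" where
  "jump_sum p = (\<Sum>i=1..fst p. snd p i)"

definition jump_square_sum :: "nat \<times> (nat \<Rightarrow> real) \<Rightarrow> real" where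
  "jump_square_sum p = (\<Sum>i=1..fst p. (snd p i)\<^sup>2)"

lemma life_nonneg [simp]: "0 \<le> life d"
  by (simp add: life_def)

lemma life_measurable [measurable]: "life \<in> borel_measurable particle_space"
  unfolding life_def by measurable

lemma children_measurable [measurable]: "children \<in> particle_space \<rightarrow>\<^sub>M count_space UNIV"
  unfolding children_def by measurable

lemma jump_measurable [measurable]: "(\<lambda>d. jump d i) \<in> borel_measurable particle_space"
  unfolding jump_def by measurable

lemma offspring_sum_measurable:
  fixes h :: "real \<Rightarrow> real"
  assumes [measurable]: "h \<in> borel_measurable borel"
  shows "(\<lambda>p. \<Sum>i=1..fst p. h (snd p i)) \<in> borel_measurable offspring_space"
  by (rule measurable_compose_countable[where f = "\<lambda>n p. \<Sum>i=1..n. h (snd p i)" and g = fst]) measurable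

lemma jump_sum_measurable [measurable]: "jump_sum \<in> borel_measurable offspring_space"
  unfolding jump_sum_def using offspring_sum_measurable[of "\<lambda>x. x"] by simp

lemma jump_square_sum_measurable [measurable]: "jump_square_sum \<in> borel_measurable offspring_space"
  unfolding jump_square_sum_def using offspring_sum_measurable[of "\<lambda>x. x\<^sup>2"] by simp

text \<open>Discounting at rate \<theta> tilts the exponential density of rate \<open>lam\<close>
  into \<open>lam / (lam + \<theta>)\<close> times that of rate \<open>lam + \<theta>\<close>; what
  remains is a tail probability.\<close>

lemma nn_integral_exponential_gt:
  assumes lam: "0 < lam" and \<theta>: "0 \<le> \<theta>" and s: "0 \<le> s"
  shows "(\<integral>\<^sup>+a. ennreal (exp (- \<theta> * a)) * indicator {s<..} a \<partial>density lborel (exponential_density lam)) =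
    ennreal (lam / (lam + \<theta>) * exp (- (lam + \<theta>) * s))"
proof -
  let ?E = "density lborel (exponential_density (lam + \<theta>))"
  have pos: "lam + \<theta> > 0" using lam \<theta> by simp
  interpret E: prob_space ?E by (rule prob_space_exponential_density[OF pos])
  have dens: "ennreal (exponential_density lam a) * (ennreal (exp (- \<theta> * a)) * indicator {s<..} a) =
      ennreal (lam / (lam + \<theta>)) * (ennreal (exponential_density (lam + \<theta>) a) * indicator {s<..} a)" for a
  proof -
    have "exponential_density lam a * exp (- \<theta> * a) = lam / (lam + \<theta>) * exponential_density (lam + \<theta>) a"
      using pos by (auto simp: exponential_density_def exp_add[symmetric] field_simps)
    then show ?thesis
      using lam pos by (auto simp: ennreal_mult[symmetric] exponential_density_nonneg split: split_indicator)
  qed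
  have "distributed ?E lborel (\<lambda>x. x) (exponential_density (lam + \<theta>))"
    by (auto simp: distributed_def distr_id2 exponential_density_nonneg pos)
  from E.exponential_distributedD_gt[OF this s pos]
  have "measure ?E {s<..} = exp (- (lam + \<theta>) * s)"
    by (simp only: space_density space_lborel UNIV_I simp_thms greaterThan_def) (simp add: algebra_simps)
  then have gt: "emeasure ?E {s<..} = ennreal (exp (- (lam + \<theta>) * s))"
    by (simp only: E.emeasure_eq_measure)
  have "(\<integral>\<^sup>+a. ennreal (exp (- \<theta> * a)) * indicator {s<..} a \<partial>density lborel (exponential_density lam)) =
      (\<integral>\<^sup>+a. ennreal (lam / (lam + \<theta>)) * (ennreal (exponential_density (lam + \<theta>) a) * indicator {s<..} a) \<partial>lborel)"
    by (subst nn_integral_density) (auto simp: dens[symmetric])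
  also have "\<dots> = ennreal (lam / (lam + \<theta>)) * emeasure ?E {s<..}"
    by (subst nn_integral_cmult) (auto simp: emeasure_density)
  finally show ?thesis unfolding gt using lam pos by (simp add: ennreal_mult[symmetric])
qed

text \<open>The quadratic Taylor term of the exponential dominates the square, whence
  \<open>2 / \<theta>\<^sup>2\<close>. A discount at rate \<theta> thus pays for quadratic growth of
  second moments.\<close>

lemma exp_square_bound:
  fixes \<theta> t :: real
  assumes "0 < \<theta>" "0 \<le> t"
  shows "exp (- \<theta> * t) * (1 + t\<^sup>2) \<le> 1 + 2 / \<theta>\<^sup>2"
proof -
  have "1 + \<theta> * t + (\<theta> * t)\<^sup>2 / 2 \<le> exp (\<theta> * t)"
    using exp_lower_Taylor_quadratic[of "\<theta> * t"] assms by simp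
  moreover have "0 \<le> \<theta> * t" using assms by simp
  ultimately have e: "1 \<le> exp (\<theta> * t)" "(\<theta> * t)\<^sup>2 / 2 \<le> exp (\<theta> * t)" using zero_le_power2[of "\<theta> * t"] by linarith+
  have "t\<^sup>2 = 2 / \<theta>\<^sup>2 * ((\<theta> * t)\<^sup>2 / 2)" using assms by (simp add: power_mult_distrib)
  also have "\<dots> \<le> 2 / \<theta>\<^sup>2 * exp (\<theta> * t)" using e by (intro mult_left_mono) auto
  finally have "1 + t\<^sup>2 \<le> (1 + 2 / \<theta>\<^sup>2) * exp (\<theta> * t)" unfolding distrib_right using e(1) by linarith
  then have "exp (- \<theta> * t) * (1 + t\<^sup>2) \<le> exp (- \<theta> * t) * ((1 + 2 / \<theta>\<^sup>2) * exp (\<theta> * t))"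
    by (intro mult_left_mono) auto
  also have "\<dots> = 1 + 2 / \<theta>\<^sup>2" by (simp add: exp_minus)
  finally show ?thesis .
qed

lemma (in prob_space) AE_fstI:
  assumes "AE x in N. Q x" shows "AE p in N \<Otimes>\<^sub>M M. Q (fst p)"
  by (rule AE_distrD[OF measurable_fst]) (use assms in \<open>simp only: distr_pair_fst\<close>)

lemma (in prob_space) AE_sndI:
  assumes "AE x in M. Q x" shows "AE p in N \<Otimes>\<^sub>M M. Q (snd p)"
proof -
  from assms obtain A where A: "A \<in> null_sets M" "{x \<in> space M. \<not> Q x} \<subseteq> A"
    by (auto simp: eventually_ae_filter)
  have "space N \<times> A \<in> null_sets (N \<Otimes>\<^sub>M M)"
    using A(1) by (auto simp: null_sets_def emeasure_pair_measure_Times)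
  then show ?thesis
    by (rule AE_I') (use A(2) in \<open>auto simp: space_pair_measure\<close>)
qed

text \<open>What is used of the law of one particle: \<open>PZ\<close> for the motion,
  \<open>PO\<close> for the offspring, \<open>lam\<close> for the lifetime. Regularity is stated
  almost surely at each fixed age, since that of whole paths cannot be expressed by countably many
  coordinates. \<open>path_increment\<close> is the martingale property of the motion minus
  \<open>mu\<close> times the age, tested against bounded functions of the past.\<close>

locale particle_law = PZ: prob_space PZ + PO: prob_space PO
  for PZ :: "(real \<Rightarrow> real) measure" and PO :: "(nat \<times> (nat \<Rightarrow> real)) measure" +
  fixes lam mu :: real
  assumes sets_PZ [measurable_cong]: "sets PZ = sets path_space"
    and sets_PO [measurable_cong]: "sets PO = sets offspring_space"
    and lam_pos: "0 < lam"
    and start_zero: "AE z in PZ. z 0 = 0"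
    and eval_right: "\<And>s. 0 \<le> s \<Longrightarrow> AE z in PZ. eval_right z s = z s"
    and path_square_integrable: "\<And>s. 0 \<le> s \<Longrightarrow> integrable PZ (\<lambda>z. (z s)\<^sup>2)"
    and path_second_moment: "\<exists>C\<ge>0. \<forall>s\<ge>0. (\<integral>z. (z s)\<^sup>2 \<partial>PZ) \<le> C * (1 + s\<^sup>2)"
    and path_increment: "\<And>s t g B. 0 \<le> s \<Longrightarrow> s \<le> t \<Longrightarrow> g \<in> borel_measurable path_space \<Longrightarrow>
      (\<And>z. \<bar>g z\<bar> \<le> B) \<Longrightarrow>
      (\<integral>z. (z t - z s) * g (stopped s z) \<partial>PZ) = mu * (t - s) * (\<integral>z. g (stopped s z) \<partial>PZ)"
    and children_square_integrable: "integrable PO (\<lambda>p. (real (fst p))\<^sup>2)"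
    and jump_sum_square_integrable: "integrable PO (\<lambda>p. (jump_sum p)\<^sup>2)"
    and jump_square_sum_integrable: "integrable PO jump_square_sum"
    and supercritical: "1 < (\<integral>p. real (fst p) \<partial>PO)"
begin

definition mean_children :: real where "mean_children = (\<integral>p. real (fst p) \<partial>PO)"
definition mean_jump :: real where "mean_jump = (\<integral>p. jump_sum p \<partial>PO)"
definition alpha :: real where "alpha = lam * (mean_children - 1)"
definition drift :: real where "drift = mu + lam * mean_jump"

abbreviation PA :: "real measure" where "PA \<equiv> density lborel (exponential_density lam)"
abbreviation P0 :: "particle measure" where "P0 \<equiv> PZ \<Otimes>\<^sub>M (PA \<Otimes>\<^sub>M PO)"

text \<open>
  The parameters \<open>c, x\<close> treat both martingales at once: a particle at centred position \<open>p\<close> counts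
  \<open>x + c * p\<close>, so \<open>(0, 1)\<close> gives the population size and \<open>(1, 0)\<close> the sum of centred positions.
  For one particle born at time \<open>0\<close>, \<open>contrib\<close> discounts its count while it is alive, and the
  total count of its children at birth from then on.
\<close>

definition weight :: "real \<Rightarrow> real \<Rightarrow> real \<Rightarrow> real \<Rightarrow> real \<Rightarrow> (real \<Rightarrow> real) \<Rightarrow> real" where
  "weight c x t k w z = exp (- alpha * t) * (k * (x + c * (eval_right z t - drift * t)) + c * w)"

definition contrib :: "real \<Rightarrow> real \<Rightarrow> real \<Rightarrow> particle \<Rightarrow> real" where
  "contrib c s x d = (if s < life d then weight c x s 1 0 (fst d)
     else weight c x (life d) (real (children d)) (jump_sum (snd (snd d))) (fst d))"

text \<open>The count \<open>x\<close> at birth is subtracted because it is already accounted for: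
  for a child by the contribution of its dead parent, for the root by the initial value. Negative
  \<open>s\<close> means not yet born.\<close>

definition innov :: "real \<Rightarrow> real \<Rightarrow> real \<Rightarrow> particle \<Rightarrow> real" where
  "innov c s x d = (if s < 0 then 0 else contrib c s x d - x)"

sublocale PA: prob_space PA by (rule prob_space_exponential_density[OF lam_pos])
sublocale PAO: pair_prob_space PA PO ..
sublocale P0: pair_prob_space PZ "PA \<Otimes>\<^sub>M PO" ..

lemma mean_children_gt_1: "1 < mean_children"
  using supercritical by (simp add: mean_children_def)

lemma alpha_pos: "0 < alpha"
  using mean_children_gt_1 lam_pos by (simp add: alpha_def)

lemma sets_P0 [measurable_cong]: "sets P0 = sets particle_space"
  by (intro sets_pair_measure_cong sets_PZ sets_PO) simp

lemma space_P0: "space P0 = space particle_space"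
  by (rule sets_eq_imp_space_eq[OF sets_P0])

lemma fst_PO_measurable [measurable]: "fst \<in> PO \<rightarrow>\<^sub>M count_space UNIV"
  using measurable_cong_sets[OF sets_PO refl, of "count_space UNIV"] by simp

lemma real_fst_PO_measurable [measurable]: "(\<lambda>p. real (fst p)) \<in> borel_measurable PO"
  by (rule measurable_compose[OF fst_PO_measurable]) simp

lemma weight_measurable_raw [measurable (raw)]:
  assumes [measurable]: "x \<in> borel_measurable N" "t \<in> borel_measurable N" "k \<in> borel_measurable N"
    "w \<in> borel_measurable N" "z \<in> N \<rightarrow>\<^sub>M path_space"
  shows "(\<lambda>\<omega>. weight c (x \<omega>) (t \<omega>) (k \<omega>) (w \<omega>) (z \<omega>)) \<in> borel_measurable N"
proof -
  have "(\<lambda>\<omega>. eval_right (z \<omega>) (t \<omega>)) \<in> borel_measurable N"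
    using measurable_compose[OF measurable_Pair[OF assms(5,2)] eval_right_measurable] by simp
  then show ?thesis unfolding weight_def by measurable
qed

lemma contrib_measurable_raw [measurable (raw)]:
  assumes [measurable]: "s \<in> borel_measurable N" "x \<in> borel_measurable N" "d \<in> N \<rightarrow>\<^sub>M particle_space"
  shows "(\<lambda>\<omega>. contrib c (s \<omega>) (x \<omega>) (d \<omega>)) \<in> borel_measurable N"
proof -
  have [measurable]: "(\<lambda>\<omega>. life (d \<omega>)) \<in> borel_measurable N" "(\<lambda>\<omega>. children (d \<omega>)) \<in> N \<rightarrow>\<^sub>M count_space UNIV"
    by (rule measurable_compose[OF assms(3) life_measurable], rule measurable_compose[OF assms(3) children_measurable])
  have [measurable]: "(\<lambda>\<omega>. real (children (d \<omega>))) \<in> borel_measurable N"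
    by (rule measurable_compose[OF assms(3)], rule measurable_compose[OF children_measurable]) simp
  have [measurable]: "(\<lambda>\<omega>. fst (d \<omega>)) \<in> N \<rightarrow>\<^sub>M path_space" "(\<lambda>\<omega>. jump_sum (snd (snd (d \<omega>)))) \<in> borel_measurable N"
    using assms(3) by measurable
  have "(\<lambda>\<omega>. weight c (x \<omega>) (s \<omega>) 1 0 (fst (d \<omega>))) \<in> borel_measurable N"
    by (rule weight_measurable_raw[where x = x and t = s and k = "\<lambda>_. 1" and w = "\<lambda>_. 0"]) auto
  moreover have "(\<lambda>\<omega>. weight c (x \<omega>) (life (d \<omega>)) (real (children (d \<omega>))) (jump_sum (snd (snd (d \<omega>)))) (fst (d \<omega>)))
      \<in> borel_measurable N"
    by (rule weight_measurable_raw[where x = x and t = "\<lambda>\<omega>. life (d \<omega>)" and k = "\<lambda>\<omega>. real (children (d \<omega>))"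
          and w = "\<lambda>\<omega>. jump_sum (snd (snd (d \<omega>)))"]) auto
  ultimately show ?thesis unfolding contrib_def by measurable
qed

lemma innov_measurable_raw [measurable (raw)]:
  assumes [measurable]: "s \<in> borel_measurable N" "x \<in> borel_measurable N" "d \<in> N \<rightarrow>\<^sub>M particle_space"
  shows "(\<lambda>\<omega>. innov c (s \<omega>) (x \<omega>) (d \<omega>)) \<in> borel_measurable N"
  unfolding innov_def by (intro measurable_If borel_measurable_diff contrib_measurable_raw[OF assms]) measurable

lemma AE_life: "AE d in P0. 0 < fst (snd d)"
proof -
  have "AE a in PA. 0 < a"
    using AE_lborel_singleton[of 0]
    by (subst AE_density) (auto simp: exponential_density_def elim!: eventually_mono)
  then show ?thesis by (intro PAO.AE_sndI PO.AE_fstI)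
qed

lemma integrable_path: "0 \<le> s \<Longrightarrow> integrable PZ (\<lambda>z. z s)"
  by (rule PZ.square_integrable_imp_integrable) (auto simp: path_square_integrable)

lemma integrable_children: "integrable PO (\<lambda>p. real (fst p))"
  by (rule PO.square_integrable_imp_integrable[OF real_fst_PO_measurable children_square_integrable])

lemma integrable_jump_sum: "integrable PO jump_sum"
  by (rule PO.square_integrable_imp_integrable) (auto simp: jump_sum_square_integrable)

end

lemma add3_square_le: "(a + b + c)\<^sup>2 \<le> 3 * (a\<^sup>2 + b\<^sup>2 + c\<^sup>2)" for a b c :: real
  using zero_le_power2[of "a - b"] zero_le_power2[of "b - c"] zero_le_power2[of "a - c"]
  by (simp add: power2_eq_square algebra_simps)

lemma add2_square_le: "(a + b)\<^sup>2 \<le> 2 * (a\<^sup>2 + b\<^sup>2)" for a b :: real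
  using zero_le_power2[of "a - b"] by (simp add: power2_eq_square algebra_simps)

lemma diff2_square_le: "(a - b)\<^sup>2 \<le> 2 * (a\<^sup>2 + b\<^sup>2)" for a b :: real
  using zero_le_power2[of "a + b"] by (simp add: power2_eq_square algebra_simps)

section \<open>Second moments of the discounted contribution of one particle\<close>

context particle_law
begin

text \<open>Centring is by \<open>drift\<close>, which includes the mean jumps, and not by the mean
  \<open>mu\<close> of the motion alone. The second moment may therefore grow quadratically although
  the variance grows linearly.\<close>

lemma centred_second_moment:
  "\<exists>C\<ge>0. \<forall>t\<ge>0. (\<integral>z. (z t - drift * t)\<^sup>2 \<partial>PZ) \<le> C * (1 + t\<^sup>2)"
proof -
  obtain C0 where C0: "C0 \<ge> 0" "\<And>s. 0 \<le> s \<Longrightarrow> (\<integral>z. (z s)\<^sup>2 \<partial>PZ) \<le> C0 * (1 + s\<^sup>2)"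
    using path_second_moment by blast
  have "(\<integral>z. (z t - drift * t)\<^sup>2 \<partial>PZ) \<le> (2 * C0 + 2 * drift\<^sup>2) * (1 + t\<^sup>2)" if t: "0 \<le> t" for t
  proof -
    have "(\<integral>z. (z t - drift * t)\<^sup>2 \<partial>PZ) \<le> (\<integral>z. 2 * ((z t)\<^sup>2 + (drift * t)\<^sup>2) \<partial>PZ)"
      using path_square_integrable[OF t] integrable_path[OF t] diff2_square_le
      by (intro integral_mono) (auto simp: power2_diff)
    also have "\<dots> = 2 * (\<integral>z. (z t)\<^sup>2 \<partial>PZ) + 2 * (drift * t)\<^sup>2"
      using path_square_integrable[OF t] by (simp add: PZ.prob_space algebra_simps)
    also have "\<dots> \<le> 2 * (C0 * (1 + t\<^sup>2)) + 2 * (drift\<^sup>2 * (1 + t\<^sup>2))"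
      using C0(2)[OF t] by (intro add_mono mult_left_mono) (auto simp: power_mult_distrib intro!: mult_left_mono)
    finally show ?thesis by (simp add: algebra_simps)
  qed
  then show ?thesis using C0(1) by (intro exI[of _ "2 * C0 + 2 * drift\<^sup>2"]) auto
qed

lemma centred_square_integrable: "0 \<le> t \<Longrightarrow> integrable PZ (\<lambda>z. (z t - drift * t)\<^sup>2)"
  using path_square_integrable integrable_path by (simp add: power2_diff)

text \<open>Of the squared discount at rate \<open>2 * alpha\<close>, the part
  \<open>alpha / 2\<close> is kept and the part \<open>3 * alpha / 2\<close> absorbs the quadratic
  growth in \<open>t\<close>. The factors in \<open>x\<close> and in \<open>k\<close>,
  \<open>w\<close> are separated so that the offspring moments can be integrated afterwards.\<close>

lemma nn_integral_weight_square:
  "\<exists>C\<ge>0. \<forall>x t k w. 0 \<le> t \<longrightarrow>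
     (\<integral>\<^sup>+z. ennreal ((weight c x t k w z)\<^sup>2) \<partial>PZ) \<le> ennreal (C * exp (- (alpha / 2) * t) * (1 + x\<^sup>2) * (k\<^sup>2 + w\<^sup>2))"
proof -
  obtain C1 where C1: "C1 \<ge> 0" "\<And>t. 0 \<le> t \<Longrightarrow> (\<integral>z. (z t - drift * t)\<^sup>2 \<partial>PZ) \<le> C1 * (1 + t\<^sup>2)"
    using centred_second_moment by blast
  define C2 where "C2 = 1 + 2 / (3 * alpha / 2)\<^sup>2"
  define C where "C = 3 * C2 * ((1 + c\<^sup>2) * (1 + C1))"
  have C0: "C \<ge> 0" using C1(1) by (auto simp: C_def C2_def)
  have "(\<integral>\<^sup>+z. ennreal ((weight c x t k w z)\<^sup>2) \<partial>PZ) \<le> ennreal (C * exp (- (alpha / 2) * t) * (1 + x\<^sup>2) * (k\<^sup>2 + w\<^sup>2))"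
    if t: "0 \<le> t" for x t k w
  proof -
    let ?B = "\<lambda>z. exp (- alpha * t) ^ 2 * (3 * ((k * x)\<^sup>2 + (k * c)\<^sup>2 * (z t - drift * t)\<^sup>2 + (c * w)\<^sup>2))"
    let ?I = "\<integral>z. (z t - drift * t)\<^sup>2 \<partial>PZ"
    have I: "0 \<le> ?I" "?I \<le> C1 * (1 + t\<^sup>2)" using C1(2)[OF t] by simp_all
    have "(\<integral>\<^sup>+z. ennreal ((weight c x t k w z)\<^sup>2) \<partial>PZ) \<le> (\<integral>\<^sup>+z. ennreal (?B z) \<partial>PZ)"
    proof (intro nn_integral_mono_AE)
      show "AE z in PZ. ennreal ((weight c x t k w z)\<^sup>2) \<le> ennreal (?B z)"
        using eval_right[OF t]
      proof eventually_elim
        case (elim z)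
        have "(weight c x t k w z)\<^sup>2 = exp (- alpha * t) ^ 2 * (k * x + (k * c) * (z t - drift * t) + c * w)\<^sup>2"
        proof -
          have "k * (x + c * (z t - drift * t)) + c * w = k * x + (k * c) * (z t - drift * t) + c * w"
            by (simp add: algebra_simps)
          then show ?thesis unfolding weight_def elim by (simp add: power_mult_distrib)
        qed
        also have "\<dots> \<le> exp (- alpha * t) ^ 2 * (3 * ((k * x)\<^sup>2 + ((k * c) * (z t - drift * t))\<^sup>2 + (c * w)\<^sup>2))"
          by (intro mult_left_mono add3_square_le) simp
        finally show ?case by (intro ennreal_leI) (simp add: power_mult_distrib)
      qed
    qed
    also have "\<dots> = ennreal (\<integral>z. ?B z \<partial>PZ)"
      using centred_square_integrable[OF t] by (intro nn_integral_eq_integral) auto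
    also have "(\<integral>z. ?B z \<partial>PZ) = exp (- alpha * t) ^ 2 * (3 * ((k * x)\<^sup>2 + (k * c)\<^sup>2 * ?I + (c * w)\<^sup>2))"
      using centred_square_integrable[OF t] by (simp add: PZ.prob_space)
    also have "\<dots> \<le> C * exp (- (alpha / 2) * t) * (1 + x\<^sup>2) * (k\<^sup>2 + w\<^sup>2)"
    proof -
      have e: "exp (- alpha * t) ^ 2 * (1 + t\<^sup>2) \<le> exp (- (alpha / 2) * t) * C2"
      proof -
        have "exp (- alpha * t) ^ 2 = exp (- (alpha / 2) * t) * exp (- (3 * alpha / 2) * t)"
          by (simp add: power2_eq_square exp_add[symmetric])
        moreover have "exp (- (3 * alpha / 2) * t) * (1 + t\<^sup>2) \<le> C2"
          unfolding C2_def using alpha_pos t by (intro exp_square_bound) auto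
        ultimately show ?thesis by (simp add: mult.assoc mult_left_mono)
      qed
      have "(k * x)\<^sup>2 + (k * c)\<^sup>2 * ?I + (c * w)\<^sup>2 \<le> (k * x)\<^sup>2 * (1 + t\<^sup>2) + (k * c)\<^sup>2 * (C1 * (1 + t\<^sup>2)) + (c * w)\<^sup>2 * (1 + t\<^sup>2)"
        using I by (intro add_mono mult_left_mono) (auto simp: algebra_simps)
      also have "\<dots> = (1 + t\<^sup>2) * (k\<^sup>2 * (x\<^sup>2 + c\<^sup>2 * C1) + w\<^sup>2 * c\<^sup>2)"
        by (simp add: algebra_simps power_mult_distrib)
      also have "\<dots> \<le> (1 + t\<^sup>2) * (k\<^sup>2 * ((1 + x\<^sup>2) * ((1 + c\<^sup>2) * (1 + C1))) + w\<^sup>2 * ((1 + x\<^sup>2) * ((1 + c\<^sup>2) * (1 + C1))))"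
        using C1(1) by (intro mult_left_mono add_mono) (auto simp: algebra_simps)
      also have "\<dots> = (1 + t\<^sup>2) * ((1 + c\<^sup>2) * (1 + C1) * (1 + x\<^sup>2) * (k\<^sup>2 + w\<^sup>2))"
        by (simp add: algebra_simps)
      finally have *: "(k * x)\<^sup>2 + (k * c)\<^sup>2 * ?I + (c * w)\<^sup>2 \<le> (1 + t\<^sup>2) * ((1 + c\<^sup>2) * (1 + C1) * (1 + x\<^sup>2) * (k\<^sup>2 + w\<^sup>2))" .
      have "exp (- alpha * t) ^ 2 * (3 * ((k * x)\<^sup>2 + (k * c)\<^sup>2 * ?I + (c * w)\<^sup>2))
          \<le> exp (- alpha * t) ^ 2 * (3 * ((1 + t\<^sup>2) * ((1 + c\<^sup>2) * (1 + C1) * (1 + x\<^sup>2) * (k\<^sup>2 + w\<^sup>2))))"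
        by (intro mult_left_mono *) auto
      also have "\<dots> = (exp (- alpha * t) ^ 2 * (1 + t\<^sup>2)) * (3 * ((1 + c\<^sup>2) * (1 + C1) * (1 + x\<^sup>2) * (k\<^sup>2 + w\<^sup>2)))"
        by (simp add: mult_ac)
      also have "\<dots> \<le> (exp (- (alpha / 2) * t) * C2) * (3 * ((1 + c\<^sup>2) * (1 + C1) * (1 + x\<^sup>2) * (k\<^sup>2 + w\<^sup>2)))"
        using C1(1) by (intro mult_right_mono e) (auto intro!: mult_nonneg_nonneg)
      finally show ?thesis unfolding C_def by (simp only: mult_ac)
    qed
    finally show ?thesis by (simp add: ennreal_leI)
  qed
  then show ?thesis using C0 by blast
qed

lemma AE_innov_zero: "AE d in P0. innov c 0 x d = 0"
proof -
  have "AE d in P0. eval_right (fst d) 0 = fst d 0" "AE d in P0. fst d 0 = 0"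
    using eval_right[of 0] start_zero by (auto intro!: PAO.AE_fstI)
  with AE_life show ?thesis
    by eventually_elim (simp add: innov_def contrib_def weight_def life_def)
qed

text \<open>With lifetime and offspring fixed, the motion is integrated first. A particle dead by
  age \<open>s\<close> adds nothing; otherwise the increment is a difference of two weights at ages
  at least \<open>s\<close>. Negative \<open>s\<close> is included because \<open>s\<close> will be
  a time minus a birth time.\<close>

lemma nn_integral_innov_square:
  "\<exists>C\<ge>0. \<forall>x s t. s \<le> t \<longrightarrow> 0 \<le> t \<longrightarrow>
     (\<integral>\<^sup>+d. ennreal ((innov c t x d - innov c s x d)\<^sup>2) \<partial>P0) \<le> ennreal (C * (1 + x\<^sup>2) * exp (- (alpha / 2) * s))"
proof -
  obtain C where C: "C \<ge> 0" "\<And>x t k w. 0 \<le> t \<Longrightarrow>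
     (\<integral>\<^sup>+z. ennreal ((weight c x t k w z)\<^sup>2) \<partial>PZ) \<le> ennreal (C * exp (- (alpha / 2) * t) * (1 + x\<^sup>2) * (k\<^sup>2 + w\<^sup>2))"
    using nn_integral_weight_square by blast
  define B where "B = 4 * C * (\<integral>p. 1 + (real (fst p))\<^sup>2 + (jump_sum p)\<^sup>2 \<partial>PO)"
  have B0: "B \<ge> 0" using C(1) by (auto simp: B_def intro!: mult_nonneg_nonneg)
  have main: "(\<integral>\<^sup>+d. ennreal ((innov c t x d - innov c s x d)\<^sup>2) \<partial>P0) \<le> ennreal (B * (1 + x\<^sup>2) * exp (- (alpha / 2) * s))"
    if s: "0 \<le> s" "s \<le> t" for x s t
  proof -
    have inner: "(\<integral>\<^sup>+z. ennreal ((innov c t x (z, q) - innov c s x (z, q))\<^sup>2) \<partial>PZ)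
        \<le> ennreal (4 * C * exp (- (alpha / 2) * s) * (1 + x\<^sup>2) * (1 + (real (fst (snd q)))\<^sup>2 + (jump_sum (snd q))\<^sup>2))" for q
    proof (cases "s < life (undefined, q)")
      case False
      then have "innov c t x (z, q) = innov c s x (z, q)" for z
        using s by (simp add: innov_def contrib_def life_def children_def)
      then show ?thesis by simp
    next
      case True
      define L where "L = life (undefined, q)"
      \<comment> \<open>\<open>T\<close> is the age at which the contribution at age
        \<open>t\<close> is evaluated, namely \<open>t\<close> or the earlier age at death. The pair
        \<open>k\<close>, \<open>w\<close> is 1, 0 for a living particle and describes the offspring
        after death.\<close>
      define T where "T = (if t < L then t else L)"
      define k where "k = (if t < L then 1 else real (fst (snd q)))"
      define w where "w = (if t < L then 0 else jump_sum (snd q))"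
      have L: "life (z, q) = L" for z by (simp add: L_def life_def)
      have T: "s \<le> T" "0 \<le> T" using True s by (auto simp: T_def L_def)
      have "innov c t x (z, q) - innov c s x (z, q) = weight c x T k w z - weight c x s 1 0 z" for z
        using True s by (simp add: innov_def contrib_def L children_def T_def k_def w_def L_def[symmetric])
      then have "(\<integral>\<^sup>+z. ennreal ((innov c t x (z, q) - innov c s x (z, q))\<^sup>2) \<partial>PZ)
          = (\<integral>\<^sup>+z. ennreal ((weight c x T k w z - weight c x s 1 0 z)\<^sup>2) \<partial>PZ)" by simp
      also have "\<dots> \<le> (\<integral>\<^sup>+z. 2 * (ennreal ((weight c x T k w z)\<^sup>2) + ennreal ((weight c x s 1 0 z)\<^sup>2)) \<partial>PZ)"
      proof (rule nn_integral_mono)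
        fix z
        have "ennreal ((weight c x T k w z - weight c x s 1 0 z)\<^sup>2) \<le> ennreal (2 * ((weight c x T k w z)\<^sup>2 + (weight c x s 1 0 z)\<^sup>2))"
          by (intro ennreal_leI diff2_square_le)
        also have "\<dots> = 2 * (ennreal ((weight c x T k w z)\<^sup>2) + ennreal ((weight c x s 1 0 z)\<^sup>2))"
          by (simp add: ennreal_mult)
        finally show "ennreal ((weight c x T k w z - weight c x s 1 0 z)\<^sup>2) \<le> \<dots>" .
      qed
      also have "\<dots> = 2 * ((\<integral>\<^sup>+z. ennreal ((weight c x T k w z)\<^sup>2) \<partial>PZ) + (\<integral>\<^sup>+z. ennreal ((weight c x s 1 0 z)\<^sup>2) \<partial>PZ))"
      proof -
        have [measurable]: "(\<lambda>z. weight c x u k' w' z) \<in> borel_measurable PZ" for u k' w'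
          by (rule weight_measurable_raw) (auto simp: measurable_cong_sets[OF sets_PZ refl])
        show ?thesis by (simp add: nn_integral_cmult nn_integral_add)
      qed
      also have "\<dots> \<le> 2 * (ennreal (C * exp (- (alpha / 2) * s) * (1 + x\<^sup>2) * (1 + (real (fst (snd q)))\<^sup>2 + (jump_sum (snd q))\<^sup>2))
          + ennreal (C * exp (- (alpha / 2) * s) * (1 + x\<^sup>2) * (1 + (real (fst (snd q)))\<^sup>2 + (jump_sum (snd q))\<^sup>2)))"
      proof (intro mult_left_mono add_mono)
        have "C * exp (- (alpha / 2) * T) * (1 + x\<^sup>2) * (k\<^sup>2 + w\<^sup>2)
           \<le> C * exp (- (alpha / 2) * s) * (1 + x\<^sup>2) * (1 + (real (fst (snd q)))\<^sup>2 + (jump_sum (snd q))\<^sup>2)"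
          using C(1) T(1) alpha_pos by (intro mult_mono mult_left_mono) (auto simp: k_def w_def)
        then show "(\<integral>\<^sup>+z. ennreal ((weight c x T k w z)\<^sup>2) \<partial>PZ)
          \<le> ennreal (C * exp (- (alpha / 2) * s) * (1 + x\<^sup>2) * (1 + (real (fst (snd q)))\<^sup>2 + (jump_sum (snd q))\<^sup>2))"
          by (intro order_trans[OF C(2)[OF T(2)]] ennreal_leI)
        have "C * exp (- (alpha / 2) * s) * (1 + x\<^sup>2) * (1\<^sup>2 + 0\<^sup>2)
           \<le> C * exp (- (alpha / 2) * s) * (1 + x\<^sup>2) * (1 + (real (fst (snd q)))\<^sup>2 + (jump_sum (snd q))\<^sup>2)"
          using C(1) by (intro mult_mono mult_left_mono) auto
        then show "(\<integral>\<^sup>+z. ennreal ((weight c x s 1 0 z)\<^sup>2) \<partial>PZ)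
          \<le> ennreal (C * exp (- (alpha / 2) * s) * (1 + x\<^sup>2) * (1 + (real (fst (snd q)))\<^sup>2 + (jump_sum (snd q))\<^sup>2))"
          by (intro order_trans[OF C(2)[OF s(1)]] ennreal_leI)
      qed simp_all
      also have "\<dots> = ennreal (4 * C * exp (- (alpha / 2) * s) * (1 + x\<^sup>2) * (1 + (real (fst (snd q)))\<^sup>2 + (jump_sum (snd q))\<^sup>2))"
      proof -
        define y where "y = C * exp (- (alpha / 2) * s) * (1 + x\<^sup>2) * (1 + (real (fst (snd q)))\<^sup>2 + (jump_sum (snd q))\<^sup>2)"
        have "0 \<le> y" using C(1) by (auto simp: y_def intro!: mult_nonneg_nonneg)
        then have "2 * (ennreal y + ennreal y) = ennreal (4 * y)"
          by (simp add: ennreal_plus[symmetric] ennreal_mult[of 4 y, symmetric] flip: ennreal_plus ennreal_numeral ennreal_mult)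
        then show ?thesis by (simp add: y_def mult.assoc)
      qed
      finally show ?thesis .
    qed
    have [measurable]: "(\<lambda>d. innov c t x d) \<in> borel_measurable P0" for t
      by (rule innov_measurable_raw) (auto simp: measurable_cong_sets[OF sets_P0 refl])
    have "(\<integral>\<^sup>+d. ennreal ((innov c t x d - innov c s x d)\<^sup>2) \<partial>P0)
        = (\<integral>\<^sup>+q. (\<integral>\<^sup>+z. ennreal ((innov c t x (z, q) - innov c s x (z, q))\<^sup>2) \<partial>PZ) \<partial>(PA \<Otimes>\<^sub>M PO))"
      by (rule P0.nn_integral_snd[symmetric]) measurable
    also have "\<dots> \<le> (\<integral>\<^sup>+q. ennreal (4 * C * exp (- (alpha / 2) * s) * (1 + x\<^sup>2) * (1 + (real (fst (snd q)))\<^sup>2 + (jump_sum (snd q))\<^sup>2)) \<partial>(PA \<Otimes>\<^sub>M PO))"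
      by (intro nn_integral_mono inner)
    also have "\<dots> = (\<integral>\<^sup>+a. (\<integral>\<^sup>+p. ennreal (4 * C * exp (- (alpha / 2) * s) * (1 + x\<^sup>2) * (1 + (real (fst p))\<^sup>2 + (jump_sum p)\<^sup>2)) \<partial>PO) \<partial>PA)"
    proof (subst PO.nn_integral_fst[symmetric])
      have [measurable]: "(\<lambda>q. real (fst (snd q))) \<in> borel_measurable (PA \<Otimes>\<^sub>M PO)" "(\<lambda>q. jump_sum (snd q)) \<in> borel_measurable (PA \<Otimes>\<^sub>M PO)"
        by (rule measurable_compose[OF measurable_snd], simp)+
      show "(\<lambda>q. ennreal (4 * C * exp (- (alpha / 2) * s) * (1 + x\<^sup>2) * (1 + (real (fst (snd q)))\<^sup>2 + (jump_sum (snd q))\<^sup>2))) \<in> borel_measurable (PA \<Otimes>\<^sub>M PO)"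
        by measurable
    qed simp
    also have "\<dots> = (\<integral>\<^sup>+p. ennreal (4 * C * exp (- (alpha / 2) * s) * (1 + x\<^sup>2) * (1 + (real (fst p))\<^sup>2 + (jump_sum p)\<^sup>2)) \<partial>PO)"
      by (simp add: PA.emeasure_space_1[simplified])
    also have "\<dots> = ennreal (\<integral>p. 4 * C * exp (- (alpha / 2) * s) * (1 + x\<^sup>2) * (1 + (real (fst p))\<^sup>2 + (jump_sum p)\<^sup>2) \<partial>PO)"
      using C(1) children_square_integrable jump_sum_square_integrable
      by (intro nn_integral_eq_integral) (auto intro!: mult_nonneg_nonneg)
    also have "(\<integral>p. 4 * C * exp (- (alpha / 2) * s) * (1 + x\<^sup>2) * (1 + (real (fst p))\<^sup>2 + (jump_sum p)\<^sup>2) \<partial>PO) = B * (1 + x\<^sup>2) * exp (- (alpha / 2) * s)"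
      by (simp add: B_def)
    finally show ?thesis .
  qed
  have "(\<integral>\<^sup>+d. ennreal ((innov c t x d - innov c s x d)\<^sup>2) \<partial>P0) \<le> ennreal (B * (1 + x\<^sup>2) * exp (- (alpha / 2) * s))"
    if st: "s \<le> t" "0 \<le> t" for x s t
  proof (cases "0 \<le> s")
    case True then show ?thesis using main st by blast
  next
    case False
    have "(\<integral>\<^sup>+d. ennreal ((innov c t x d - innov c s x d)\<^sup>2) \<partial>P0) = (\<integral>\<^sup>+d. ennreal ((innov c t x d - innov c 0 x d)\<^sup>2) \<partial>P0)"
      using AE_innov_zero[of c x] False by (intro nn_integral_cong_AE) (auto elim!: eventually_mono simp: innov_def[of c s])
    also have "\<dots> \<le> ennreal (B * (1 + x\<^sup>2) * exp (- (alpha / 2) * 0))" by (rule main) (use st in auto)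
    also have "\<dots> \<le> ennreal (B * (1 + x\<^sup>2) * exp (- (alpha / 2) * s))"
      using False B0 alpha_pos by (intro ennreal_leI mult_left_mono) (auto simp: mult_le_0_iff zero_le_mult_iff)
    finally show ?thesis .
  qed
  then show ?thesis using B0 by blast
qed

end

text \<open>The factor of \<open>x\<^sup>2\<close> can be kept as close to 1 as desired; otherwise
  the contraction in \<open>offspring_lyapunov\<close> would be lost.\<close>

lemma add_square_eps_le:
  fixes x y \<epsilon> :: real
  assumes "0 < \<epsilon>"
  shows "(x + y)\<^sup>2 \<le> (1 + \<epsilon>) * x\<^sup>2 + (1 + 1 / \<epsilon>) * y\<^sup>2"
proof -
  have "0 \<le> (\<epsilon> * x - y)\<^sup>2 / \<epsilon>" using assms by simp
  also have "\<dots> = \<epsilon> * x\<^sup>2 - 2 * x * y + y\<^sup>2 / \<epsilon>"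
    using assms by (simp add: power2_eq_square field_simps)
  finally show ?thesis by (simp add: power2_eq_square algebra_simps)
qed

text \<open>The centred displacement from the birth position of a particle to that of its
  \<open>i\<close>-th child.\<close>

definition step :: "real \<Rightarrow> particle \<Rightarrow> nat \<Rightarrow> real" where
  "step r d i = eval_right (fst d) (life d) - r * life d + jump d i"

lemma step_measurable [measurable]: "(\<lambda>d. step r d i) \<in> borel_measurable particle_space"
proof -
  have "(\<lambda>d. eval_right (fst d) (life d)) \<in> borel_measurable particle_space"
    using measurable_compose[OF measurable_Pair[OF measurable_fst life_measurable] eval_right_measurable] by simp
  then show ?thesis unfolding step_def by measurable
qed

section \<open>Mean-zero increments, memoryless lifetimes and contraction over one
  generation\<close>

context particle_law
begin

text \<open>Tested against the past up to \<open>s\<close>, the motion enters only through the two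
  numbers \<open>G\<close> and \<open>Y\<close>. The increment after \<open>s\<close> contributes
  \<open>mu * (t - s) * G\<close>, and \<open>mu - drift = - lam * mean_jump\<close> leaves the term
  that the jumps will compensate.\<close>

lemma weight_stopped_integral:
  assumes s: "0 \<le> s" "s \<le> t" and g: "g \<in> borel_measurable path_space" "\<And>z. \<bar>g z\<bar> \<le> B"
  defines "G \<equiv> \<integral>z. g (stopped s z) \<partial>PZ" and "Y \<equiv> \<integral>z. z s * g (stopped s z) \<partial>PZ"
  shows "(\<integral>z. weight c x t k w z * g (stopped s z) \<partial>PZ) =
    exp (- alpha * t) * (k * (x * G + c * (Y - drift * s * G) - c * lam * mean_jump * (t - s) * G) + c * w * G)"
    and "integrable PZ (\<lambda>z. weight c x t k w z * g (stopped s z))"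
proof -
  have t: "0 \<le> t" using s by simp
  have gm[measurable]: "(\<lambda>z. g (stopped s z)) \<in> borel_measurable PZ"
    using measurable_compose[OF stopped_measurable g(1)] by (simp add: measurable_cong_sets[OF sets_PZ refl])
  have ig: "integrable PZ (\<lambda>z. g (stopped s z))"
    by (rule PZ.integrable_const_bound[of _ B]) (use g(2) in auto)
  have izg: "integrable PZ (\<lambda>z. z u * g (stopped s z))" if "0 \<le> u" for u
  proof (rule Bochner_Integration.integrable_bound)
    show "integrable PZ (\<lambda>z. B * z u)" using integrable_path[OF that] by simp
    show "AE z in PZ. norm (z u * g (stopped s z)) \<le> norm (B * z u)"
      using order_trans[OF g(2) abs_ge_self]
      by (auto simp: abs_mult mult.commute[of "\<bar>B\<bar>"] intro!: mult_left_mono)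
    show "(\<lambda>z. z u * g (stopped s z)) \<in> borel_measurable PZ" using integrable_path[OF that] by measurable
  qed
  let ?R = "\<lambda>z. exp (- alpha * t) * ((k * x - k * c * drift * t + c * w) * g (stopped s z) + k * c * (z t * g (stopped s z)))"
  have iR: "integrable PZ ?R" using ig izg[OF t] by simp
  have AE: "AE z in PZ. weight c x t k w z * g (stopped s z) = ?R z"
    using eval_right[OF t] by eventually_elim (simp add: weight_def algebra_simps)
  have wm: "weight c x t k w \<in> borel_measurable PZ"
    by (rule weight_measurable_raw) (auto simp: measurable_cong_sets[OF sets_PZ refl])
  show "integrable PZ (\<lambda>z. weight c x t k w z * g (stopped s z))"
    by (rule integrable_cong_AE_imp[OF iR]) (use AE wm in \<open>auto elim!: eventually_mono\<close>)
  have "(\<integral>z. (z t - z s) * g (stopped s z) \<partial>PZ) = mu * (t - s) * G"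
    unfolding G_def by (rule path_increment[OF s g(1) g(2)])
  then have "(\<integral>z. z t * g (stopped s z) \<partial>PZ) = mu * (t - s) * G + Y"
    using izg[OF t] izg[OF s(1)] by (simp add: left_diff_distrib Y_def)
  moreover have "(\<integral>z. weight c x t k w z * g (stopped s z) \<partial>PZ) = (\<integral>z. ?R z \<partial>PZ)"
    by (rule integral_cong_AE) (use AE wm iR in auto)
  ultimately have "(\<integral>z. weight c x t k w z * g (stopped s z) \<partial>PZ) =
      exp (- alpha * t) * ((k * x - k * c * drift * t + c * w) * G + k * c * (mu * (t - s) * G + Y))"
    using ig izg[OF t] by (simp add: G_def)
  also have "\<dots> = exp (- alpha * t) * (k * (x * G + c * (Y - drift * s * G) - c * lam * mean_jump * (t - s) * G) + c * w * G)"
    by (simp add: drift_def algebra_simps)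
  finally show "(\<integral>z. weight c x t k w z * g (stopped s z) \<partial>PZ) = \<dots>" .
qed

lemma nn_integral_PA:
  assumes \<theta>: "0 \<le> \<theta>"
  shows "(\<integral>\<^sup>+a. ennreal (exp (- \<theta> * \<bar>a\<bar>)) * indicator {s<..} \<bar>a\<bar> \<partial>PA) =
    ennreal (lam / (lam + \<theta>) * exp (- (lam + \<theta>) * max 0 s))"
proof -
  have pos: "AE a in PA. 0 < a"
    using AE_lborel_singleton[of 0]
    by (subst AE_density) (auto simp: exponential_density_def elim!: eventually_mono)
  have "(\<integral>\<^sup>+a. ennreal (exp (- \<theta> * \<bar>a\<bar>)) * indicator {s<..} \<bar>a\<bar> \<partial>PA) =
      (\<integral>\<^sup>+a. ennreal (exp (- \<theta> * a)) * indicator {max 0 s<..} a \<partial>PA)"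
    by (rule nn_integral_cong_AE) (use pos in \<open>auto elim!: eventually_mono split: split_indicator\<close>)
  then show ?thesis using nn_integral_exponential_gt[OF lam_pos \<theta>, of "max 0 s"] by simp
qed

lemma nn_integral_P0_product:
  assumes [measurable]: "f \<in> borel_measurable PZ" "u \<in> borel_measurable borel" "h \<in> borel_measurable PO"
  shows "(\<integral>\<^sup>+d. f (fst d) * (u (fst (snd d)) * h (snd (snd d))) \<partial>P0) =
    (\<integral>\<^sup>+z. f z \<partial>PZ) * ((\<integral>\<^sup>+a. u a \<partial>PA) * (\<integral>\<^sup>+p. h p \<partial>PO))"
proof -
  have [measurable]: "(\<lambda>q. u (fst q) * h (snd q)) \<in> borel_measurable (PA \<Otimes>\<^sub>M PO)"
  proof (intro borel_measurable_times_ennreal)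
    show "(\<lambda>q. u (fst q)) \<in> borel_measurable (PA \<Otimes>\<^sub>M PO)" by (rule measurable_compose[OF measurable_fst]) simp
    show "(\<lambda>q. h (snd q)) \<in> borel_measurable (PA \<Otimes>\<^sub>M PO)" by (rule measurable_compose[OF measurable_snd]) simp
  qed
  have [measurable]: "(\<lambda>d. f (fst d) * (u (fst (snd d)) * h (snd (snd d)))) \<in> borel_measurable P0"
  proof (intro borel_measurable_times_ennreal[of _ P0 "\<lambda>d. u (fst (snd d)) * h (snd (snd d))"])
    show "(\<lambda>d. f (fst d)) \<in> borel_measurable P0" by (rule measurable_compose[OF measurable_fst]) simp
    show "(\<lambda>d. u (fst (snd d)) * h (snd (snd d))) \<in> borel_measurable P0"
      by (rule measurable_compose[OF measurable_snd, of "\<lambda>q. u (fst q) * h (snd q)"]) simp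
  qed
  have um: "u \<in> borel_measurable PA" by simp
  have "(\<integral>\<^sup>+d. f (fst d) * (u (fst (snd d)) * h (snd (snd d))) \<partial>P0) =
      (\<integral>\<^sup>+z. (\<integral>\<^sup>+q. f z * (u (fst q) * h (snd q)) \<partial>(PA \<Otimes>\<^sub>M PO)) \<partial>PZ)"
    by (subst PAO.nn_integral_fst[symmetric]) auto
  also have "\<dots> = (\<integral>\<^sup>+z. f z \<partial>PZ) * (\<integral>\<^sup>+q. u (fst q) * h (snd q) \<partial>(PA \<Otimes>\<^sub>M PO))"
    by (simp add: nn_integral_cmult nn_integral_multc)
  also have "(\<integral>\<^sup>+q. u (fst q) * h (snd q) \<partial>(PA \<Otimes>\<^sub>M PO)) = (\<integral>\<^sup>+a. (\<integral>\<^sup>+p. u a * h p \<partial>PO) \<partial>PA)"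
    by (subst PO.nn_integral_fst[symmetric]) auto
  also have "\<dots> = (\<integral>\<^sup>+a. u a \<partial>PA) * (\<integral>\<^sup>+p. h p \<partial>PO)"
    using um by (simp add: nn_integral_cmult nn_integral_multc)
  finally show ?thesis .
qed

lemma nn_integral_children: "(\<integral>\<^sup>+p. ennreal (real (fst p)) \<partial>PO) = ennreal mean_children"
  unfolding mean_children_def by (rule nn_integral_eq_integral[OF integrable_children]) simp

text \<open>Memorylessness: given a lifetime beyond \<open>s\<close>, the expected number of
  children, discounted at death, is \<open>mean_children * lam / (lam + \<theta>)\<close> times the
  discount at \<open>s\<close>. The factor \<open>g\<close> depends on the motion alone, which is
  independent of lifetime and offspring.\<close>

lemma nn_integral_offspring_gt:
  assumes g[measurable]: "g \<in> borel_measurable PZ" and \<theta>: "0 \<le> \<theta>"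
  shows "(\<integral>\<^sup>+d. g (fst d) * (ennreal (exp (- \<theta> * life d)) * indicator {s<..} (life d) * ennreal (real (children d))) \<partial>P0) =
    ennreal (mean_children * lam / (lam + \<theta>) * exp (- \<theta> * max 0 s)) * (\<integral>\<^sup>+d. g (fst d) * indicator {s<..} (life d) \<partial>P0)"
proof -
  have 1: "(\<integral>\<^sup>+d. g (fst d) * (ennreal (exp (- \<theta> * life d)) * indicator {s<..} (life d) * ennreal (real (children d))) \<partial>P0) =
      (\<integral>\<^sup>+z. g z \<partial>PZ) * (ennreal (lam / (lam + \<theta>) * exp (- (lam + \<theta>) * max 0 s)) * ennreal mean_children)"
    unfolding life_def children_def nn_integral_PA[OF \<theta>, of s, symmetric] nn_integral_children[symmetric]
    by (rule nn_integral_P0_product) (auto intro!: borel_measurable_times_ennreal)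
  have 2: "(\<integral>\<^sup>+d. g (fst d) * indicator {s<..} (life d) \<partial>P0) =
      (\<integral>\<^sup>+z. g z \<partial>PZ) * (ennreal (exp (- lam * max 0 s)) * 1)"
  proof -
    have "(\<integral>\<^sup>+d. g (fst d) * (indicator {s<..} \<bar>fst (snd d)\<bar> * 1) \<partial>P0) =
      (\<integral>\<^sup>+z. g z \<partial>PZ) * ((\<integral>\<^sup>+a. indicator {s<..} \<bar>a\<bar> \<partial>PA) * (\<integral>\<^sup>+p. 1 \<partial>PO))"
      by (rule nn_integral_P0_product) auto
    then show ?thesis using nn_integral_PA[of 0 s] lam_pos by (simp add: life_def PO.emeasure_space_1)
  qed
  have 3: "ennreal (lam / (lam + \<theta>) * exp (- (lam + \<theta>) * max 0 s)) * ennreal mean_children =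
     ennreal (mean_children * lam / (lam + \<theta>) * exp (- \<theta> * max 0 s)) * ennreal (exp (- lam * max 0 s))"
    using lam_pos \<theta> mean_children_gt_1
    by (simp add: ennreal_mult[symmetric] exp_add[symmetric] algebra_simps)
  show ?thesis unfolding 1 2 3 by (simp add: mult_ac)
qed

text \<open>For the population count the motion drops out, and both values compared lie between 0
  and the discount at \<open>s\<close> times \<open>1 + children\<close>. The full rate
  \<open>2 * alpha\<close> and the indicator of survival beyond \<open>s\<close> are retained, since
  the conditional variance bound relies on both.\<close>

lemma innov_count_bound:
  assumes "s \<le> t" "0 \<le> t"
  shows "(innov 0 t 1 d - innov 0 s 1 d)\<^sup>2 \<le> indicator {s<..} (life d) * (exp (- (2 * alpha) * max 0 s) * (1 + real (children d))\<^sup>2)"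
proof (cases "s < life d")
  case False
  then have "\<not> s < 0" using life_nonneg[of d] by linarith
  then have "innov 0 t 1 d = innov 0 s 1 d" using False assms by (simp add: innov_def contrib_def)
  then show ?thesis using False by simp
next
  case True
  have c: "0 \<le> contrib 0 t 1 d \<and> contrib 0 t 1 d \<le> exp (- alpha * max 0 s) * (1 + real (children d))"
  proof (cases "t < life d")
    case True
    then have "contrib 0 t 1 d = exp (- alpha * t)" by (simp add: contrib_def weight_def)
    moreover have "exp (- alpha * t) * 1 \<le> exp (- alpha * max 0 s) * (1 + real (children d))"
      using assms alpha_pos by (intro mult_mono) auto
    ultimately show ?thesis by simp
  next
    case False
    then have "contrib 0 t 1 d = exp (- alpha * life d) * real (children d)" by (simp add: contrib_def weight_def)
    moreover have "exp (- alpha * life d) * real (children d) \<le> exp (- alpha * max 0 s) * (1 + real (children d))"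
      using True life_nonneg[of d] alpha_pos by (intro mult_mono) auto
    ultimately show ?thesis by simp
  qed
  have "\<bar>innov 0 t 1 d - innov 0 s 1 d\<bar> \<le> exp (- alpha * max 0 s) * (1 + real (children d))"
  proof (cases "s < 0")
    case True
    then show ?thesis using c assms by (auto simp: innov_def)
  next
    case False
    then have "innov 0 t 1 d - innov 0 s 1 d = contrib 0 t 1 d - exp (- alpha * s)"
      using True assms by (simp add: innov_def contrib_def[of _ s] weight_def)
    moreover have "exp (- alpha * s) * 1 \<le> exp (- alpha * max 0 s) * (1 + real (children d))"
      using False by (intro mult_mono) auto
    moreover have "0 < exp (- alpha * s)" by simp
    ultimately show ?thesis using c by linarith
  qed
  then have "(innov 0 t 1 d - innov 0 s 1 d)\<^sup>2 \<le> (exp (- alpha * max 0 s) * (1 + real (children d)))\<^sup>2"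
    using abs_le_square_iff[of "innov 0 t 1 d - innov 0 s 1 d" "exp (- alpha * max 0 s) * (1 + real (children d))"] by simp
  also have "\<dots> = exp (- (2 * alpha) * max 0 s) * (1 + real (children d))\<^sup>2"
    by (simp add: power_mult_distrib exp_double[symmetric])
  finally show ?thesis using True by simp
qed

text \<open>Offspring are independent of lifetime and motion, so their second moment factors out and
  only survival beyond \<open>s\<close> is left inside the integral with \<open>g\<close>.\<close>

lemma nn_integral_innov_count:
  assumes g[measurable]: "g \<in> borel_measurable PZ" and st: "s \<le> t" "0 \<le> t"
  shows "(\<integral>\<^sup>+d. g (fst d) * ennreal ((innov 0 t 1 d - innov 0 s 1 d)\<^sup>2) \<partial>P0) \<le>
    ennreal ((\<integral>p. (1 + real (fst p))\<^sup>2 \<partial>PO) * exp (- (2 * alpha) * max 0 s)) * (\<integral>\<^sup>+d. g (fst d) * indicator {s<..} (life d) \<partial>P0)"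
proof -
  let ?C = "\<integral>p. (1 + real (fst p))\<^sup>2 \<partial>PO"
  have i: "integrable PO (\<lambda>p. (1 + real (fst p))\<^sup>2)"
    using children_square_integrable integrable_children by (simp add: power2_sum)
  have "(\<integral>\<^sup>+d. g (fst d) * ennreal ((innov 0 t 1 d - innov 0 s 1 d)\<^sup>2) \<partial>P0) \<le>
     (\<integral>\<^sup>+d. g (fst d) * (ennreal (exp (- (2 * alpha) * max 0 s)) * indicator {s<..} \<bar>fst (snd d)\<bar> * ennreal ((1 + real (fst (snd (snd d))))\<^sup>2)) \<partial>P0)"
  proof (intro nn_integral_mono mult_left_mono)
    fix d
    have "ennreal ((innov 0 t 1 d - innov 0 s 1 d)\<^sup>2) \<le> ennreal (indicator {s<..} (life d) * (exp (- (2 * alpha) * max 0 s) * (1 + real (children d))\<^sup>2))"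
      by (rule ennreal_leI[OF innov_count_bound[OF st]])
    also have "\<dots> = ennreal (exp (- (2 * alpha) * max 0 s)) * indicator {s<..} \<bar>fst (snd d)\<bar> * ennreal ((1 + real (fst (snd (snd d))))\<^sup>2)"
      by (auto simp: ennreal_mult life_def children_def split: split_indicator)
    finally show "ennreal ((innov 0 t 1 d - innov 0 s 1 d)\<^sup>2) \<le> \<dots>" .
  qed simp
  also have "\<dots> = (\<integral>\<^sup>+z. g z \<partial>PZ) * ((\<integral>\<^sup>+a. ennreal (exp (- (2 * alpha) * max 0 s)) * indicator {s<..} \<bar>a\<bar> \<partial>PA) * (\<integral>\<^sup>+p. ennreal ((1 + real (fst p))\<^sup>2) \<partial>PO))"
    by (rule nn_integral_P0_product) auto
  also have "(\<integral>\<^sup>+p. ennreal ((1 + real (fst p))\<^sup>2) \<partial>PO) = ennreal ?C"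
    by (rule nn_integral_eq_integral[OF i]) simp
  also have "(\<integral>\<^sup>+a. ennreal (exp (- (2 * alpha) * max 0 s)) * indicator {s<..} \<bar>a\<bar> \<partial>PA) =
      ennreal (exp (- (2 * alpha) * max 0 s)) * (\<integral>\<^sup>+a. indicator {s<..} \<bar>a\<bar> \<partial>PA)"
    by (rule nn_integral_cmult) simp
  also have "(\<integral>\<^sup>+z. g z \<partial>PZ) * (ennreal (exp (- (2 * alpha) * max 0 s)) * (\<integral>\<^sup>+a. indicator {s<..} \<bar>a\<bar> \<partial>PA) * ennreal ?C) =
      ennreal (?C * exp (- (2 * alpha) * max 0 s)) * ((\<integral>\<^sup>+z. g z \<partial>PZ) * (\<integral>\<^sup>+a. indicator {s<..} \<bar>a\<bar> \<partial>PA))"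
    by (simp add: ennreal_mult mult_ac)
  also have "(\<integral>\<^sup>+z. g z \<partial>PZ) * (\<integral>\<^sup>+a. indicator {s<..} \<bar>a\<bar> \<partial>PA) = (\<integral>\<^sup>+d. g (fst d) * indicator {s<..} (life d) \<partial>P0)"
    using nn_integral_P0_product[of g "\<lambda>a. indicator {s<..} \<bar>a\<bar>" "\<lambda>_. 1"]
    by (simp add: life_def PO.emeasure_space_1)
  finally show ?thesis .
qed

lemma innov_increment_integrable:
  assumes "s \<le> t" "0 \<le> t"
  shows "integrable P0 (\<lambda>d. (innov c t x d - innov c s x d)\<^sup>2)"
proof -
  obtain C where "(\<integral>\<^sup>+d. ennreal ((innov c t x d - innov c s x d)\<^sup>2) \<partial>P0) \<le> ennreal (C * (1 + x\<^sup>2) * exp (- (alpha / 2) * s))"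
    using nn_integral_innov_square[of c] assms by blast
  then have "(\<integral>\<^sup>+d. ennreal ((innov c t x d - innov c s x d)\<^sup>2) \<partial>P0) < \<infinity>"
    using le_less_trans ennreal_less_top by fastforce
  moreover have "(\<lambda>d. innov c u x d) \<in> borel_measurable P0" for u
    by (rule innov_measurable_raw) (auto simp: measurable_cong_sets[OF sets_P0 refl])
  ultimately show ?thesis by (intro integrableI_nonneg) auto
qed

lemma lam_mean_children: "lam * mean_children = lam + alpha"
  by (simp add: alpha_def algebra_simps)

text \<open>\<open>K\<close> is the mean increment as a function of the lifetime, once motion and
  offspring are integrated out. \<open>U\<close> stands for the tested count at age \<open>s\<close>
  and \<delta> for the tested mean total jump. That the integral vanishes is the calculation behind
  the choice of growth rate and drift.\<close>

lemma lifetime_integral: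
  fixes U \<beta> \<delta> :: real
  assumes s: "0 \<le> s" "s \<le> t"
  defines "K \<equiv> \<lambda>L. if L \<le> s then 0 else if t < L then exp (- alpha * t) * (U - lam * \<delta> * (t - s)) - exp (- alpha * s) * U
    else exp (- alpha * L) * (mean_children * (U - lam * \<delta> * (L - s)) + \<delta>) - exp (- alpha * s) * U"
  shows "(\<integral>a. K \<bar>a\<bar> \<partial>PA) = 0"
proof -
  let ?c1 = "exp (- alpha * t) * (U - lam * \<delta> * (t - s))" and ?c2 = "exp (- alpha * s) * U"
  let ?k = "\<lambda>a. exp (- alpha * a) * (mean_children * (U - lam * \<delta> * (a - s)) + \<delta>)"
  let ?f = "\<lambda>a. ?k a * (lam * exp (- a * lam))"
  \<comment> \<open>An antiderivative of \<open>?f\<close>, by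
    \<open>lam * mean_children = lam + alpha\<close>. Its boundary values cancel the terms for
    survival beyond \<open>t\<close> and beyond \<open>s\<close>.\<close>
  let ?F = "\<lambda>a. - exp (- (lam + alpha) * a) * (U - lam * \<delta> * (a - s))"
  have pos: "AE a in PA. 0 < a"
    using AE_lborel_singleton[of 0]
    by (subst AE_density) (auto simp: exponential_density_def elim!: eventually_mono)
  have gt: "measure PA {u<..} = exp (- lam * u)" if "0 \<le> u" for u
    using nn_integral_exponential_gt[OF lam_pos, of 0 u] that lam_pos
    by (simp add: PA.emeasure_eq_measure)
  have igt: "integrable PA (\<lambda>a. indicator {u<..} a * y :: real)" for u y
    by (rule PA.integrable_const_bound[of _ "\<bar>y\<bar>"]) (auto split: split_indicator)
  have ck: "continuous_on {s..t} ?k" by (intro continuous_intros)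
  have "bounded (?k ` {s..t})"
    by (rule compact_imp_bounded[OF compact_continuous_image[OF ck compact_Icc]])
  then obtain B where "\<forall>y\<in>?k ` {s..t}. norm y \<le> B" unfolding bounded_iff by blast
  then have B: "\<bar>?k a\<bar> \<le> B" if "a \<in> {s..t}" for a using that by auto
  have ik: "integrable PA (\<lambda>a. indicator {s..t} a * ?k a)"
  proof (rule PA.integrable_const_bound[of _ "\<bar>B\<bar>"])
    show "AE a in PA. norm (indicator {s..t} a * ?k a) \<le> \<bar>B\<bar>"
      using B by (intro AE_I2) (force split: split_indicator)
  qed simp
  \<comment> \<open>At \<open>a = s\<close> the closed indicator and \<open>K\<close> may disagree;
    the point carries no mass.\<close>
  have ns: "AE a in PA. a \<noteq> s"
    by (subst AE_density) (use AE_lborel_singleton[of s] in \<open>auto elim!: eventually_mono\<close>)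
  have "(\<integral>a. K \<bar>a\<bar> \<partial>PA) = (\<integral>a. indicator {t<..} a * ?c1 - indicator {s<..} a * ?c2 + indicator {s..t} a * ?k a \<partial>PA)"
  proof (rule integral_cong_AE)
    show "AE a in PA. K \<bar>a\<bar> = indicator {t<..} a * ?c1 - indicator {s<..} a * ?c2 + indicator {s..t} a * ?k a"
      using pos ns by eventually_elim (use s in \<open>auto simp: K_def split: split_indicator\<close>)
    show "(\<lambda>a. K \<bar>a\<bar>) \<in> borel_measurable PA" unfolding K_def by measurable
  qed (use igt ik in auto)
  also have "\<dots> = ?c1 * exp (- lam * t) - ?c2 * exp (- lam * s) + (\<integral>a. indicator {s..t} a * ?k a \<partial>PA)"
    using gt[of t] gt[of s] s
    by (subst Bochner_Integration.integral_add[OF Bochner_Integration.integrable_diff[OF igt igt] ik],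
        subst Bochner_Integration.integral_diff[OF igt igt]) simp
  also have "(\<integral>a. indicator {s..t} a * ?k a \<partial>PA) = (\<integral>a. exponential_density lam a * (indicator {s..t} a * ?k a) \<partial>lborel)"
    by (subst integral_density) (auto simp: exponential_density_nonneg lam_pos)
  also have "\<dots> = (\<integral>a. indicator {s..t} a *\<^sub>R ?f a \<partial>lborel)"
    using s by (intro Bochner_Integration.integral_cong) (auto simp: exponential_density_def split: split_indicator)
  also have "\<dots> = ?F t - ?F s"
  proof (rule integral_FTC_atLeastAtMost[OF s(2)])
    show "continuous_on {s..t} ?f" by (intro continuous_intros)
    fix a
    have e: "exp (- alpha * a) * exp (- a * lam) = exp (- (lam + alpha) * a)"
      unfolding exp_add[symmetric] by (rule arg_cong[where f = exp]) (simp add: algebra_simps)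
    have "(?F has_real_derivative (lam + alpha) * exp (- (lam + alpha) * a) * (U - lam * \<delta> * (a - s)) + exp (- (lam + alpha) * a) * (lam * \<delta>)) (at a within {s..t})"
      by (auto intro!: derivative_eq_intros simp: algebra_simps)
    also have "(lam + alpha) * exp (- (lam + alpha) * a) * (U - lam * \<delta> * (a - s)) + exp (- (lam + alpha) * a) * (lam * \<delta>) = ?f a"
    proof -
      have "?f a = (exp (- alpha * a) * exp (- a * lam)) * ((lam * mean_children) * (U - lam * \<delta> * (a - s)) + lam * \<delta>)"
        by (simp only: distrib_left mult_ac)
      also have "\<dots> = (lam + alpha) * exp (- (lam + alpha) * a) * (U - lam * \<delta> * (a - s)) + exp (- (lam + alpha) * a) * (lam * \<delta>)"
        unfolding e lam_mean_children distrib_left[of "exp (- (lam + alpha) * a)"] by (simp only: mult_ac)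
      finally show ?thesis by (rule sym)
    qed
    finally show "(?F has_vector_derivative ?f a) (at a within {s..t})"
      by (simp add: has_real_derivative_iff_has_vector_derivative)
  qed
  also have "?c1 * exp (- lam * t) - ?c2 * exp (- lam * s) + (?F t - ?F s) = 0"
  proof -
    have e: "exp (- alpha * u) * exp (- lam * u) = exp (- (lam + alpha) * u)" for u
      unfolding exp_add[symmetric] by (rule arg_cong[where f = exp]) (simp add: algebra_simps)
    have eq: "exp (- alpha * u) * y * exp (- lam * u) = exp (- (lam + alpha) * u) * y" for u y
      unfolding e[symmetric] by (simp only: mult_ac)
    show ?thesis unfolding eq by simp
  qed
  finally show ?thesis .
qed

text \<open>Integrating motion, offspring and lifetime in this order reduces the claim to
  \<open>lifetime_integral\<close>. Tests of the stopped motion suffice: a particle dead by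
  \<open>s\<close> has zero increment, and of one still alive only its motion is known at
  \<open>s\<close>.\<close>

lemma innov_increment_orthogonal:
  assumes st: "s \<le> t" "0 \<le> t" and g: "g \<in> borel_measurable path_space" "\<And>z. \<bar>g z\<bar> \<le> B"
  shows "(\<integral>d. (innov c t x d - innov c s x d) * g (stopped s (fst d)) \<partial>P0) = 0"
proof -
  have im[measurable]: "(\<lambda>d. innov c u x d) \<in> borel_measurable P0" for u
    by (rule innov_measurable_raw) (auto simp: measurable_cong_sets[OF sets_P0 refl])
  have gm[measurable]: "(\<lambda>d. g (stopped u (fst d))) \<in> borel_measurable P0" for u
    using measurable_compose[OF measurable_fst measurable_compose[OF stopped_measurable g(1)]]
    by (simp add: measurable_cong_sets[OF sets_P0 refl])
  have main: "(\<integral>d. (innov c t x d - innov c s x d) * g (stopped s (fst d)) \<partial>P0) = 0" if s: "0 \<le> s" "s \<le> t" for s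
  proof -
    define f where "f d = (innov c t x d - innov c s x d) * g (stopped s (fst d))" for d
    have fm[measurable]: "f \<in> borel_measurable P0" unfolding f_def by measurable
    define G where "G = (\<integral>z. g (stopped s z) \<partial>PZ)"
    define Y where "Y = (\<integral>z. z s * g (stopped s z) \<partial>PZ)"
    define U where "U = x * G + c * (Y - drift * s * G)"
    define \<delta> where "\<delta> = c * mean_jump * G"
    note W = weight_stopped_integral[OF _ _ g, folded G_def Y_def]
    have "integrable P0 (\<lambda>d. innov c t x d - innov c s x d)"
      by (rule P0.square_integrable_imp_integrable) (use innov_increment_integrable[OF s(2)] s in auto)
    then have int: "integrable P0 f"
    proof (rule Bochner_Integration.integrable_bound[OF integrable_mult_right[of B]])
      show "AE d in P0. norm (f d) \<le> norm (B * (innov c t x d - innov c s x d))"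
        unfolding f_def
        using order_trans[OF g(2) abs_ge_self]
        by (intro AE_I2) (auto simp: abs_mult mult.commute[of "\<bar>B\<bar>"] intro!: mult_left_mono)
    qed measurable
    define J where "J q = (let L = \<bar>fst q\<bar> in if L \<le> s then 0
      else if t < L then exp (- alpha * t) * (U - lam * \<delta> * (t - s)) - exp (- alpha * s) * U
      else exp (- alpha * L) * (real (fst (snd q)) * (U - lam * \<delta> * (L - s)) + c * jump_sum (snd q) * G) - exp (- alpha * s) * U)" for q
    have inner: "(\<integral>z. f (z, q) \<partial>PZ) = J q" for q
    proof (cases "\<bar>fst q\<bar> \<le> s")
      case True
      then have "innov c t x (z, q) = innov c s x (z, q)" for z
        using s by (simp add: innov_def contrib_def life_def children_def)
      then show ?thesis using True by (simp add: J_def f_def)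
    next
      case False
      define L where "L = \<bar>fst q\<bar>"
      define T where "T = (if t < L then t else L)"
      define k where "k = (if t < L then 1 else real (fst (snd q)))"
      define w where "w = (if t < L then 0 else jump_sum (snd q))"
      have T: "s \<le> T" using False s by (auto simp: T_def L_def)
      have "innov c t x (z, q) - innov c s x (z, q) = weight c x T k w z - weight c x s 1 0 z" for z
        using False s by (simp add: innov_def contrib_def life_def L_def children_def T_def k_def w_def)
      then have "(\<integral>z. f (z, q) \<partial>PZ) = (\<integral>z. weight c x T k w z * g (stopped s z) - weight c x s 1 0 z * g (stopped s z) \<partial>PZ)"
        by (simp add: left_diff_distrib f_def)
      also have "\<dots> = exp (- alpha * T) * (k * (U - lam * \<delta> * (T - s)) + c * w * G) - exp (- alpha * s) * U"
      proof -
        have "(\<integral>z. weight c x T k w z * g (stopped s z) \<partial>PZ) = exp (- alpha * T) * (k * (U - lam * \<delta> * (T - s)) + c * w * G)"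
          unfolding W(1)[OF s(1) T] U_def \<delta>_def G_def Y_def by (simp add: algebra_simps)
        moreover have "(\<integral>z. weight c x s 1 0 z * g (stopped s z) \<partial>PZ) = exp (- alpha * s) * U"
          unfolding W(1)[OF s(1) order_refl] U_def G_def Y_def by simp
        ultimately show ?thesis
          by (simp only: Bochner_Integration.integral_diff[OF W(2)[OF s(1) T] W(2)[OF s(1) order_refl]])
      qed
      also have "\<dots> = J q" using False by (simp add: J_def Let_def L_def T_def k_def w_def)
      finally show ?thesis .
    qed
    have intJ: "integrable (PA \<Otimes>\<^sub>M PO) J"
      using P0.integrable_snd[of "\<lambda>z q. f (z, q)"] int unfolding inner case_prod_eta .
    have "(\<integral>d. (innov c t x d - innov c s x d) * g (stopped s (fst d)) \<partial>P0) = (\<integral>d. f d \<partial>P0)"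
      by (simp add: f_def)
    also have "\<dots> = (\<integral>q. (\<integral>z. f (z, q) \<partial>PZ) \<partial>(PA \<Otimes>\<^sub>M PO))"
      using P0.integral_snd[of "\<lambda>z q. f (z, q)"] int unfolding case_prod_eta by simp
    also have "\<dots> = (\<integral>q. J q \<partial>(PA \<Otimes>\<^sub>M PO))" unfolding inner ..
    also have "\<dots> = (\<integral>a. (\<integral>p. J (a, p) \<partial>PO) \<partial>PA)"
      using PAO.integral_fst[of "\<lambda>a p. J (a, p)"] intJ by simp
    also have "(\<lambda>a. (\<integral>p. J (a, p) \<partial>PO)) = (\<lambda>a. (\<lambda>L. if L \<le> s then 0 else if t < L then exp (- alpha * t) * (U - lam * \<delta> * (t - s)) - exp (- alpha * s) * U
        else exp (- alpha * L) * (mean_children * (U - lam * \<delta> * (L - s)) + \<delta>) - exp (- alpha * s) * U) \<bar>a\<bar>)"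
      using integrable_children integrable_jump_sum
      by (auto simp: J_def Let_def fun_eq_iff PO.prob_space mean_children_def[symmetric] mean_jump_def[symmetric] \<delta>_def)
    also have "(\<integral>a. \<dots> a \<partial>PA) = 0" by (rule lifetime_integral[OF s])
    finally show ?thesis .
  qed
  show ?thesis
  proof (cases "0 \<le> s")
    case True then show ?thesis using main st by blast
  next
    case False
    \<comment> \<open>At a negative age the stopped path is that of age 0, and so, almost surely, is
      the value of \<open>innov\<close>.\<close>
    have st': "stopped s = stopped 0" using False by (simp add: stopped_def fun_eq_iff)
    have "(\<integral>d. (innov c t x d - innov c s x d) * g (stopped s (fst d)) \<partial>P0) =
        (\<integral>d. (innov c t x d - innov c 0 x d) * g (stopped 0 (fst d)) \<partial>P0)"
      unfolding st'
    proof (rule integral_cong_AE)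
      show "AE d in P0. (innov c t x d - innov c s x d) * g (stopped 0 (fst d)) = (innov c t x d - innov c 0 x d) * g (stopped 0 (fst d))"
        using AE_innov_zero[of c x] by eventually_elim (use False in \<open>simp add: innov_def[of c s]\<close>)
    qed measurable
    also have "\<dots> = 0" by (rule main) (use st in auto)
    finally show ?thesis .
  qed
qed

text \<open>The ratio is the mean number of children discounted at rate \<theta>. It equals 1 at
  \<theta> = \<open>alpha\<close>, the Malthusian parameter, and decreases in \<theta>.\<close>

lemma offspring_ratio_lt_1: "alpha < \<theta> \<Longrightarrow> mean_children * lam / (lam + \<theta>) < 1"
  using lam_mean_children lam_pos alpha_pos by (simp add: field_simps)

text \<open>The function \<open>K + x\<^sup>2\<close> of the count at birth, discounted at rate
  \<open>3 * alpha / 2\<close>, shrinks in mean from one generation to the next. The rate exceeds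
  \<open>alpha\<close>, so the discounted number of children contracts; it lies below
  \<open>2 * alpha\<close>, which leaves \<open>alpha / 2\<close> as decay in time.\<close>

lemma offspring_lyapunov:
  "\<exists>K\<ge>1. \<exists>\<rho>\<ge>0. \<rho> < 1 \<and> (\<forall>x. (\<integral>\<^sup>+d. (\<Sum>i=1..children d. ennreal (exp (- (3 * alpha / 2) * life d) * (K + (x + c * step drift d i)\<^sup>2))) \<partial>P0)
     \<le> ennreal (\<rho> * (K + x\<^sup>2)))"
proof -
  obtain C1 where C1: "C1 \<ge> 0" "\<And>t. 0 \<le> t \<Longrightarrow> (\<integral>z. (z t - drift * t)\<^sup>2 \<partial>PZ) \<le> C1 * (1 + t\<^sup>2)"
    using centred_second_moment by blast
  define \<theta> where "\<theta> = 3 * alpha / 2"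
  have \<theta>: "0 < \<theta>" "alpha < \<theta>" using alpha_pos by (auto simp: \<theta>_def)
  define C2 where "C2 = 1 + 2 / \<theta>\<^sup>2"
  have C2: "1 \<le> C2" "\<And>t. 0 \<le> t \<Longrightarrow> exp (- \<theta> * t) * (1 + t\<^sup>2) \<le> C2"
    using exp_square_bound[OF \<theta>(1)] by (auto simp: C2_def)
  define \<rho>0 where "\<rho>0 = mean_children * lam / (lam + \<theta>)"
  have \<rho>0: "0 < \<rho>0" "\<rho>0 < 1" using mean_children_gt_1 lam_pos \<theta> offspring_ratio_lt_1[OF \<theta>(2)] by (auto simp: \<rho>0_def)
  \<comment> \<open>Chosen so that \<open>(1 + \<epsilon>) * \<rho>0\<close> is the midpoint \<rho>
    between \<open>\<rho>0\<close> and 1.\<close>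
  define \<epsilon> where "\<epsilon> = (1 - \<rho>0) / (2 * \<rho>0)"
  define \<rho> where "\<rho> = (1 + \<rho>0) / 2"
  have \<epsilon>: "0 < \<epsilon>" "(1 + \<epsilon>) * \<rho>0 = \<rho>" using \<rho>0 by (auto simp: \<epsilon>_def \<rho>_def field_simps)
  have \<rho>: "0 \<le> \<rho>" "\<rho> < 1" "\<rho>0 < \<rho>" using \<rho>0 by (auto simp: \<rho>_def)
  define C3 where "C3 = (1 + 1 / \<epsilon>) * (2 * c\<^sup>2) * (C2 * (C1 + 1))"
  have C3: "0 \<le> C3" using \<epsilon>(1) C1 C2(1) by (auto simp: C3_def intro!: mult_nonneg_nonneg)
  define m2 where "m2 = mean_children + (\<integral>p. jump_square_sum p \<partial>PO)"
  have "0 \<le> (\<integral>p. jump_square_sum p \<partial>PO)"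
    by (rule Bochner_Integration.integral_nonneg) (auto simp: jump_square_sum_def intro!: sum_nonneg)
  then have m2: "0 \<le> m2" using mean_children_gt_1 by (simp add: m2_def)
  \<comment> \<open>The cost \<open>C3 * m2\<close> of one generation does not scale with
    \<open>x\<close>; with this \<open>K\<close> it is paid from the gap between
    \<open>\<rho>0\<close> and \<rho>.\<close>
  define K where "K = max 1 (C3 * m2 / (\<rho> - \<rho>0))"
  have K: "1 \<le> K" "C3 * m2 \<le> (\<rho> - \<rho>0) * K"
    using \<rho>(3) by (auto simp: K_def field_simps max_def)
  have "(\<integral>\<^sup>+d. (\<Sum>i=1..children d. ennreal (exp (- \<theta> * life d) * (K + (x + c * step drift d i)\<^sup>2))) \<partial>P0)
     \<le> ennreal (\<rho> * (K + x\<^sup>2))" for x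
  proof -
    let ?f = "\<lambda>d. \<Sum>i=1..children d. exp (- \<theta> * life d) * (K + (x + c * step drift d i)\<^sup>2)"
    let ?b = "\<lambda>q. exp (- \<theta> * \<bar>fst q\<bar>) * real (fst (snd q)) * (K + (1 + \<epsilon>) * x\<^sup>2) + C3 * (real (fst (snd q)) + jump_square_sum (snd q))"
    have fm: "?f \<in> borel_measurable P0"
    proof -
      have "?f \<in> borel_measurable particle_space"
        by (rule measurable_compose_countable[where g = children and f = "\<lambda>n d. \<Sum>i=1..n. exp (- \<theta> * life d) * (K + (x + c * step drift d i)\<^sup>2)"]) measurable
      then show ?thesis by (simp add: measurable_cong_sets[OF sets_P0 refl])
    qed
    have jq: "0 \<le> jump_square_sum p" for p by (auto simp: jump_square_sum_def intro!: sum_nonneg)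
    have inner: "(\<integral>\<^sup>+z. ennreal (?f (z, q)) \<partial>PZ) \<le> ennreal (?b q)" for q
    proof -
      define L where "L = \<bar>fst q\<bar>"
      define n where "n = fst (snd q)"
      define j where "j = jump_square_sum (snd q)"
      have L: "0 \<le> L" by (simp add: L_def)
      have j: "0 \<le> j" using jq by (simp add: j_def)
      let ?h = "\<lambda>z. exp (- \<theta> * L) * (real n * (K + (1 + \<epsilon>) * x\<^sup>2) + (1 + 1 / \<epsilon>) * (2 * c\<^sup>2) * (real n * (z L - drift * L)\<^sup>2 + j))"
      let ?I = "\<integral>z. (z L - drift * L)\<^sup>2 \<partial>PZ"
      have "(\<integral>\<^sup>+z. ennreal (?f (z, q)) \<partial>PZ) \<le> (\<integral>\<^sup>+z. ennreal (?h z) \<partial>PZ)"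
      proof (intro nn_integral_mono_AE)
        show "AE z in PZ. ennreal (?f (z, q)) \<le> ennreal (?h z)"
          using eval_right[OF L]
        proof eventually_elim
          case (elim z)
          have st: "step drift (z, q) i = (z L - drift * L) + snd (snd q) i" for i
            using elim by (simp add: step_def life_def L_def jump_def)
          have "?f (z, q) = exp (- \<theta> * L) * (\<Sum>i=1..n. K + (x + c * step drift (z, q) i)\<^sup>2)"
            by (simp add: sum_distrib_left life_def L_def children_def n_def)
          also have "\<dots> \<le> exp (- \<theta> * L) * (\<Sum>i=1..n. K + ((1 + \<epsilon>) * x\<^sup>2 + (1 + 1 / \<epsilon>) * (2 * c\<^sup>2) * ((z L - drift * L)\<^sup>2 + (snd (snd q) i)\<^sup>2)))"
          proof (intro mult_left_mono sum_mono add_left_mono)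
            fix i
            let ?y = "(z L - drift * L)\<^sup>2 + (snd (snd q) i)\<^sup>2"
            have "(c * step drift (z, q) i)\<^sup>2 \<le> c\<^sup>2 * (2 * ?y)"
              unfolding st power_mult_distrib by (intro mult_left_mono add2_square_le) simp
            then have "(1 + 1 / \<epsilon>) * (c * step drift (z, q) i)\<^sup>2 \<le> (1 + 1 / \<epsilon>) * (c\<^sup>2 * (2 * ?y))"
              using \<epsilon>(1) by (intro mult_left_mono) auto
            also have "\<dots> = (1 + 1 / \<epsilon>) * (2 * c\<^sup>2) * ?y" by (simp only: mult_ac)
            finally show "(x + c * step drift (z, q) i)\<^sup>2 \<le> (1 + \<epsilon>) * x\<^sup>2 + (1 + 1 / \<epsilon>) * (2 * c\<^sup>2) * ?y"
              using add_square_eps_le[OF \<epsilon>(1), of x "c * step drift (z, q) i"] by linarith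
          qed simp
          also have "\<dots> = ?h z"
          proof -
            have "(\<Sum>i=1..n. A + (B + D * (W + f i))) = real n * (A + B) + D * (real n * W + (\<Sum>i=1..n. f i))"
              for A B D W :: real and f :: "nat \<Rightarrow> real"
              by (simp add: sum.distrib sum_distrib_left algebra_simps)
            then show ?thesis by (simp only: j_def jump_square_sum_def n_def)
          qed
          finally show ?case by (rule ennreal_leI)
        qed
      qed
      also have "\<dots> = ennreal (\<integral>z. ?h z \<partial>PZ)"
        using centred_square_integrable[OF L] \<epsilon>(1) K(1) j
        by (intro nn_integral_eq_integral AE_I2) (auto intro!: mult_nonneg_nonneg add_nonneg_nonneg)
      also have "(\<integral>z. ?h z \<partial>PZ) = exp (- \<theta> * L) * (real n * (K + (1 + \<epsilon>) * x\<^sup>2) + (1 + 1 / \<epsilon>) * (2 * c\<^sup>2) * (real n * ?I + j))"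
        using centred_square_integrable[OF L] by (simp add: PZ.prob_space)
      also have "\<dots> = exp (- \<theta> * L) * real n * (K + (1 + \<epsilon>) * x\<^sup>2) + (1 + 1 / \<epsilon>) * (2 * c\<^sup>2) * (exp (- \<theta> * L) * (real n * ?I + j))"
        by (simp add: algebra_simps)
      also have "exp (- \<theta> * L) * (real n * ?I + j) \<le> (C2 * (C1 + 1)) * (real n + j)"
      proof -
        have "real n * ?I + j \<le> real n * (C1 * (1 + L\<^sup>2)) + j * (1 + L\<^sup>2)"
          using C1(2)[OF L] j by (intro add_mono mult_left_mono) (auto simp: algebra_simps)
        also have "\<dots> \<le> (1 + L\<^sup>2) * ((C1 + 1) * (real n + j))"
        proof -
          have "real n * C1 + j \<le> (C1 + 1) * (real n + j)" using C1(1) j by (simp add: algebra_simps)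
          then have "(1 + L\<^sup>2) * (real n * C1 + j) \<le> (1 + L\<^sup>2) * ((C1 + 1) * (real n + j))" by (intro mult_left_mono) auto
          then show ?thesis by (simp add: algebra_simps)
        qed
        finally have "exp (- \<theta> * L) * (real n * ?I + j) \<le> exp (- \<theta> * L) * ((1 + L\<^sup>2) * ((C1 + 1) * (real n + j)))"
          by (intro mult_left_mono) auto
        also have "\<dots> = (exp (- \<theta> * L) * (1 + L\<^sup>2)) * ((C1 + 1) * (real n + j))" by simp
        also have "\<dots> \<le> C2 * ((C1 + 1) * (real n + j))"
          using C2(2)[OF L] C1(1) j by (intro mult_right_mono) auto
        finally show ?thesis by simp
      qed
      then have "exp (- \<theta> * L) * real n * (K + (1 + \<epsilon>) * x\<^sup>2) + (1 + 1 / \<epsilon>) * (2 * c\<^sup>2) * (exp (- \<theta> * L) * (real n * ?I + j)) \<le> ?b q"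
        using \<epsilon>(1) by (simp add: C3_def L_def n_def j_def mult_left_mono mult.assoc)
      finally show ?thesis by (simp add: ennreal_leI)
    qed
    have [measurable]: "(\<lambda>q. real (fst (snd q))) \<in> borel_measurable (PA \<Otimes>\<^sub>M PO)" "(\<lambda>q. jump_square_sum (snd q)) \<in> borel_measurable (PA \<Otimes>\<^sub>M PO)"
      by (rule measurable_compose[OF measurable_snd], simp)+
    have "(\<integral>\<^sup>+d. ennreal (?f d) \<partial>P0) = (\<integral>\<^sup>+q. (\<integral>\<^sup>+z. ennreal (?f (z, q)) \<partial>PZ) \<partial>(PA \<Otimes>\<^sub>M PO))"
      using fm by (intro P0.nn_integral_snd[symmetric]) auto
    also have "\<dots> \<le> (\<integral>\<^sup>+q. ennreal (?b q) \<partial>(PA \<Otimes>\<^sub>M PO))" by (intro nn_integral_mono inner)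
    also have "\<dots> = (\<integral>\<^sup>+a. (\<integral>\<^sup>+p. ennreal (?b (a, p)) \<partial>PO) \<partial>PA)"
      by (rule PO.nn_integral_fst[symmetric]) measurable
    also have "\<dots> = (\<integral>\<^sup>+a. ennreal (exp (- \<theta> * \<bar>a\<bar>) * (mean_children * (K + (1 + \<epsilon>) * x\<^sup>2)) + C3 * m2) \<partial>PA)"
    proof (intro nn_integral_cong)
      fix a
      have "(\<integral>\<^sup>+p. ennreal (?b (a, p)) \<partial>PO) = ennreal (\<integral>p. ?b (a, p) \<partial>PO)"
        using integrable_children jump_square_sum_integrable K(1) \<epsilon>(1) C3 jq
        by (intro nn_integral_eq_integral AE_I2) (auto intro!: add_nonneg_nonneg mult_nonneg_nonneg)
      also have "(\<integral>p. ?b (a, p) \<partial>PO) = exp (- \<theta> * \<bar>a\<bar>) * (mean_children * (K + (1 + \<epsilon>) * x\<^sup>2)) + C3 * m2"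
        using integrable_children jump_square_sum_integrable by (simp add: mean_children_def m2_def)
      finally show "(\<integral>\<^sup>+p. ennreal (?b (a, p)) \<partial>PO) = ennreal \<dots>" .
    qed
    also have "\<dots> = (\<integral>\<^sup>+a. ennreal (exp (- \<theta> * \<bar>a\<bar>)) * ennreal (mean_children * (K + (1 + \<epsilon>) * x\<^sup>2)) + ennreal (C3 * m2) \<partial>PA)"
      using mean_children_gt_1 K(1) \<epsilon>(1) C3 m2
      by (intro nn_integral_cong) (auto simp: ennreal_mult[symmetric] ennreal_plus[symmetric] simp del: ennreal_plus intro!: mult_nonneg_nonneg)
    also have "\<dots> = (\<integral>\<^sup>+a. ennreal (exp (- \<theta> * \<bar>a\<bar>)) \<partial>PA) * ennreal (mean_children * (K + (1 + \<epsilon>) * x\<^sup>2)) + ennreal (C3 * m2)"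
      by (simp add: nn_integral_add nn_integral_multc PA.emeasure_space_1[simplified])
    also have "(\<integral>\<^sup>+a. ennreal (exp (- \<theta> * \<bar>a\<bar>)) \<partial>PA) = ennreal (lam / (lam + \<theta>))"
    proof -
      have "(\<lambda>a. ennreal (exp (- \<theta> * \<bar>a\<bar>)) * indicator {-1<..} \<bar>a\<bar>) = (\<lambda>a. ennreal (exp (- \<theta> * \<bar>a\<bar>)))"
        by (auto simp: fun_eq_iff)
      then show ?thesis using nn_integral_PA[of \<theta> "-1"] \<theta> by simp
    qed
    also have "ennreal (lam / (lam + \<theta>)) * ennreal (mean_children * (K + (1 + \<epsilon>) * x\<^sup>2)) + ennreal (C3 * m2) =
        ennreal (\<rho>0 * (K + (1 + \<epsilon>) * x\<^sup>2) + C3 * m2)"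
      using mean_children_gt_1 K(1) \<epsilon>(1) C3 m2 lam_pos \<theta>(1) \<rho>0
      by (simp add: ennreal_mult[symmetric] ennreal_plus[symmetric] \<rho>0_def mult_ac del: ennreal_plus)
    also have "\<dots> \<le> ennreal (\<rho> * (K + x\<^sup>2))"
    proof (rule ennreal_leI)
      have "\<rho>0 * ((1 + \<epsilon>) * x\<^sup>2) = \<rho> * x\<^sup>2" using \<epsilon>(2) by (metis mult.assoc mult.commute)
      then have "\<rho>0 * (K + (1 + \<epsilon>) * x\<^sup>2) = \<rho>0 * K + \<rho> * x\<^sup>2" by (simp only: distrib_left)
      moreover have "\<rho> * (K + x\<^sup>2) = \<rho> * K + \<rho> * x\<^sup>2" by (simp only: distrib_left)
      moreover have "C3 * m2 \<le> \<rho> * K - \<rho>0 * K" using K(2) by (simp only: left_diff_distrib)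
      ultimately show "\<rho>0 * (K + (1 + \<epsilon>) * x\<^sup>2) + C3 * m2 \<le> \<rho> * (K + x\<^sup>2)" by linarith
    qed
    finally show ?thesis
      using K(1) by (subst sum_ennreal) auto
  qed
  then show ?thesis using K(1) \<rho> unfolding \<theta>_def by blast
qed

end

section \<open>The branching tree on the product space\<close>

definition birth :: "(nat list \<Rightarrow> particle) \<Rightarrow> nat list \<Rightarrow> real" where
  "birth w v = (\<Sum>m<length v. life (w (take m v)))"

definition born :: "(nat list \<Rightarrow> particle) \<Rightarrow> nat list \<Rightarrow> bool" where
  "born w v \<longleftrightarrow> (\<forall>m<length v. v ! m \<le> children (w (take m v)))"

text \<open>The count \<open>x + c * p\<close> of \<open>v\<close> at its birth, \<open>p\<close>
  being its centred birth position when \<open>r\<close> is the drift.\<close>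

definition score :: "real \<Rightarrow> real \<Rightarrow> real \<Rightarrow> (nat list \<Rightarrow> particle) \<Rightarrow> nat list \<Rightarrow> real" where
  "score r c x w v = x + c * (\<Sum>m<length v. step r (w (take m v)) (v ! m))"

text \<open>Bounding both length and entries makes these sets finite. They increase to all labels
  and contain every ancestor of each member, as induction from the root requires.\<close>

definition labels_upto :: "nat \<Rightarrow> nat list set" where
  "labels_upto n = {v. set v \<subseteq> {1..n} \<and> length v \<le> n}"

lemma strict_prefix_take: "m < length v \<Longrightarrow> strict_prefix (take m v) v"
  by (auto simp: strict_prefix_def take_is_prefix dest: arg_cong[where f = length])

lemma strict_prefix_iff_take: "strict_prefix u v \<longleftrightarrow> (\<exists>m<length v. u = take m v)"
proof
  assume "strict_prefix u v"
  then have "u = take (length u) v" "length u < length v"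
    by (auto simp: strict_prefix_def prefix_def)
  then show "\<exists>m<length v. u = take m v" by blast
qed (auto simp: strict_prefix_take)

lemma take_labels: "v \<in> labels \<Longrightarrow> take m v \<in> labels"
  by (auto simp: labels_def lists_eq_set dest: in_set_takeD)

lemma labels_append: "v @ [i] \<in> labels \<longleftrightarrow> v \<in> labels \<and> 1 \<le> i"
  by (auto simp: labels_def)

lemma Nil_labels [simp]: "[] \<in> labels"
  by (simp add: labels_def)

lemma labels_nth_pos: "v \<in> labels \<Longrightarrow> m < length v \<Longrightarrow> 1 \<le> v ! m"
  using nth_mem[of m v] subsetD[of "set v" "{1..}" "v ! m"] by (auto simp: labels_def lists_eq_set simp del: nth_mem)

lemma finite_labels_upto [simp]: "finite (labels_upto n)"
proof -
  have "labels_upto n = {v. set v \<subseteq> {1..n} \<and> length v \<le> n}" by (simp add: labels_upto_def)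
  then show ?thesis using finite_lists_length_le[of "{1..n}" n] by simp
qed

lemma labels_upto_subset: "labels_upto n \<subseteq> labels"
  by (auto simp: labels_upto_def labels_def lists_eq_set)

lemma labels_uptoD: "v \<in> labels_upto n \<Longrightarrow> v \<in> labels"
  using labels_upto_subset by blast

lemma Nil_labels_upto [simp]: "[] \<in> labels_upto n"
  by (simp add: labels_upto_def)

lemma labels_upto_butlast: "v @ [i] \<in> labels_upto n \<Longrightarrow> v \<in> labels_upto n \<and> i \<in> {1..n}"
  by (auto simp: labels_upto_def)

lemma labels_upto_mono: "m \<le> n \<Longrightarrow> labels_upto m \<subseteq> labels_upto n"
  by (fastforce simp: labels_upto_def)

lemma labels_upto_cover: "v \<in> labels \<Longrightarrow> \<exists>n. v \<in> labels_upto n"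
proof -
  assume v: "v \<in> labels"
  have "i \<le> sum_list v" if "i \<in> set v" for i using that member_le_sum_list by blast
  then have "v \<in> labels_upto (length v + sum_list v)"
    using v by (fastforce simp: labels_upto_def labels_def lists_eq_set)
  then show ?thesis by blast
qed

lemma finite_subset_labels_upto: "finite P \<Longrightarrow> P \<subseteq> labels \<Longrightarrow> \<exists>n. P \<subseteq> labels_upto n"
proof (induction P rule: finite_induct)
  case (insert v P)
  then have "\<exists>m. P \<subseteq> labels_upto m" "\<exists>n. v \<in> labels_upto n" using labels_upto_cover by auto
  then obtain m n where "P \<subseteq> labels_upto m" "v \<in> labels_upto n" by blast
  then have "insert v P \<subseteq> labels_upto (max m n)"
    using labels_upto_mono[of m "max m n"] labels_upto_mono[of n "max m n"] by auto
  then show ?case by blast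
qed simp

lemma birth_Nil [simp]: "birth w [] = 0" and born_Nil [simp]: "born w []" and score_Nil [simp]: "score r c x w [] = x"
  by (simp_all add: birth_def born_def score_def)

lemma birth_append [simp]: "birth w (v @ [i]) = birth w v + life (w v)"
  by (simp add: birth_def)

lemma born_append [simp]: "born w (v @ [i]) \<longleftrightarrow> born w v \<and> i \<le> children (w v)"
  by (auto simp: born_def nth_append less_Suc_eq)

lemma score_append [simp]: "score r c x w (v @ [i]) = score r c x w v + c * step r (w v) i"
  by (simp add: score_def nth_append algebra_simps)

text \<open>Birth time, existence and birth position of \<open>v\<close> are determined by its
  strict ancestors, so resampling the coordinate of \<open>u\<close> leaves them unchanged unless
  \<open>u\<close> is one of these.\<close>

lemma
  assumes "\<not> strict_prefix u v"
  shows birth_upd: "birth (w(u := d)) v = birth w v"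
    and born_upd: "born (w(u := d)) v = born w v"
    and score_upd: "score r c x (w(u := d)) v = score r c x w v"
proof -
  have "take m v \<noteq> u" if "m < length v" for m
    using strict_prefix_take[OF that] assms by auto
  then show "birth (w(u := d)) v = birth w v" "born (w(u := d)) v = born w v" "score r c x (w(u := d)) v = score r c x w v"
    by (simp_all add: birth_def born_def score_def)
qed

lemma birth_strict_prefix: "strict_prefix u v \<Longrightarrow> birth w u + life (w u) \<le> birth w v"
proof -
  assume "strict_prefix u v"
  then obtain k where k: "k < length v" "u = take k v" by (auto simp: strict_prefix_iff_take)
  then have "birth w u + life (w u) = (\<Sum>m<Suc k. life (w (take m v)))"
    by (simp add: birth_def min_def)
  also have "\<dots> \<le> birth w v"
    unfolding birth_def using k(1) by (intro sum_mono2) auto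
  finally show ?thesis .
qed

lemma born_strict_prefix:
  "strict_prefix u v \<Longrightarrow> born w v \<Longrightarrow> v ! length u \<le> children (w u)"
  by (auto simp: strict_prefix_iff_take born_def)

text \<open>
  A representative of all particles still alive at age \<open>s\<close> with the same motion up to that age.
\<close>

definition stop_particle :: "real \<Rightarrow> particle \<Rightarrow> particle" where
  "stop_particle s d = (stopped s (fst d), max 0 s + 1, 0, \<lambda>_. 0)"

text \<open>Summing the one-step bound over all labels gives
  \<open>S \<le> G + \<rho> * (S + H)\<close>, and \<open>S\<close> is absorbed on the left. It
  serves the Lyapunov function, with \<open>h = 0\<close>, and later the weights of particles born
  after a given time, with those alive at that time as source \<open>h\<close>.\<close>

lemma sum_labels_upto_le:
  fixes g h :: "nat list \<Rightarrow> ennreal"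
  assumes step: "\<And>v. v \<in> labels_upto n \<Longrightarrow> (\<Sum>i=1..n. g (v @ [i])) \<le> ennreal \<rho> * (g v + h v)"
    and \<rho>: "0 \<le> \<rho>" "\<rho> < 1"
    and fin: "g [] < \<infinity>" "\<And>v. v \<in> labels_upto n \<Longrightarrow> h v < \<infinity>"
  shows "(\<Sum>v\<in>labels_upto n. g v) \<le> ennreal (1 / (1 - \<rho>)) * (g [] + (\<Sum>v\<in>labels_upto n. h v))"
proof -
  let ?F = "labels_upto n"
  \<comment> \<open>Finiteness of each term, descending from the root, is what permits the
    absorption.\<close>
  have "g v < \<infinity>" if "v \<in> ?F" for v
    using that
  proof (induction v rule: rev_induct)
    case Nil then show ?case using fin(1) by simp
  next
    case (snoc i v)
    then have v: "v \<in> ?F" "i \<in> {1..n}" using labels_upto_butlast by auto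
    have "g (v @ [i]) \<le> (\<Sum>i=1..n. g (v @ [i]))" by (rule member_le_sum[OF v(2)]) auto
    also have "\<dots> \<le> ennreal \<rho> * (g v + h v)" by (rule step[OF v(1)])
    also have "\<dots> < \<infinity>" using snoc.IH[OF v(1)] fin(2)[OF v(1)] by (simp add: ennreal_mult_less_top)
    finally show ?case .
  qed
  then have finS: "(\<Sum>v\<in>?F. g v) < \<infinity>" by simp
  have "(\<Sum>v\<in>?F - {[]}. g v) \<le> (\<Sum>(v, i)\<in>?F \<times> {1..n}. g (v @ [i]))"
  proof -
    have "(\<Sum>v\<in>?F - {[]}. g v) = (\<Sum>(v, i)\<in>(\<lambda>v. (butlast v, last v)) ` (?F - {[]}). g (v @ [i]))"
    proof (subst sum.reindex)
      show "inj_on (\<lambda>v. (butlast v, last v)) (?F - {[]})"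
        by (intro inj_onI) (metis DiffE Pair_inject append_butlast_last_id insertCI)
    qed (auto intro: sum.cong)
    also have "\<dots> \<le> (\<Sum>(v, i)\<in>?F \<times> {1..n}. g (v @ [i]))"
    proof (rule sum_mono2)
      show "(\<lambda>v. (butlast v, last v)) ` (?F - {[]}) \<subseteq> ?F \<times> {1..n}"
      proof safe
        fix v assume v: "v \<in> ?F" "v \<noteq> []"
        then have "butlast v @ [last v] \<in> ?F" by simp
        then show "butlast v \<in> ?F" "last v \<in> {1..n}" using labels_upto_butlast by blast+
      qed
    qed auto
    finally show ?thesis .
  qed
  also have "\<dots> = (\<Sum>v\<in>?F. \<Sum>i=1..n. g (v @ [i]))" by (simp add: sum.cartesian_product)
  also have "\<dots> \<le> (\<Sum>v\<in>?F. ennreal \<rho> * (g v + h v))" by (intro sum_mono step)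
  also have "\<dots> = ennreal \<rho> * ((\<Sum>v\<in>?F. g v) + (\<Sum>v\<in>?F. h v))"
    by (simp add: sum.distrib distrib_left sum_distrib_left)
  finally have le: "(\<Sum>v\<in>?F. g v) \<le> g [] + ennreal \<rho> * ((\<Sum>v\<in>?F. g v) + (\<Sum>v\<in>?F. h v))"
    by (subst sum.remove[of _ "[]"]) (auto intro: add_left_mono)
  have finH: "(\<Sum>v\<in>?F. h v) < \<infinity>" using fin(2) by simp
  obtain S where S: "0 \<le> S" "(\<Sum>v\<in>?F. g v) = ennreal S" using finS by (cases "\<Sum>v\<in>?F. g v") auto
  obtain H where H: "0 \<le> H" "(\<Sum>v\<in>?F. h v) = ennreal H" using finH by (cases "\<Sum>v\<in>?F. h v") auto
  obtain G where G: "0 \<le> G" "g [] = ennreal G" using fin(1) by (cases "g []") auto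
  have "ennreal S \<le> ennreal (G + \<rho> * (S + H))"
    using le S H G \<rho> by (simp add: ennreal_plus[symmetric] ennreal_mult[symmetric] del: ennreal_plus)
  then have "S \<le> G + \<rho> * (S + H)" using S(1) H(1) G(1) \<rho> by (subst (asm) ennreal_le_iff) auto
  then have "S * (1 - \<rho>) \<le> G + \<rho> * H" by (simp add: algebra_simps)
  also have "\<dots> \<le> G + H" using \<rho> H(1) by (simp add: mult_left_le_one_le)
  finally have "S \<le> 1 / (1 - \<rho>) * (G + H)" using \<rho> by (simp add: field_simps)
  then show ?thesis
    using S(2) H(2) G(2) H(1) G(1) \<rho> by (simp add: ennreal_plus[symmetric] ennreal_mult[symmetric] ennreal_leI del: ennreal_plus)
qed

section \<open>Martingale terms and adaptedness on the product space\<close>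

context particle_law
begin

abbreviation Q :: "(nat list \<Rightarrow> particle) measure" where "Q \<equiv> PiM labels (\<lambda>_. P0)"

sublocale Q: product_prob_space "\<lambda>_. P0" labels
  by unfold_locales

lemma component_measurable: "v \<in> labels \<Longrightarrow> (\<lambda>w. w v) \<in> Q \<rightarrow>\<^sub>M P0"
  by (rule measurable_component_singleton)

lemma component_measurable_space: "v \<in> labels \<Longrightarrow> (\<lambda>w. w v) \<in> Q \<rightarrow>\<^sub>M particle_space"
  using component_measurable by (simp add: measurable_cong_sets[OF refl sets_P0])

lemma birth_measurable:
  assumes v: "v \<in> labels" shows "(\<lambda>w. birth w v) \<in> borel_measurable Q"
  unfolding birth_def
proof (rule borel_measurable_sum)
  fix m
  show "(\<lambda>w. life (w (take m v))) \<in> borel_measurable Q"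
    by (rule measurable_compose[OF component_measurable_space[OF take_labels[OF v]] life_measurable])
qed

lemma born_measurable:
  assumes v: "v \<in> labels" shows "Measurable.pred Q (\<lambda>w. born w v)"
proof -
  have "Measurable.pred Q (\<lambda>w. v ! m \<le> children (w (take m v)))" for m
  proof (rule measurable_compose[where g = "\<lambda>n. v ! m \<le> n"])
    show "(\<lambda>w. children (w (take m v))) \<in> Q \<rightarrow>\<^sub>M count_space UNIV"
      by (rule measurable_compose[OF component_measurable_space[OF take_labels[OF v]] children_measurable])
  qed simp
  then have "Measurable.pred Q (\<lambda>w. \<forall>m\<in>{..<length v}. v ! m \<le> children (w (take m v)))"
    by (intro pred_intros_finite) auto
  moreover have "(\<lambda>w. born w v) = (\<lambda>w. \<forall>m\<in>{..<length v}. v ! m \<le> children (w (take m v)))"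
    by (auto simp: born_def fun_eq_iff)
  ultimately show ?thesis by (simp only:)
qed

lemma score_measurable:
  assumes v: "v \<in> labels" shows "(\<lambda>w. score r c x w v) \<in> borel_measurable Q"
proof -
  have "(\<lambda>w. step r (w (take m v)) (v ! m)) \<in> borel_measurable Q" for m
    by (rule measurable_compose[OF component_measurable_space[OF take_labels[OF v]] step_measurable])
  then have "(\<lambda>w. \<Sum>m<length v. step r (w (take m v)) (v ! m)) \<in> borel_measurable Q"
    by (rule borel_measurable_sum)
  then show ?thesis unfolding score_def
    by (intro borel_measurable_add borel_measurable_times) simp_all
qed

text \<open>The term of \<open>v\<close> in the martingale at time \<open>t\<close>: the innovation
  at its current age, discounted from birth. It vanishes before birth and is constant after
  death.\<close>

definition incr :: "real \<Rightarrow> real \<Rightarrow> real \<Rightarrow> nat list \<Rightarrow> (nat list \<Rightarrow> particle) \<Rightarrow> real" where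
  "incr c x t v w = (if born w v then exp (- alpha * birth w v) * innov c (t - birth w v) (score drift c x w v) (w v) else 0)"

definition Phi :: "real \<Rightarrow> real \<Rightarrow> nat list set \<Rightarrow> real \<Rightarrow> (nat list \<Rightarrow> particle) \<Rightarrow> real" where
  "Phi c x F t w = x + (\<Sum>v\<in>F. incr c x t v w)"

lemma incr_measurable:
  assumes v: "v \<in> labels"
  shows "incr c x t v \<in> borel_measurable Q"
proof -
  note [measurable] = birth_measurable[OF v] born_measurable[OF v]
  have [measurable]: "(\<lambda>w. innov c (t - birth w v) (score drift c x w v) (w v)) \<in> borel_measurable Q"
    by (rule innov_measurable_raw[where d = "\<lambda>w. w v"])
       (use score_measurable[OF v] component_measurable_space[OF v] in auto)
  show ?thesis unfolding incr_def[abs_def] by measurable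
qed

lemma Phi_measurable: "F \<subseteq> labels \<Longrightarrow> Phi c x F t \<in> borel_measurable Q"
  unfolding Phi_def[abs_def] by (intro borel_measurable_add borel_measurable_const borel_measurable_sum incr_measurable) auto

lemma upd_measurable: "u \<in> labels \<Longrightarrow> w \<in> space Q \<Longrightarrow> (\<lambda>d. w(u := d)) \<in> P0 \<rightarrow>\<^sub>M Q"
  using measurable_compose[OF measurable_Pair2' Q.measurable_fun_upd_PiM, of w u]
  by (simp add: measurable_Pair2')

lemma incr_upd_other:
  "u \<noteq> v \<Longrightarrow> \<not> strict_prefix u v \<Longrightarrow> incr c x t v (w(u := d)) = incr c x t v w"
  by (simp add: incr_def birth_upd born_upd score_upd)

lemma incr_upd_self:
  "incr c x t v (w(v := d)) = (if born w v then exp (- alpha * birth w v) * innov c (t - birth w v) (score drift c x w v) d else 0)"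
  by (simp add: incr_def birth_upd born_upd score_upd)

text \<open>Replaces measurability with respect to the history up to \<open>t\<close>: a particle
  that has not died by \<open>t\<close> may be exchanged for a childless representative with the
  same motion up to its current age. The null set may depend on \<open>w\<close> and
  \<open>u\<close>; it is there because a stopped path, evaluated at its last time, agrees with the
  original only almost surely.\<close>

definition adapted :: "real \<Rightarrow> ((nat list \<Rightarrow> particle) \<Rightarrow> real) \<Rightarrow> bool" where
  "adapted t H \<longleftrightarrow> (\<forall>w\<in>space Q. \<forall>u\<in>labels. AE d in P0. t < birth w u + life d \<longrightarrow>
     H (w(u := d)) = H (w(u := stop_particle (t - birth w u) d)))"

text \<open>Countably many null sets are joined; outside them all \<open>H i\<close> keep their
  values, and so does every function of the sequence.\<close>

lemma adapted_compose:
  assumes "\<And>i::nat. adapted t (H i)"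
  shows "adapted t (\<lambda>w. f (\<lambda>i. H i w))"
  unfolding adapted_def
proof (intro ballI)
  fix w u assume "w \<in> space Q" "u \<in> labels"
  then have "AE d in P0. \<forall>i. t < birth w u + life d \<longrightarrow> H i (w(u := d)) = H i (w(u := stop_particle (t - birth w u) d))"
    unfolding AE_all_countable using assms unfolding adapted_def by blast
  then show "AE d in P0. t < birth w u + life d \<longrightarrow>
     f (\<lambda>i. H i (w(u := d))) = f (\<lambda>i. H i (w(u := stop_particle (t - birth w u) d)))"
    by eventually_elim simp
qed

lemma adapted_compose1: "adapted t H \<Longrightarrow> adapted t (\<lambda>w. f (H w))"
  using adapted_compose[of t "\<lambda>_. H" "\<lambda>h. f (h 0)"] by simp

lemma adapted_sum:
  assumes "finite F" "\<And>v. v \<in> F \<Longrightarrow> adapted t (H v)"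
  shows "adapted t (\<lambda>w. \<Sum>v\<in>F. H v w)"
  using assms
proof (induction F rule: finite_induct)
  case empty then show ?case by (simp add: adapted_def)
next
  case (insert v F)
  let ?H = "\<lambda>i::nat. if i = 0 then H v else (\<lambda>w. \<Sum>v\<in>F. H v w)"
  have "adapted t (?H i)" for i using insert by auto
  from adapted_compose[of t ?H "\<lambda>h. h 0 + h 1", OF this]
  have "adapted t (\<lambda>w. H v w + (\<Sum>v\<in>F. H v w))" by simp
  then show ?case using insert.hyps by (simp only: sum.insert not_False_eq_True)
qed

text \<open>There are three positions of \<open>u\<close>. For \<open>u = v\<close> only the motion
  up to the age at \<open>r\<close> matters, and an unrelated \<open>u\<close> does not enter. A
  strict ancestor dying after \<open>t\<close> leaves \<open>v\<close> not yet born at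
  \<open>r\<close>, while its childless representative leaves \<open>v\<close> nonexistent, so both
  values are zero.\<close>

lemma adapted_incr:
  assumes v: "v \<in> labels" and r: "r \<le> t"
  shows "adapted t (incr c x r v)"
  unfolding adapted_def
proof (intro ballI)
  fix w u assume w: "w \<in> space Q" and u: "u \<in> labels"
  define s where "s = t - birth w u"
  have "AE d in P0. 0 \<le> s \<longrightarrow> eval_right (fst d) s = fst d s"
  proof (cases "0 \<le> s")
    case True
    from PAO.AE_fstI[OF eval_right[OF True]] show ?thesis by (rule eventually_mono) simp
  qed simp
  then show "AE d in P0. t < birth w u + life d \<longrightarrow> incr c x r v (w(u := d)) = incr c x r v (w(u := stop_particle (t - birth w u) d))"
  proof eventually_elim
    case (elim d)
    show ?case
    proof (intro impI)
      assume less: "t < birth w u + life d"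
      consider "u = v" | "u \<noteq> v" "\<not> strict_prefix u v" | "strict_prefix u v" by blast
      then show "incr c x r v (w(u := d)) = incr c x r v (w(u := stop_particle (t - birth w u) d))"
      proof cases
        case 1
        let ?a = "r - birth w u"
        have "innov c ?a y d = innov c ?a y (stop_particle s d)" for y
        proof (cases "?a < 0")
          case False
          then have "0 \<le> ?a" "?a \<le> s" using r by (auto simp: s_def)
          then have "eval_right (stopped s (fst d)) ?a = eval_right (fst d) ?a"
            using elim by (intro eval_right_stopped) auto
          moreover have "?a < life d" "?a < life (stop_particle s d)"
            using less r \<open>?a \<le> s\<close> by (auto simp: s_def stop_particle_def life_def)
          ultimately show ?thesis by (simp add: innov_def contrib_def weight_def stop_particle_def)
        qed (simp add: innov_def)
        then show ?thesis using 1 by (simp add: incr_upd_self s_def)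
      next
        case 2
        then show ?thesis by (simp add: incr_upd_other)
      next
        case 3
        have "birth w u + life d \<le> birth (w(u := d)) v"
          using birth_strict_prefix[OF 3, of "w(u := d)"] by (simp add: birth_upd)
        then have "incr c x r v (w(u := d)) = 0" using less r by (simp add: incr_def innov_def)
        moreover have "\<not> born (w(u := stop_particle s d)) v"
        proof
          assume "born (w(u := stop_particle s d)) v"
          \<comment> \<open>The representative has no children, while the entries of a label are at
            least 1.\<close>
          from born_strict_prefix[OF 3 this] have "v ! length u = 0" by (simp add: stop_particle_def children_def)
          moreover have "length u < length v" using 3 by (auto simp: strict_prefix_iff_take)
          ultimately show False using labels_nth_pos[OF v] by fastforce
        qed
        ultimately show ?thesis by (simp add: incr_def s_def)
      qed
    qed
  qed
qed

lemma adapted_Phi: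
  assumes "finite F" "F \<subseteq> labels" "r \<le> t"
  shows "adapted t (Phi c x F r)"
proof -
  have "adapted t (\<lambda>w. x + (\<Sum>v\<in>F. incr c x r v w))"
    by (rule adapted_compose1[where f = "\<lambda>y. x + y"], rule adapted_sum[OF assms(1)])
       (use assms adapted_incr in auto)
  then show ?thesis by (simp add: Phi_def[abs_def])
qed

text \<open>The coordinate of \<open>u\<close> is integrated with all others fixed. \<open>W\<close>
  does not depend on it, and adaptedness turns \<open>H\<close> into a function \<open>g\<close> of
  the stopped motion of \<open>u\<close> wherever the increment is nonzero, so
  \<open>innov_increment_orthogonal\<close> applies.\<close>

lemma incr_increment_orthogonal:
  assumes u: "u \<in> labels" and st: "s \<le> t"
    and H: "adapted s H" "H \<in> borel_measurable Q" "\<And>w. \<bar>H w\<bar> \<le> B"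
    and W: "\<And>w d. W (w(u := d)) = W w"
    and int: "integrable Q (\<lambda>w. (incr c x t u w - incr c x s u w) * W w * H w)"
  shows "(\<integral>w. (incr c x t u w - incr c x s u w) * W w * H w \<partial>Q) = 0"
proof -
  have "(\<integral>d. (incr c x t u (w(u := d)) - incr c x s u (w(u := d))) * W (w(u := d)) * H (w(u := d)) \<partial>P0) = 0"
    if w: "w \<in> space Q" for w
  proof (cases "born w u")
    case False then show ?thesis by (simp add: incr_upd_self)
  next
    case True
    define a where "a = s - birth w u"
    define b where "b = t - birth w u"
    define y where "y = score drift c x w u"
    define g where "g z = H (w(u := (z, max 0 a + 1, 0, \<lambda>_. 0)))" for z
    have ab: "a \<le> b" using st by (simp add: a_def b_def)
    have gm: "g \<in> borel_measurable path_space"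
    proof -
      have "(\<lambda>z. (z, max 0 a + 1, 0, \<lambda>_. 0)) \<in> path_space \<rightarrow>\<^sub>M particle_space"
        by (intro measurable_Pair measurable_ident measurable_const) (auto simp: space_pair_measure space_PiM)
      then have "(\<lambda>z. (z, max 0 a + 1, 0, \<lambda>_. 0)) \<in> path_space \<rightarrow>\<^sub>M P0"
        by (simp add: measurable_cong_sets[OF refl sets_P0])
      from measurable_compose[OF measurable_compose[OF this upd_measurable[OF u w]] H(2)]
      show ?thesis unfolding g_def .
    qed
    have im: "(\<lambda>d. innov c r y d) \<in> borel_measurable P0" for r
      by (rule innov_measurable_raw) (auto simp: measurable_cong_sets[OF sets_P0 refl])
    have Hm: "(\<lambda>d. H (w(u := d))) \<in> borel_measurable P0"
      by (rule measurable_compose[OF upd_measurable[OF u w] H(2)])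
    have gm': "(\<lambda>d. g (stopped a (fst d))) \<in> borel_measurable P0"
      using measurable_compose[OF measurable_fst measurable_compose[OF stopped_measurable gm]]
      by (simp add: measurable_cong_sets[OF sets_P0 refl])
    have D: "incr c x t u (w(u := d)) - incr c x s u (w(u := d)) = exp (- alpha * birth w u) * (innov c b y d - innov c a y d)" for d
      unfolding incr_upd_self a_def b_def y_def if_P[OF True] by (rule right_diff_distrib[symmetric])
    have "AE d in P0. s < birth w u + life d \<longrightarrow> H (w(u := d)) = H (w(u := stop_particle (s - birth w u) d))"
      using H(1) w u by (auto simp: adapted_def)
    then have "AE d in P0. (incr c x t u (w(u := d)) - incr c x s u (w(u := d))) * W (w(u := d)) * H (w(u := d)) =
        exp (- alpha * birth w u) * W w * ((innov c b y d - innov c a y d) * g (stopped a (fst d)))"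
    proof eventually_elim
      case (elim d)
      show ?case
      proof (cases "s < birth w u + life d")
        case True
        with elim have "H (w(u := d)) = H (w(u := stop_particle (s - birth w u) d))" by blast
        also have "\<dots> = g (stopped a (fst d))" unfolding g_def stop_particle_def a_def ..
        finally have "H (w(u := d)) = g (stopped a (fst d))" .
        then show ?thesis unfolding D W by (simp only: mult_ac)
      next
        case False
        \<comment> \<open>If \<open>u\<close> is dead at \<open>s\<close>, adaptedness gives no
          information about \<open>H\<close>, but the increment vanishes.\<close>
        then have "life d \<le> a" by (simp add: a_def)
        moreover from this have "0 \<le> a" using life_nonneg[of d] by linarith
        ultimately have "innov c b y d = innov c a y d"
          using ab by (simp add: innov_def contrib_def)
        then show ?thesis unfolding D by simp
      qed
    qed
    then have "(\<integral>d. (incr c x t u (w(u := d)) - incr c x s u (w(u := d))) * W (w(u := d)) * H (w(u := d)) \<partial>P0) =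
        (\<integral>d. exp (- alpha * birth w u) * W w * ((innov c b y d - innov c a y d) * g (stopped a (fst d))) \<partial>P0)"
    proof (rule integral_cong_AE[rotated 2])
      show "(\<lambda>d. (incr c x t u (w(u := d)) - incr c x s u (w(u := d))) * W (w(u := d)) * H (w(u := d))) \<in> borel_measurable P0"
        unfolding D W by (intro borel_measurable_times borel_measurable_diff borel_measurable_const im Hm)
      show "(\<lambda>d. exp (- alpha * birth w u) * W w * ((innov c b y d - innov c a y d) * g (stopped a (fst d)))) \<in> borel_measurable P0"
        by (intro borel_measurable_times borel_measurable_diff borel_measurable_const im gm')
    qed
    also have "\<dots> = exp (- alpha * birth w u) * W w * (\<integral>d. (innov c b y d - innov c a y d) * g (stopped a (fst d)) \<partial>P0)"
      by simp
    also have "(\<integral>d. (innov c b y d - innov c a y d) * g (stopped a (fst d)) \<partial>P0) = 0"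
    proof (cases "0 \<le> b")
      case True
      show ?thesis by (rule innov_increment_orthogonal[OF ab True gm, of B]) (simp add: g_def H(3))
    next
      case False
      then show ?thesis using ab by (simp add: innov_def)
    qed
    finally show ?thesis by (simp only: mult_zero_right)
  qed
  then have "(\<integral>w. (\<integral>d. (incr c x t u (w(u := d)) - incr c x s u (w(u := d))) * W (w(u := d)) * H (w(u := d)) \<partial>P0) \<partial>Q) = (\<integral>w. 0 \<partial>Q)"
    by (intro Bochner_Integration.integral_cong) auto
  then show ?thesis
    using Q.integral_resample[OF u int] by simp
qed

end

section \<open>Second moments in the tree and orthogonality of distinct terms\<close>

context particle_law
begin

declare sets_P0 [measurable_cong del]

definition dinc :: "real \<Rightarrow> real \<Rightarrow> real \<Rightarrow> real \<Rightarrow> nat list \<Rightarrow> (nat list \<Rightarrow> particle) \<Rightarrow> real" where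
  "dinc c x s t u w = incr c x t u w - incr c x s u w"

definition lyapunov :: "real \<Rightarrow> real \<Rightarrow> real \<Rightarrow> nat list \<Rightarrow> (nat list \<Rightarrow> particle) \<Rightarrow> real" where
  "lyapunov K c x u w = (if born w u then exp (- (3 * alpha / 2) * birth w u) * (K + (score drift c x w u)\<^sup>2) else 0)"

lemma dinc_measurable: "u \<in> labels \<Longrightarrow> dinc c x s t u \<in> borel_measurable Q"
  unfolding dinc_def[abs_def] by (intro borel_measurable_diff incr_measurable)

lemma lyapunov_measurable:
  assumes u: "u \<in> labels" shows "lyapunov K c x u \<in> borel_measurable Q"
proof -
  note [measurable] = birth_measurable[OF u] born_measurable[OF u] score_measurable[OF u]
  show ?thesis unfolding lyapunov_def[abs_def] by measurable
qed

lemma dinc_upd_self: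
  "dinc c x s t u (w(u := d)) = (if born w u then exp (- alpha * birth w u) *
     (innov c (t - birth w u) (score drift c x w u) d - innov c (s - birth w u) (score drift c x w u) d) else 0)"
  by (simp add: dinc_def incr_upd_self right_diff_distrib)

lemma dinc_upd_other: "u \<noteq> v \<Longrightarrow> \<not> strict_prefix u v \<Longrightarrow> dinc c x s t v (w(u := d)) = dinc c x s t v w"
  by (simp add: dinc_def incr_upd_other)

text \<open>Discount bookkeeping for birth time \<open>b\<close>: the rate \<open>2 * alpha\<close>
  up to \<open>b\<close> and the decay at rate \<open>alpha / 2\<close> over \<open>s - b\<close>
  combine into decay at rate \<open>alpha / 2\<close> over \<open>s\<close> and a discount at rate
  \<open>3 * alpha / 2\<close> over \<open>b\<close>.\<close>

lemma nn_integral_dinc_square: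
  "\<exists>C\<ge>0. \<forall>x s t u. u \<in> labels \<longrightarrow> s \<le> t \<longrightarrow> 0 \<le> t \<longrightarrow>
     (\<integral>\<^sup>+w. ennreal ((dinc c x s t u w)\<^sup>2) \<partial>Q) \<le> ennreal (C * exp (- (alpha / 2) * s)) * (\<integral>\<^sup>+w. ennreal (lyapunov 1 c x u w) \<partial>Q)"
proof -
  obtain C where C: "C \<ge> 0" "\<And>x s t. s \<le> t \<Longrightarrow> 0 \<le> t \<Longrightarrow>
     (\<integral>\<^sup>+d. ennreal ((innov c t x d - innov c s x d)\<^sup>2) \<partial>P0) \<le> ennreal (C * (1 + x\<^sup>2) * exp (- (alpha / 2) * s))"
    using nn_integral_innov_square by blast
  have "(\<integral>\<^sup>+w. ennreal ((dinc c x s t u w)\<^sup>2) \<partial>Q) \<le> ennreal (C * exp (- (alpha / 2) * s)) * (\<integral>\<^sup>+w. ennreal (lyapunov 1 c x u w) \<partial>Q)"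
    if u: "u \<in> labels" and st: "s \<le> t" "0 \<le> t" for x s t u
  proof -
    have "(\<integral>\<^sup>+w. ennreal ((dinc c x s t u w)\<^sup>2) \<partial>Q) = (\<integral>\<^sup>+w. (\<integral>\<^sup>+d. ennreal ((dinc c x s t u (w(u := d)))\<^sup>2) \<partial>P0) \<partial>Q)"
      by (rule Q.nn_integral_resample[OF u measurable_compose[OF borel_measurable_power[OF dinc_measurable[OF u]] measurable_ennreal]])
    also have "\<dots> \<le> (\<integral>\<^sup>+w. ennreal (C * exp (- (alpha / 2) * s)) * ennreal (lyapunov 1 c x u w) \<partial>Q)"
    proof (rule nn_integral_mono)
      fix w
      show "(\<integral>\<^sup>+d. ennreal ((dinc c x s t u (w(u := d)))\<^sup>2) \<partial>P0) \<le> ennreal (C * exp (- (alpha / 2) * s)) * ennreal (lyapunov 1 c x u w)"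
      proof (cases "born w u")
        case False then show ?thesis by (simp add: dinc_upd_self)
      next
        case True
        define b where "b = birth w u"
        define y where "y = score drift c x w u"
        have im: "(\<lambda>d. innov c r y d) \<in> borel_measurable P0" for r
          by (rule innov_measurable_raw) (auto simp: measurable_cong_sets[OF sets_P0 refl])
        have "(\<integral>\<^sup>+d. ennreal ((dinc c x s t u (w(u := d)))\<^sup>2) \<partial>P0) =
            (\<integral>\<^sup>+d. ennreal ((exp (- alpha * b))\<^sup>2) * ennreal ((innov c (t - b) y d - innov c (s - b) y d)\<^sup>2) \<partial>P0)"
          using True by (intro nn_integral_cong) (simp add: dinc_upd_self b_def y_def power_mult_distrib ennreal_mult)
        also have "\<dots> = ennreal ((exp (- alpha * b))\<^sup>2) * (\<integral>\<^sup>+d. ennreal ((innov c (t - b) y d - innov c (s - b) y d)\<^sup>2) \<partial>P0)"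
          by (rule nn_integral_cmult) (intro measurable_compose[OF _ measurable_ennreal] borel_measurable_power borel_measurable_diff im)
        also have "\<dots> \<le> ennreal ((exp (- alpha * b))\<^sup>2) * ennreal (C * (1 + y\<^sup>2) * exp (- (alpha / 2) * (s - b)))"
        proof (intro mult_left_mono)
          show "(\<integral>\<^sup>+d. ennreal ((innov c (t - b) y d - innov c (s - b) y d)\<^sup>2) \<partial>P0) \<le> ennreal (C * (1 + y\<^sup>2) * exp (- (alpha / 2) * (s - b)))"
          proof (cases "0 \<le> t - b")
            case True then show ?thesis using st by (intro C(2)) auto
          next
            case False then show ?thesis using st by (simp add: innov_def)
          qed
        qed simp
        also have "\<dots> = ennreal ((exp (- alpha * b))\<^sup>2 * (C * (1 + y\<^sup>2) * exp (- (alpha / 2) * (s - b))))"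
          by (rule ennreal_mult''[symmetric]) (use C(1) in simp)
        also have "(exp (- alpha * b))\<^sup>2 * (C * (1 + y\<^sup>2) * exp (- (alpha / 2) * (s - b))) =
            (C * exp (- (alpha / 2) * s)) * (exp (- (3 * alpha / 2) * b) * (1 + y\<^sup>2))"
        proof -
          have e: "(exp (- alpha * b))\<^sup>2 * exp (- (alpha / 2) * (s - b)) = exp (- (alpha / 2) * s) * exp (- (3 * alpha / 2) * b)"
            unfolding power2_eq_square exp_add[symmetric] by (rule arg_cong[where f = exp]) (simp add: field_simps)
          have "(exp (- alpha * b))\<^sup>2 * (C * (1 + y\<^sup>2) * exp (- (alpha / 2) * (s - b))) =
              C * (1 + y\<^sup>2) * ((exp (- alpha * b))\<^sup>2 * exp (- (alpha / 2) * (s - b)))"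
            by (simp only: mult_ac)
          then show ?thesis unfolding e by (simp only: mult_ac)
        qed
        also have "ennreal \<dots> = ennreal (C * exp (- (alpha / 2) * s)) * ennreal (lyapunov 1 c x u w)"
          using True C(1) by (simp add: lyapunov_def b_def y_def ennreal_mult)
        finally show ?thesis .
      qed
    qed
    also have "\<dots> = ennreal (C * exp (- (alpha / 2) * s)) * (\<integral>\<^sup>+w. ennreal (lyapunov 1 c x u w) \<partial>Q)"
      by (rule nn_integral_cmult[OF measurable_compose[OF lyapunov_measurable[OF u] measurable_ennreal]])
    finally show ?thesis .
  qed
  then show ?thesis using C(1) by blast
qed

text \<open>Resampling the coordinate of a parent turns \<open>offspring_lyapunov\<close> into a
  contraction of expectations along the tree, uniformly in the truncation. As \<open>K\<close> is at
  least 1, the function with constant 1 is dominated by the one with \<open>K\<close>.\<close>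

lemma sum_lyapunov_bounded:
  "\<exists>C\<ge>0. \<forall>n. (\<Sum>u\<in>labels_upto n. \<integral>\<^sup>+w. ennreal (lyapunov 1 c x u w) \<partial>Q) \<le> ennreal C"
proof -
  obtain K \<rho> where K: "1 \<le> K" and \<rho>: "0 \<le> \<rho>" "\<rho> < 1"
    and L: "\<And>x. (\<integral>\<^sup>+d. (\<Sum>i=1..children d. ennreal (exp (- (3 * alpha / 2) * life d) * (K + (x + c * step drift d i)\<^sup>2))) \<partial>P0)
     \<le> ennreal (\<rho> * (K + x\<^sup>2))"
    using offspring_lyapunov by blast
  let ?g = "\<lambda>u. \<integral>\<^sup>+w. ennreal (lyapunov K c x u w) \<partial>Q"
  have stp: "(\<Sum>i=1..n. ?g (u @ [i])) \<le> ennreal \<rho> * (?g u + 0)" if u: "u \<in> labels" for u n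
  proof -
    have ui: "u @ [i] \<in> labels" if "i \<in> {1..n}" for i using u that by (simp add: labels_append)
    have lm: "(\<lambda>w. ennreal (lyapunov K c x (u @ [i]) w)) \<in> borel_measurable Q" if "i \<in> {1..n}" for i
      by (rule measurable_compose[OF lyapunov_measurable[OF ui[OF that]] measurable_ennreal])
    have "(\<Sum>i=1..n. ?g (u @ [i])) = (\<integral>\<^sup>+w. (\<Sum>i=1..n. ennreal (lyapunov K c x (u @ [i]) w)) \<partial>Q)"
      by (rule nn_integral_sum[symmetric]) (rule lm)
    also have "\<dots> = (\<integral>\<^sup>+w. (\<integral>\<^sup>+d. (\<Sum>i=1..n. ennreal (lyapunov K c x (u @ [i]) (w(u := d)))) \<partial>P0) \<partial>Q)"
      by (rule Q.nn_integral_resample[OF u]) (intro borel_measurable_sum lm)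
    also have "\<dots> \<le> (\<integral>\<^sup>+w. ennreal \<rho> * ennreal (lyapunov K c x u w) \<partial>Q)"
    proof (rule nn_integral_mono)
      fix w
      show "(\<integral>\<^sup>+d. (\<Sum>i=1..n. ennreal (lyapunov K c x (u @ [i]) (w(u := d)))) \<partial>P0) \<le> ennreal \<rho> * ennreal (lyapunov K c x u w)"
      proof (cases "born w u")
        case False
        then show ?thesis by (simp add: lyapunov_def born_upd)
      next
        case True
        define E where "E = exp (- (3 * alpha / 2) * birth w u)"
        define y where "y = score drift c x w u"
        let ?f = "\<lambda>d i. ennreal (exp (- (3 * alpha / 2) * life d) * (K + (y + c * step drift d i)\<^sup>2))"
        have pw: "(\<Sum>i=1..n. ennreal (lyapunov K c x (u @ [i]) (w(u := d)))) \<le> ennreal E * (\<Sum>i=1..children d. ?f d i)" for d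
        proof -
          have "ennreal (lyapunov K c x (u @ [i]) (w(u := d))) = (if i \<le> children d then ennreal E * ?f d i else 0)" for i
          proof -
            have "exp (- (3 * alpha / 2) * (birth w u + life d)) = E * exp (- (3 * alpha / 2) * life d)"
              unfolding E_def exp_add[symmetric] by (rule arg_cong[where f = exp]) (simp add: algebra_simps)
            then have "lyapunov K c x (u @ [i]) (w(u := d)) = (if i \<le> children d then E * (exp (- (3 * alpha / 2) * life d) * (K + (y + c * step drift d i)\<^sup>2)) else 0)"
              using True by (simp add: lyapunov_def born_upd birth_upd score_upd y_def mult.assoc)
            then show ?thesis using K by (simp add: E_def ennreal_mult)
          qed
          then have "(\<Sum>i=1..n. ennreal (lyapunov K c x (u @ [i]) (w(u := d)))) = (\<Sum>i=1..n. if i \<le> children d then ennreal E * ?f d i else 0)"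
            by simp
          also have "\<dots> = (\<Sum>i\<in>{i\<in>{1..n}. i \<le> children d}. ennreal E * ?f d i)"
            by (rule sum.inter_filter[symmetric]) simp
          also have "\<dots> \<le> (\<Sum>i=1..children d. ennreal E * ?f d i)"
            by (rule sum_mono2) auto
          finally show ?thesis by (simp only: sum_distrib_left)
        qed
        have "(\<integral>\<^sup>+d. (\<Sum>i=1..n. ennreal (lyapunov K c x (u @ [i]) (w(u := d)))) \<partial>P0) \<le> (\<integral>\<^sup>+d. ennreal E * (\<Sum>i=1..children d. ?f d i) \<partial>P0)"
          by (rule nn_integral_mono) (rule pw)
        also have "\<dots> = ennreal E * (\<integral>\<^sup>+d. (\<Sum>i=1..children d. ?f d i) \<partial>P0)"
        proof (rule nn_integral_cmult)
          have "(\<lambda>d. \<Sum>i=1..children d. ?f d i) \<in> borel_measurable particle_space"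
            by (rule measurable_compose_countable[where g = children and f = "\<lambda>n d. \<Sum>i=1..n. ?f d i"]) measurable
          then show "(\<lambda>d. \<Sum>i=1..children d. ?f d i) \<in> borel_measurable P0"
            by (simp only: measurable_cong_sets[OF sets_P0 refl])
        qed
        also have "\<dots> \<le> ennreal E * ennreal (\<rho> * (K + y\<^sup>2))"
          by (intro mult_left_mono L) simp
        also have "\<dots> = ennreal \<rho> * ennreal (lyapunov K c x u w)"
          using True K \<rho>(1) by (simp add: lyapunov_def E_def y_def ennreal_mult[symmetric] mult_ac)
        finally show ?thesis .
      qed
    qed
    also have "\<dots> = ennreal \<rho> * ?g u"
      by (rule nn_integral_cmult[OF measurable_compose[OF lyapunov_measurable[OF u] measurable_ennreal]])
    finally show ?thesis by simp
  qed
  have root: "?g [] = ennreal (K + x\<^sup>2)"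
    using K by (simp add: lyapunov_def Q.P.emeasure_space_1)
  have "(\<Sum>u\<in>labels_upto n. \<integral>\<^sup>+w. ennreal (lyapunov 1 c x u w) \<partial>Q) \<le> ennreal (1 / (1 - \<rho>) * (K + x\<^sup>2))" for n
  proof -
    have "(\<Sum>u\<in>labels_upto n. \<integral>\<^sup>+w. ennreal (lyapunov 1 c x u w) \<partial>Q) \<le> (\<Sum>u\<in>labels_upto n. ?g u)"
      using K by (intro sum_mono nn_integral_mono ennreal_leI) (auto simp: lyapunov_def)
    also have "\<dots> \<le> ennreal (1 / (1 - \<rho>)) * (?g [] + (\<Sum>u\<in>labels_upto n. 0))"
      using stp[OF labels_uptoD] \<rho> root by (intro sum_labels_upto_le) auto
    also have "\<dots> = ennreal (1 / (1 - \<rho>) * (K + x\<^sup>2))"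
      unfolding root sum.neutral_const add_0_right using \<rho> K by (intro ennreal_mult[symmetric]) auto
    finally show ?thesis .
  qed
  moreover have "0 \<le> 1 / (1 - \<rho>) * (K + x\<^sup>2)" using \<rho> K by simp
  ultimately show ?thesis by blast
qed

lemma sum_dinc_square_bounded:
  "\<exists>C\<ge>0. \<forall>n s t. s \<le> t \<longrightarrow> 0 \<le> t \<longrightarrow>
     (\<Sum>u\<in>labels_upto n. \<integral>\<^sup>+w. ennreal ((dinc c x s t u w)\<^sup>2) \<partial>Q) \<le> ennreal (C * exp (- (alpha / 2) * s))"
proof -
  obtain C1 where C1: "C1 \<ge> 0" "\<And>s t u. u \<in> labels \<Longrightarrow> s \<le> t \<Longrightarrow> 0 \<le> t \<Longrightarrow>
     (\<integral>\<^sup>+w. ennreal ((dinc c x s t u w)\<^sup>2) \<partial>Q) \<le> ennreal (C1 * exp (- (alpha / 2) * s)) * (\<integral>\<^sup>+w. ennreal (lyapunov 1 c x u w) \<partial>Q)"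
    using nn_integral_dinc_square[of c] by meson
  obtain C2 where C2: "C2 \<ge> 0" "\<And>n. (\<Sum>u\<in>labels_upto n. \<integral>\<^sup>+w. ennreal (lyapunov 1 c x u w) \<partial>Q) \<le> ennreal C2"
    using sum_lyapunov_bounded by blast
  have "(\<Sum>u\<in>labels_upto n. \<integral>\<^sup>+w. ennreal ((dinc c x s t u w)\<^sup>2) \<partial>Q) \<le> ennreal (C1 * C2 * exp (- (alpha / 2) * s))"
    if st: "s \<le> t" "0 \<le> t" for n s t
  proof -
    have "(\<Sum>u\<in>labels_upto n. \<integral>\<^sup>+w. ennreal ((dinc c x s t u w)\<^sup>2) \<partial>Q) \<le>
       (\<Sum>u\<in>labels_upto n. ennreal (C1 * exp (- (alpha / 2) * s)) * (\<integral>\<^sup>+w. ennreal (lyapunov 1 c x u w) \<partial>Q))"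
      by (rule sum_mono) (rule C1(2)[OF labels_uptoD st])
    also have "\<dots> \<le> ennreal (C1 * exp (- (alpha / 2) * s)) * ennreal C2"
      unfolding sum_distrib_left[symmetric] by (intro mult_left_mono C2(2)) simp
    also have "\<dots> = ennreal (C1 * C2 * exp (- (alpha / 2) * s))"
      by (subst ennreal_mult[symmetric]) (use C1(1) C2(1) in \<open>simp_all add: mult.commute mult.left_commute\<close>)
    finally show ?thesis .
  qed
  then show ?thesis using mult_nonneg_nonneg[OF C1(1) C2(1)] by blast
qed

lemma dinc_square_integrable:
  assumes u: "u \<in> labels" and st: "s \<le> t" "0 \<le> t"
  shows "integrable Q (\<lambda>w. (dinc c x s t u w)\<^sup>2)"
proof -
  obtain C where C: "\<And>n. (\<Sum>u\<in>labels_upto n. \<integral>\<^sup>+w. ennreal ((dinc c x s t u w)\<^sup>2) \<partial>Q) \<le> ennreal (C * exp (- (alpha / 2) * s))"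
    using sum_dinc_square_bounded[of c x] st by blast
  obtain n where n: "u \<in> labels_upto n" using labels_upto_cover[OF u] by blast
  have "(\<integral>\<^sup>+w. ennreal ((dinc c x s t u w)\<^sup>2) \<partial>Q) \<le> (\<Sum>u\<in>labels_upto n. \<integral>\<^sup>+w. ennreal ((dinc c x s t u w)\<^sup>2) \<partial>Q)"
    by (rule member_le_sum[OF n]) auto
  also have "\<dots> < \<infinity>" using le_less_trans[OF C ennreal_less_top] by simp
  finally have "(\<integral>\<^sup>+w. ennreal ((dinc c x s t u w)\<^sup>2) \<partial>Q) < \<infinity>" .
  then show ?thesis
    by (intro integrableI_nonneg[OF borel_measurable_power[OF dinc_measurable[OF u]]] AE_I2) simp_all
qed

lemma dinc_integrable: "u \<in> labels \<Longrightarrow> s \<le> t \<Longrightarrow> 0 \<le> t \<Longrightarrow> integrable Q (dinc c x s t u)"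
  by (rule Q.P.square_integrable_imp_integrable[OF dinc_measurable dinc_square_integrable])

lemma integrable_times_bounded:
  fixes f H :: "'b \<Rightarrow> real"
  assumes "integrable N f" "H \<in> borel_measurable N" "\<And>w. \<bar>H w\<bar> \<le> B"
  shows "integrable N (\<lambda>w. f w * H w)"
proof (rule Bochner_Integration.integrable_bound[OF integrable_mult_right[OF assms(1), of B]])
  show "AE w in N. norm (f w * H w) \<le> norm (B * f w)"
    using order_trans[OF assms(3) abs_ge_self]
    by (intro AE_I2) (auto simp: abs_mult mult.commute[of "\<bar>B\<bar>"] intro!: mult_left_mono)
  show "(\<lambda>w. f w * H w) \<in> borel_measurable N" using assms(1,2) by measurable
qed

lemma Phi_diff: "Phi c x F t w - Phi c x F s w = (\<Sum>u\<in>F. dinc c x s t u w)"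
  by (simp add: Phi_def dinc_def sum_subtractf)

lemma Phi_increment_orthogonal:
  assumes F: "finite F" "F \<subseteq> labels" and st: "s \<le> t" "0 \<le> t"
    and H: "adapted s H" "H \<in> borel_measurable Q" "\<And>w. \<bar>H w\<bar> \<le> B"
  shows "(\<integral>w. (Phi c x F t w - Phi c x F s w) * H w \<partial>Q) = 0"
proof -
  have i: "integrable Q (\<lambda>w. dinc c x s t u w * H w)" if "u \<in> F" for u
    using that F st by (intro integrable_times_bounded[OF _ H(2,3)] dinc_integrable) auto
  have "(\<integral>w. (Phi c x F t w - Phi c x F s w) * H w \<partial>Q) = (\<integral>w. (\<Sum>u\<in>F. dinc c x s t u w * H w) \<partial>Q)"
    by (simp only: Phi_diff sum_distrib_right)
  also have "\<dots> = (\<Sum>u\<in>F. \<integral>w. dinc c x s t u w * H w \<partial>Q)"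
    by (rule Bochner_Integration.integral_sum[OF i])
  also have "\<dots> = 0"
  proof (rule sum.neutral, rule ballI)
    fix u assume u: "u \<in> F"
    have "(\<integral>w. (incr c x t u w - incr c x s u w) * 1 * H w \<partial>Q) = 0"
      using i[OF u] F u by (intro incr_increment_orthogonal[OF _ st(1) H]) (auto simp: dinc_def)
    then show "(\<integral>w. dinc c x s t u w * H w \<partial>Q) = 0" by (simp add: dinc_def)
  qed
  finally show ?thesis .
qed

text \<open>Of two distinct labels at least one is not an ancestor of the other. Resampling that one
  leaves the increment of the other unchanged, so the latter can serve as the factor
  \<open>W\<close>.\<close>

lemma dinc_product_orthogonal:
  assumes uv: "u \<in> labels" "v \<in> labels" "u \<noteq> v" and st: "s \<le> t" "0 \<le> t"
    and H: "adapted s H" "H \<in> borel_measurable Q" "\<And>w. \<bar>H w\<bar> \<le> B"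
  shows "(\<integral>w. dinc c x s t u w * dinc c x s t v w * H w \<partial>Q) = 0"
proof -
  have *: "(\<integral>w. dinc c x s t u w * dinc c x s t v w * H w \<partial>Q) = 0"
    if uv: "u \<in> labels" "v \<in> labels" "u \<noteq> v" "\<not> strict_prefix u v" for u v
  proof -
    have "integrable Q (\<lambda>w. dinc c x s t u w * dinc c x s t v w)"
      using uv st by (intro integrable_mult_L2 dinc_measurable dinc_square_integrable)
    then have "integrable Q (\<lambda>w. dinc c x s t u w * dinc c x s t v w * H w)"
      by (rule integrable_times_bounded[OF _ H(2,3)])
    then have "(\<integral>w. (incr c x t u w - incr c x s u w) * dinc c x s t v w * H w \<partial>Q) = 0"
      using uv by (intro incr_increment_orthogonal[OF _ st(1) H] dinc_upd_other) (auto simp: dinc_def)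
    then show ?thesis by (simp only: dinc_def)
  qed
  show ?thesis
  proof (cases "strict_prefix u v")
    case False then show ?thesis using * uv by blast
  next
    case True
    then have "\<not> strict_prefix v u" by auto
    from *[OF uv(2,1) _ this] uv(3)
    have "(\<integral>w. dinc c x s t v w * dinc c x s t u w * H w \<partial>Q) = 0" by auto
    then show ?thesis by (simp only: mult.commute[of "dinc c x s t v _"])
  qed
qed

text \<open>Pythagoras with an adapted weight: the mixed terms vanish even after multiplication by
  \<open>H\<close>. The weighted form is what replaces conditioning on the population at time
  \<open>s\<close>.\<close>

lemma Phi_increment_square:
  assumes F: "finite F" "F \<subseteq> labels" and st: "s \<le> t" "0 \<le> t"
    and H: "adapted s H" "H \<in> borel_measurable Q" "\<And>w. \<bar>H w\<bar> \<le> B"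
  shows "(\<integral>w. (Phi c x F t w - Phi c x F s w)\<^sup>2 * H w \<partial>Q) = (\<Sum>u\<in>F. \<integral>w. (dinc c x s t u w)\<^sup>2 * H w \<partial>Q)"
    and "integrable Q (\<lambda>w. (Phi c x F t w - Phi c x F s w)\<^sup>2 * H w)"
proof -
  have i: "integrable Q (\<lambda>w. dinc c x s t u w * dinc c x s t v w * H w)" if "u \<in> F" "v \<in> F" for u v
    using that F st by (intro integrable_times_bounded[OF _ H(2,3)] integrable_mult_L2 dinc_measurable dinc_square_integrable) auto
  have eq: "(Phi c x F t w - Phi c x F s w)\<^sup>2 * H w = (\<Sum>u\<in>F. \<Sum>v\<in>F. dinc c x s t u w * dinc c x s t v w * H w)" for w
    unfolding Phi_diff power2_eq_square sum_product by (simp only: sum_distrib_right)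
  show "integrable Q (\<lambda>w. (Phi c x F t w - Phi c x F s w)\<^sup>2 * H w)"
    unfolding eq by (intro Bochner_Integration.integrable_sum i)
  have "(\<integral>w. (Phi c x F t w - Phi c x F s w)\<^sup>2 * H w \<partial>Q) = (\<Sum>u\<in>F. \<Sum>v\<in>F. \<integral>w. dinc c x s t u w * dinc c x s t v w * H w \<partial>Q)"
    unfolding eq
    by (subst Bochner_Integration.integral_sum, intro Bochner_Integration.integrable_sum i, assumption+,
        intro sum.cong refl Bochner_Integration.integral_sum i)
  also have "\<dots> = (\<Sum>u\<in>F. \<Sum>v\<in>F. if u = v then \<integral>w. (dinc c x s t u w)\<^sup>2 * H w \<partial>Q else 0)"
  proof (intro sum.cong refl)
    fix u v assume "u \<in> F" "v \<in> F"
    then show "(\<integral>w. dinc c x s t u w * dinc c x s t v w * H w \<partial>Q) = (if u = v then \<integral>w. (dinc c x s t u w)\<^sup>2 * H w \<partial>Q else 0)"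
      using dinc_product_orthogonal[OF _ _ _ st H, of u v c x] F(2) by (auto simp: power2_eq_square)
  qed
  also have "\<dots> = (\<Sum>u\<in>F. \<integral>w. (dinc c x s t u w)\<^sup>2 * H w \<partial>Q)"
    using F(1) by simp
  finally show "(\<integral>w. (Phi c x F t w - Phi c x F s w)\<^sup>2 * H w \<partial>Q) = (\<Sum>u\<in>F. \<integral>w. (dinc c x s t u w)\<^sup>2 * H w \<partial>Q)" .
qed

text \<open>The multiplier of a first exceedance at \<open>\<tau> j\<close> is a function of values
  up to that time, hence adapted, so \<open>maximal_inequality\<close> applies. Apart from
  \<epsilon> and the starting time, the bound depends neither on the truncation nor on the
  grid.\<close>

lemma Phi_maximal:
  "\<exists>C\<ge>0. \<forall>n (p::nat) \<tau> \<epsilon>. 0 \<le> \<tau> 0 \<longrightarrow> (\<forall>i j. i \<le> j \<longrightarrow> \<tau> i \<le> \<tau> j) \<longrightarrow> 0 < \<epsilon> \<longrightarrow>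
     Q.P.prob {w \<in> space Q. \<exists>j\<le>p. \<epsilon> < \<bar>Phi c x (labels_upto n) (\<tau> j) w - Phi c x (labels_upto n) (\<tau> 0) w\<bar>}
       \<le> C * exp (- (alpha / 2) * \<tau> 0) / \<epsilon>\<^sup>2"
proof -
  obtain C where C: "C \<ge> 0" "\<And>n s t. s \<le> t \<Longrightarrow> 0 \<le> t \<Longrightarrow>
     (\<Sum>u\<in>labels_upto n. \<integral>\<^sup>+w. ennreal ((dinc c x s t u w)\<^sup>2) \<partial>Q) \<le> ennreal (C * exp (- (alpha / 2) * s))"
    using sum_dinc_square_bounded[of c x] by meson
  have main: "Q.P.prob {w \<in> space Q. \<exists>j\<le>p. \<epsilon> < \<bar>Phi c x (labels_upto n) (\<tau> j) w - Phi c x (labels_upto n) (\<tau> 0) w\<bar>}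
       \<le> C * exp (- (alpha / 2) * \<tau> 0) / \<epsilon>\<^sup>2"
    if \<tau>0: "0 \<le> \<tau> 0" and mono: "\<And>i j. i \<le> j \<Longrightarrow> \<tau> i \<le> \<tau> j" and \<epsilon>: "0 < \<epsilon>" for n p and \<tau> :: "nat \<Rightarrow> real" and \<epsilon> :: real
  proof -
    let ?F = "labels_upto n"
    note F = finite_labels_upto[of n] labels_upto_subset[of n]
    define S where "S j w = Phi c x ?F (\<tau> j) w - Phi c x ?F (\<tau> 0) w" for j w
    have \<tau>: "0 \<le> \<tau> j" "\<tau> 0 \<le> \<tau> j" for j using \<tau>0 mono[of 0 j] by auto
    have one: "adapted s (\<lambda>_. 1)" "(\<lambda>_. 1) \<in> borel_measurable Q" "\<And>w. \<bar>1\<bar> \<le> (1::real)" for s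
      by (auto simp: adapted_def)
    have sq: "(\<integral>w. (S p w)\<^sup>2 \<partial>Q) = (\<Sum>u\<in>?F. \<integral>w. (dinc c x (\<tau> 0) (\<tau> p) u w)\<^sup>2 \<partial>Q)" "integrable Q (\<lambda>w. (S p w)\<^sup>2)"
      using Phi_increment_square[OF F \<tau>(2) \<tau>(1) one] unfolding S_def mult_1_right by this+
    have Sm: "S j \<in> borel_measurable Q" for j
      unfolding S_def[abs_def] by (intro borel_measurable_diff Phi_measurable F)
    have max: "Q.P.prob {w \<in> space Q. \<exists>j\<le>p. \<epsilon> < \<bar>S j w\<bar>} \<le> Q.P.expectation (\<lambda>w. (S p w)\<^sup>2) / \<epsilon>\<^sup>2"
    proof (rule Q.P.maximal_inequality[OF _ _ \<epsilon>])
      show "integrable Q (S j)" for j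
        unfolding S_def[abs_def] Phi_diff
        by (rule Bochner_Integration.integrable_sum) (rule dinc_integrable[OF labels_uptoD \<tau>(2,1)])
      show "integrable Q (\<lambda>w. (S p w)\<^sup>2)" by (rule sq(2))
      fix j assume "j \<le> p"
      define H where "H w = (if \<epsilon> < \<bar>S j w\<bar> \<and> (\<forall>i<j. \<bar>S i w\<bar> \<le> \<epsilon>) then sgn (S j w) else 0)" for w
      \<comment> \<open>Values after \<open>\<tau> j\<close> are replaced by 0, since
        \<open>adapted_compose\<close> asks every member of the sequence to be adapted at the same
        time.\<close>
      have aS: "adapted (\<tau> j) (\<lambda>w. if i \<le> j then S i w else 0)" for i
      proof (cases "i \<le> j")
        case True
        let ?P = "\<lambda>k::nat. if k = 0 then Phi c x ?F (\<tau> i) else Phi c x ?F (\<tau> 0)"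
        have "adapted (\<tau> j) (?P k)" for k
          using adapted_Phi[OF F mono[OF True]] adapted_Phi[OF F mono[of 0 j]] by simp
        from adapted_compose[of "\<tau> j" ?P "\<lambda>h. h 0 - h 1", OF this]
        show ?thesis using True by (simp add: S_def)
      next
        case False then show ?thesis by (simp add: adapted_def)
      qed
      have "adapted (\<tau> j) H"
      proof -
        let ?h = "\<lambda>h. if \<epsilon> < \<bar>h j\<bar> \<and> (\<forall>i<j. \<bar>h i\<bar> \<le> \<epsilon>) then sgn (h j) else 0"
        have "H = (\<lambda>w. ?h (\<lambda>i. if i \<le> j then S i w else 0))"
          by (rule ext) (auto simp: H_def)
        then show ?thesis using adapted_compose[of "\<tau> j" "\<lambda>i w. if i \<le> j then S i w else 0" ?h, OF aS] by (simp only:)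
      qed
      moreover have "H \<in> borel_measurable Q"
      proof -
        have a: "(\<lambda>w. \<bar>S i w\<bar>) \<in> borel_measurable Q" for i by (rule borel_measurable_abs[OF Sm])
        have "{w \<in> space Q. \<forall>i\<in>{..<j}. \<bar>S i w\<bar> \<le> \<epsilon>} \<in> sets Q"
          by (intro sets.sets_Collect_finite_All borel_measurable_le a borel_measurable_const) auto
        then have "{w \<in> space Q. \<forall>i<j. \<bar>S i w\<bar> \<le> \<epsilon>} \<in> sets Q" unfolding Ball_def lessThan_iff .
        note B = sets.sets_Collect_conj[OF this borel_measurable_less[OF borel_measurable_const[of \<epsilon>] a[of j]]]
        show ?thesis unfolding H_def[abs_def]
          by (rule measurable_If[OF measurable_compose[OF Sm borel_measurable_sgn] borel_measurable_const])
             (rule B)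
      qed
      moreover have "\<bar>H w\<bar> \<le> 1" for w by (simp add: H_def sgn_if)
      ultimately have "(\<integral>w. (Phi c x ?F (\<tau> p) w - Phi c x ?F (\<tau> j) w) * H w \<partial>Q) = 0"
        by - (rule Phi_increment_orthogonal[OF F mono[OF \<open>j \<le> p\<close>] \<tau>(1)])
      moreover have "S p w - S j w = Phi c x ?F (\<tau> p) w - Phi c x ?F (\<tau> j) w" for w by (simp add: S_def)
      ultimately show "Q.P.expectation (\<lambda>w. (S p w - S j w) * (if \<epsilon> < \<bar>S j w\<bar> \<and> (\<forall>i<j. \<bar>S i w\<bar> \<le> \<epsilon>) then sgn (S j w) else 0)) = 0"
        by (simp only: H_def)
    qed
    have "ennreal (\<integral>w. (S p w)\<^sup>2 \<partial>Q) = ennreal (\<Sum>u\<in>?F. \<integral>w. (dinc c x (\<tau> 0) (\<tau> p) u w)\<^sup>2 \<partial>Q)"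
      by (simp only: sq(1))
    also have "\<dots> = (\<Sum>u\<in>?F. ennreal (\<integral>w. (dinc c x (\<tau> 0) (\<tau> p) u w)\<^sup>2 \<partial>Q))"
      by (rule sum_ennreal[symmetric]) (rule Bochner_Integration.integral_nonneg, rule zero_le_power2)
    also have "\<dots> = (\<Sum>u\<in>?F. \<integral>\<^sup>+w. ennreal ((dinc c x (\<tau> 0) (\<tau> p) u w)\<^sup>2) \<partial>Q)"
    proof (rule sum.cong[OF refl])
      fix u assume "u \<in> ?F"
      show "ennreal (\<integral>w. (dinc c x (\<tau> 0) (\<tau> p) u w)\<^sup>2 \<partial>Q) = (\<integral>\<^sup>+w. ennreal ((dinc c x (\<tau> 0) (\<tau> p) u w)\<^sup>2) \<partial>Q)"
        by (rule nn_integral_eq_integral[symmetric, OF dinc_square_integrable[OF labels_uptoD[OF \<open>u \<in> ?F\<close>] \<tau>(2,1)]])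
           (rule AE_I2, rule zero_le_power2)
    qed
    also have "\<dots> \<le> ennreal (C * exp (- (alpha / 2) * \<tau> 0))" by (rule C(2)[OF \<tau>(2,1)])
    finally have "(\<integral>w. (S p w)\<^sup>2 \<partial>Q) \<le> C * exp (- (alpha / 2) * \<tau> 0)"
      by (simp only: ennreal_le_iff[OF mult_nonneg_nonneg[OF C(1) exp_ge_zero]])
    then have "(\<integral>w. (S p w)\<^sup>2 \<partial>Q) / \<epsilon>\<^sup>2 \<le> C * exp (- (alpha / 2) * \<tau> 0) / \<epsilon>\<^sup>2"
      by (rule divide_right_mono) (rule zero_le_power2)
    with max show ?thesis unfolding S_def by (rule order_trans)
  qed
  show ?thesis by (intro exI[of _ C] conjI C(1) allI impI, rule main) simp_all
qed

end

section \<open>Almost sure convergence\<close>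

text \<open>On each unit interval right-continuity extends the bound from dyadic points to all
  times. Summability makes the values at integers converge and the oscillation in between tend to
  0.\<close>

lemma tendsto_at_top_of_dyadic_oscillation:
  fixes f :: "real \<Rightarrow> real" and \<epsilon> :: "nat \<Rightarrow> real"
  assumes right: "\<And>t. 0 \<le> t \<Longrightarrow> continuous (at_right t) f"
    and sum: "summable \<epsilon>"
    and osc: "\<And>k q j. k0 \<le> k \<Longrightarrow> j \<le> 2 ^ q \<Longrightarrow> \<bar>f (real k + real j / 2 ^ q) - f (real k)\<bar> \<le> \<epsilon> k"
  shows "\<exists>L. (f \<longlongrightarrow> L) at_top"
proof -
  have close: "\<bar>f t - f (real k)\<bar> \<le> \<epsilon> k" if k: "k0 \<le> k" and t: "real k \<le> t" "t < real k + 1" for t k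
  proof -
    \<comment> \<open>The \<open>+ 1\<close> gives dyadic points strictly to the right of
      \<open>t\<close>; as \<open>t < real k + 1\<close>, they stay in the same closed unit
      interval.\<close>
    define j where "j q = nat \<lfloor>(t - real k) * 2 ^ q\<rfloor> + 1" for q :: nat
    have j: "(t - real k) * 2 ^ q < real (j q)" "real (j q) \<le> (t - real k) * 2 ^ q + 1" for q
    proof -
      have "0 \<le> (t - real k) * 2 ^ q" using t by simp
      then have "real (j q) = real_of_int \<lfloor>(t - real k) * 2 ^ q\<rfloor> + 1" by (simp add: j_def)
      then show "(t - real k) * 2 ^ q < real (j q)" "real (j q) \<le> (t - real k) * 2 ^ q + 1" by linarith+
    qed
    have j_le: "j q \<le> 2 ^ q" for q
    proof -
      have "(t - real k) * 2 ^ q < 1 * 2 ^ q" using t by (intro mult_strict_right_mono) auto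
      then have "real (j q) < 2 ^ q + 1" using j(2)[of q] by linarith
      then have "real (j q) < real (2 ^ q + 1)" by simp
      then show ?thesis by (simp only: of_nat_less_iff)
    qed
    have "filterlim (\<lambda>q. real k + real (j q) / 2 ^ q) (at_right t) sequentially"
    proof (rule tendsto_imp_filterlim_at_right)
      have "t < real k + real (j q) / 2 ^ q" for q
        using j(1)[of q] by (simp add: field_simps)
      then show "\<forall>\<^sub>F q in sequentially. t < real k + real (j q) / 2 ^ q" by simp
      have up: "real k + real (j q) / 2 ^ q \<le> t + (1 / 2) ^ q" for q
      proof -
        have "real (j q) / 2 ^ q \<le> ((t - real k) * 2 ^ q + 1) / 2 ^ q"
          using j(2)[of q] by (rule divide_right_mono) simp
        also have "\<dots> = (t - real k) + (1 / 2) ^ q" by (simp add: add_divide_distrib power_one_over)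
        finally show ?thesis by simp
      qed
      have "(\<lambda>q. t + (1 / 2) ^ q) \<longlonglongrightarrow> t + 0"
        by (intro tendsto_add tendsto_const LIMSEQ_realpow_zero) auto
      then have lim: "(\<lambda>q. t + (1 / 2) ^ q) \<longlonglongrightarrow> t" by simp
      show "(\<lambda>q. real k + real (j q) / 2 ^ q) \<longlonglongrightarrow> t"
        by (rule tendsto_sandwich[OF _ _ tendsto_const lim])
           (use \<open>\<And>q. t < real k + real (j q) / 2 ^ q\<close> up in \<open>auto intro!: always_eventually less_imp_le\<close>)
    qed
    moreover have "(f \<longlongrightarrow> f t) (at_right t)"
      using right[of t] t by (simp add: continuous_within)
    ultimately have "(\<lambda>q. f (real k + real (j q) / 2 ^ q)) \<longlonglongrightarrow> f t"
      by (rule filterlim_compose[rotated])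
    then have "(\<lambda>q. \<bar>f (real k + real (j q) / 2 ^ q) - f (real k)\<bar>) \<longlonglongrightarrow> \<bar>f t - f (real k)\<bar>"
      by (intro tendsto_intros)
    then show ?thesis
      using osc[OF k j_le] by (intro LIMSEQ_le_const2) auto
  qed
  have "summable (\<lambda>k. f (real (Suc k)) - f (real k))"
  proof (rule summable_comparison_test_ev[OF _ sum])
    have "norm (f (real (Suc k)) - f (real k)) \<le> \<epsilon> k" if "k0 \<le> k" for k
      using osc[OF that, of 1 0] by (simp add: add.commute)
    then show "\<forall>\<^sub>F k in sequentially. norm (f (real (Suc k)) - f (real k)) \<le> \<epsilon> k"
      unfolding eventually_sequentially by blast
  qed
  then have "convergent (\<lambda>n. \<Sum>k<n. f (real (Suc k)) - f (real k))"
    by (simp add: summable_iff_convergent)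
  then have "convergent (\<lambda>n. f (real n) - f (real 0))"
    by (simp only: sum_lessThan_telescope[of "\<lambda>k. f (real k)"])
  then obtain l where "(\<lambda>n. f (real n) - f (real 0)) \<longlonglongrightarrow> l" by (auto simp: convergent_def)
  then have "(\<lambda>n. (f (real n) - f (real 0)) + f (real 0)) \<longlonglongrightarrow> l + f (real 0)" by (intro tendsto_intros)
  then have L: "(\<lambda>n. f (real n)) \<longlonglongrightarrow> l + f (real 0)" by simp
  have fl: "filterlim (\<lambda>t::real. nat \<lfloor>t\<rfloor>) sequentially at_top"
    by (intro filterlim_compose[OF filterlim_nat_sequentially] filterlim_floor_sequentially)
  have "((\<lambda>t. f t - f (real (nat \<lfloor>t\<rfloor>))) \<longlongrightarrow> 0) at_top"
  proof (rule Lim_null_comparison)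
    show "((\<lambda>t::real. \<epsilon> (nat \<lfloor>t\<rfloor>)) \<longlongrightarrow> 0) at_top"
      by (rule filterlim_compose[OF summable_LIMSEQ_zero[OF sum] fl])
    show "\<forall>\<^sub>F t in at_top. norm (f t - f (real (nat \<lfloor>t\<rfloor>))) \<le> \<epsilon> (nat \<lfloor>t\<rfloor>)"
      using eventually_ge_at_top[of "real k0"]
    proof eventually_elim
      case (elim t)
      then have "k0 \<le> nat \<lfloor>t\<rfloor>" "real (nat \<lfloor>t\<rfloor>) \<le> t" "t < real (nat \<lfloor>t\<rfloor>) + 1" by linarith+
      from close[OF this] show ?case by simp
    qed
  qed
  moreover have "((\<lambda>t::real. f (real (nat \<lfloor>t\<rfloor>))) \<longlongrightarrow> l + f (real 0)) at_top"
    by (rule filterlim_compose[OF L fl])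
  ultimately have "((\<lambda>t. (f t - f (real (nat \<lfloor>t\<rfloor>))) + f (real (nat \<lfloor>t\<rfloor>))) \<longlongrightarrow> 0 + (l + f (real 0))) at_top"
    by (rule tendsto_add)
  then show ?thesis by auto
qed

section \<open>Telescoping to the living particles, non-explosion and oscillation bounds\<close>

context particle_law
begin

text \<open>The current count \<open>x + c * p\<close> of \<open>v\<close>, where \<open>p\<close>
  is its centred position at time \<open>t\<close>.\<close>

definition place :: "real \<Rightarrow> real \<Rightarrow> real \<Rightarrow> (nat list \<Rightarrow> particle) \<Rightarrow> nat list \<Rightarrow> real" where
  "place c x t w v = score drift c x w v + c * (eval_right (fst (w v)) (t - birth w v) - drift * (t - birth w v))"

definition present :: "real \<Rightarrow> (nat list \<Rightarrow> particle) \<Rightarrow> nat list set" where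
  "present t w = {v \<in> labels. born w v \<and> birth w v \<le> t}"

definition living :: "real \<Rightarrow> (nat list \<Rightarrow> particle) \<Rightarrow> nat list set" where
  "living t w = {v \<in> labels. born w v \<and> birth w v \<le> t \<and> t < birth w v + life (w v)}"

text \<open>The martingale of the whole tree: labels outside \<open>present t w\<close> have zero
  terms, and leaving them out makes the sum finite once the population is.\<close>

definition PhiI :: "real \<Rightarrow> real \<Rightarrow> real \<Rightarrow> (nat list \<Rightarrow> particle) \<Rightarrow> real" where
  "PhiI c x t w = Phi c x (present t w) t w"

lemma living_present: "living t w \<subseteq> present t w"
  by (auto simp: living_def present_def)

lemma present_mono: "s \<le> t \<Longrightarrow> present s w \<subseteq> present t w"
  by (auto simp: present_def)

lemma incr_eq_0: "v \<in> labels \<Longrightarrow> v \<notin> present t w \<Longrightarrow> incr c x t v w = 0"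
  by (auto simp: incr_def innov_def present_def)

lemma incr_living:
  assumes "v \<in> living t w"
  shows "incr c x t v w = exp (- alpha * t) * place c x t w v - exp (- alpha * birth w v) * score drift c x w v"
proof -
  have e: "exp (- alpha * birth w v) * exp (- alpha * (t - birth w v)) = exp (- alpha * t)"
    unfolding exp_add[symmetric] by (rule arg_cong[where f = exp]) (simp add: algebra_simps)
  have "incr c x t v w = exp (- alpha * birth w v) * (exp (- alpha * (t - birth w v)) * place c x t w v - score drift c x w v)"
    using assms by (simp add: incr_def living_def innov_def contrib_def weight_def place_def)
  also have "\<dots> = (exp (- alpha * birth w v) * exp (- alpha * (t - birth w v))) * place c x t w v - exp (- alpha * birth w v) * score drift c x w v"
    by (simp only: right_diff_distrib mult.assoc)
  finally show ?thesis unfolding e .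
qed

text \<open>A death exchanges the count of the particle at its birth for the counts of its children
  at theirs. Together with \<open>incr_living\<close> this is what telescopes.\<close>

lemma incr_dead:
  assumes "v \<in> present t w" "v \<notin> living t w"
  shows "incr c x t v w = (\<Sum>i=1..children (w v). exp (- alpha * birth w (v @ [i])) * score drift c x w (v @ [i]))
     - exp (- alpha * birth w v) * score drift c x w v"
proof -
  let ?L = "life (w v)" and ?y = "score drift c x w v" and ?b = "birth w v" and ?n = "children (w v)"
  let ?z = "eval_right (fst (w v)) ?L - drift * ?L"
  have d: "born w v" "?b \<le> t" "\<not> t - ?b < 0" "\<not> t - ?b < ?L" using assms by (auto simp: present_def living_def)
  have e: "exp (- alpha * ?b) * exp (- alpha * ?L) = exp (- alpha * (?b + ?L))"
    unfolding exp_add[symmetric] by (rule arg_cong[where f = exp]) (simp add: algebra_simps)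
  have j: "jump_sum (snd (snd (w v))) = (\<Sum>i=1..?n. jump (w v) i)"
    by (simp add: jump_sum_def jump_def children_def)
  have "(\<Sum>i=1..?n. ?y + c * step drift (w v) i) = (\<Sum>i=1..?n. (?y + c * ?z) + c * jump (w v) i)"
    by (intro sum.cong refl) (simp add: step_def algebra_simps)
  also have "\<dots> = real ?n * (?y + c * ?z) + c * jump_sum (snd (snd (w v)))"
    unfolding sum.distrib sum_distrib_left[symmetric] j by (simp add: algebra_simps)
  finally have s: "(\<Sum>i=1..?n. ?y + c * step drift (w v) i) = real ?n * (?y + c * ?z) + c * jump_sum (snd (snd (w v)))" .
  have "incr c x t v w = exp (- alpha * ?b) * (exp (- alpha * ?L) * (\<Sum>i=1..?n. ?y + c * step drift (w v) i) - ?y)"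
    unfolding s incr_def innov_def contrib_def weight_def using d by (simp only: if_True if_False)
  also have "\<dots> = (exp (- alpha * ?b) * exp (- alpha * ?L)) * (\<Sum>i=1..?n. ?y + c * step drift (w v) i) - exp (- alpha * ?b) * ?y"
    by (simp only: right_diff_distrib mult.assoc)
  finally show ?thesis unfolding e sum_distrib_left birth_append score_append .
qed

text \<open>
  Restricting to \<open>labels_upto n\<close> loses particles; their counts at birth, frozen from then on, are what
  the restricted sum keeps of them.
\<close>

definition frozen :: "nat \<Rightarrow> real \<Rightarrow> (nat list \<Rightarrow> particle) \<Rightarrow> nat list set" where
  "frozen n t w = (\<lambda>(v, i). v @ [i]) ` (SIGMA v : labels_upto n \<inter> present t w - living t w. {1..children (w v)}) - labels_upto n \<inter> present t w"

lemma Phi_telescope: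
  assumes t: "0 \<le> t"
  shows "Phi c x (labels_upto n) t w =
    (\<Sum>v\<in>labels_upto n \<inter> living t w. exp (- alpha * t) * place c x t w v) +
    (\<Sum>u\<in>frozen n t w. exp (- alpha * birth w u) * score drift c x w u)"
proof -
  let ?F = "labels_upto n"
  define P where "P = ?F \<inter> present t w"
  define A where "A = ?F \<inter> living t w"
  define D where "D = P - living t w"
  define C where "C = (\<lambda>(v, i). v @ [i]) ` (SIGMA v : D. {1..children (w v)})"
  let ?f = "\<lambda>u. exp (- alpha * birth w u) * score drift c x w u"
  have fin: "finite P" "finite A" "finite D" "finite C"
    by (auto simp: P_def A_def D_def C_def)
  have PAD: "P = A \<union> D" "A \<inter> D = {}" using living_present[of t w] by (auto simp: P_def A_def D_def)
  have inj: "inj_on (\<lambda>(v, i). v @ [i]) (SIGMA v : D. {1..children (w v)})"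
    by (auto simp: inj_on_def)
  have frozen: "frozen n t w = C - P" by (simp add: frozen_def C_def D_def P_def)
  \<comment> \<open>Apart from the root, the particles born by \<open>t\<close> inside the
    truncation are the children, again inside it, of particles dead by \<open>t\<close>. Hence all
    birth counts cancel except those of frozen children and that of the root, which offsets the
    initial \<open>x\<close>.\<close>
  have PC: "P - {[]} = C \<inter> P"
  proof (intro equalityI subsetI)
    fix u assume u: "u \<in> P - {[]}"
    define v where "v = butlast u"
    define i where "i = last u"
    have ui: "u = v @ [i]" using u by (simp add: v_def i_def)
    have b: "born w u" "birth w u \<le> t" "u \<in> ?F" using u by (auto simp: P_def present_def)
    have v: "v \<in> ?F" "1 \<le> i" using labels_upto_butlast[of v i n] b(3) ui by auto
    have bw: "born w v" "i \<le> children (w v)" "birth w v + life (w v) \<le> t" using b ui by auto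
    have "birth w v \<le> t" using bw(3) life_nonneg[of "w v"] by linarith
    then have "v \<in> D" using v bw labels_uptoD[OF v(1)] by (auto simp: D_def P_def present_def living_def)
    then have "(v, i) \<in> (SIGMA v : D. {1..children (w v)})" using v bw by simp
    then have "u \<in> C" unfolding C_def ui by (rule rev_image_eqI) simp
    then show "u \<in> C \<inter> P" using u by simp
  qed (auto simp: C_def)
  have root: "[] \<in> P" using t by (simp add: P_def present_def)
  have "(\<Sum>v\<in>?F. incr c x t v w) = (\<Sum>v\<in>P. incr c x t v w)"
    by (rule sum.mono_neutral_right) (auto simp: P_def intro!: incr_eq_0 dest: labels_uptoD)
  also have "\<dots> = (\<Sum>v\<in>A. incr c x t v w) + (\<Sum>v\<in>D. incr c x t v w)"
    unfolding PAD(1) by (rule sum.union_disjoint[OF fin(2,3) PAD(2)])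
  also have "(\<Sum>v\<in>A. incr c x t v w) = (\<Sum>v\<in>A. exp (- alpha * t) * place c x t w v) - (\<Sum>v\<in>A. ?f v)"
    unfolding sum_subtractf[symmetric] by (rule sum.cong[OF refl], rule incr_living) (simp add: A_def)
  also have "(\<Sum>v\<in>D. incr c x t v w) = (\<Sum>v\<in>D. \<Sum>i=1..children (w v). ?f (v @ [i])) - (\<Sum>v\<in>D. ?f v)"
    unfolding sum_subtractf[symmetric] by (rule sum.cong[OF refl], rule incr_dead) (simp_all add: D_def P_def)
  also have "(\<Sum>v\<in>D. \<Sum>i=1..children (w v). ?f (v @ [i])) = (\<Sum>u\<in>C. ?f u)"
    unfolding C_def sum.reindex[OF inj] by (subst sum.Sigma) (auto simp: fin split_beta' simp del: birth_append score_append)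
  also have "(\<Sum>u\<in>C. ?f u) = (\<Sum>u\<in>C \<inter> P. ?f u) + (\<Sum>u\<in>C - P. ?f u)"
    by (rule sum.Int_Diff[OF fin(4)])
  also have "(\<Sum>u\<in>C \<inter> P. ?f u) = (\<Sum>u\<in>P. ?f u) - ?f []"
    unfolding PC[symmetric] by (rule sum_diff1[OF fin(1), of ?f "[]", unfolded if_P[OF root]])
  also have "(\<Sum>u\<in>P. ?f u) = (\<Sum>u\<in>A. ?f u) + (\<Sum>u\<in>D. ?f u)"
    unfolding PAD(1) by (rule sum.union_disjoint[OF fin(2,3) PAD(2)])
  finally show ?thesis unfolding Phi_def frozen A_def by simp
qed

text \<open>Frozen children count positively here, so dropping them gives a bound for the number of
  living particles by the restricted martingale.\<close>

lemma Phi_count_ge: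
  assumes "0 \<le> t"
  shows "exp (- alpha * t) * real (card (labels_upto n \<inter> living t w)) \<le> Phi 0 1 (labels_upto n) t w"
proof -
  have "0 \<le> (\<Sum>u\<in>frozen n t w. exp (- alpha * birth w u) * score drift 0 1 w u)"
    by (rule sum_nonneg) (simp add: score_def)
  moreover have "(\<Sum>v\<in>labels_upto n \<inter> living t w. exp (- alpha * t) * place 0 1 t w v) = exp (- alpha * t) * real (card (labels_upto n \<inter> living t w))"
    by (simp add: place_def score_def)
  ultimately show ?thesis unfolding Phi_telescope[OF assms] by linarith
qed

lemma Phi_eq_PhiI:
  assumes "present t w \<subseteq> labels_upto n" "s \<le> t"
  shows "Phi c x (labels_upto n) s w = PhiI c x s w"
proof -
  have "present s w \<subseteq> labels_upto n" using present_mono[OF assms(2)] assms(1) by (rule subset_trans)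
  then have "(\<Sum>v\<in>labels_upto n. incr c x s v w) = (\<Sum>v\<in>present s w. incr c x s v w)"
    by (intro sum.mono_neutral_right) (auto intro!: incr_eq_0 dest: labels_uptoD)
  then show ?thesis by (simp add: Phi_def PhiI_def)
qed

text \<open>Finitely many particles fit into one truncation, which then loses no children, so
  nothing is frozen.\<close>

lemma PhiI_eq:
  assumes t: "0 \<le> t" and fin: "finite (present t w)"
  shows "PhiI c x t w = exp (- alpha * t) * (\<Sum>v\<in>living t w. place c x t w v)"
proof -
  have "present t w \<subseteq> labels" by (auto simp: present_def)
  then obtain n where n: "present t w \<subseteq> labels_upto n" using finite_subset_labels_upto[OF fin] by blast
  have "frozen n t w = {}"
  proof -
    have K: "v @ [i] \<in> labels_upto n \<inter> present t w"
      if v: "v \<in> labels_upto n" "v \<in> present t w" "v \<notin> living t w" and i: "i \<in> {1..children (w v)}" for v i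
    proof -
      have "v @ [i] \<in> present t w"
        using v i by (auto simp: present_def living_def labels_append)
      then show ?thesis using n by auto
    qed
    show ?thesis
    proof (rule equals0I)
      fix u assume "u \<in> frozen n t w"
      then obtain v i where "u = v @ [i]" "v \<in> labels_upto n" "v \<in> present t w" "v \<notin> living t w" "i \<in> {1..children (w v)}"
        and u: "u \<notin> labels_upto n \<inter> present t w"
        unfolding frozen_def by fast
      then show False using K by meson
    qed
  qed
  moreover have "labels_upto n \<inter> living t w = living t w" using n living_present by blast
  ultimately have "Phi c x (labels_upto n) t w = (\<Sum>v\<in>living t w. exp (- alpha * t) * place c x t w v)"
    unfolding Phi_telescope[OF t] by simp
  then show ?thesis using Phi_eq_PhiI[OF n order_refl] by (simp only: sum_distrib_left)
qed

text \<open>Non-explosion: with \<open>c\<close> and \<open>x\<close> zero, the Lyapunov function of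
  an existing particle is the discount at rate \<open>3 * alpha / 2\<close> up to its birth. The sum
  over the tree has finite mean, and each particle born by \<open>t\<close> contributes at least the
  fixed amount \<open>exp (- (3 * alpha / 2) * t)\<close>.\<close>

lemma AE_finite_present: "AE w in Q. \<forall>t. finite (present t w)"
proof -
  obtain C where C: "C \<ge> 0" "\<And>n. (\<Sum>u\<in>labels_upto n. \<integral>\<^sup>+w. ennreal (lyapunov 1 0 0 u w) \<partial>Q) \<le> ennreal C"
    using sum_lyapunov_bounded[of 0 0] by meson
  let ?f = "\<lambda>n w. \<Sum>u\<in>labels_upto n. ennreal (lyapunov 1 0 0 u w)"
  have lm: "(\<lambda>w. ennreal (lyapunov 1 0 0 u w)) \<in> borel_measurable Q" if "u \<in> labels_upto n" for u n
    by (rule measurable_compose[OF lyapunov_measurable[OF labels_uptoD[OF that]] measurable_ennreal])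
  have fm: "?f n \<in> borel_measurable Q" for n
    by (rule borel_measurable_sum) (rule lm)
  have inc: "incseq ?f"
    by (intro incseq_SucI le_funI sum_mono2 labels_upto_mono) auto
  have "(\<integral>\<^sup>+w. (SUP n. ?f n w) \<partial>Q) = (SUP n. \<integral>\<^sup>+w. ?f n w \<partial>Q)"
    by (rule nn_integral_monotone_convergence_SUP[OF inc fm])
  also have "\<dots> \<le> ennreal C"
  proof (rule SUP_least)
    fix n
    have "(\<integral>\<^sup>+w. ?f n w \<partial>Q) = (\<Sum>u\<in>labels_upto n. \<integral>\<^sup>+w. ennreal (lyapunov 1 0 0 u w) \<partial>Q)"
      by (rule nn_integral_sum) (rule lm)
    then show "(\<integral>\<^sup>+w. ?f n w \<partial>Q) \<le> ennreal C" using C(2) by simp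
  qed
  finally have "(\<integral>\<^sup>+w. (SUP n. ?f n w) \<partial>Q) \<noteq> \<infinity>"
    unfolding infinity_ennreal_def by (rule neq_top_trans[OF ennreal_neq_top])
  then have "AE w in Q. (SUP n. ?f n w) \<noteq> \<infinity>"
    by (intro nn_integral_noteq_infinite borel_measurable_SUP) (auto intro: fm)
  then show ?thesis
  proof eventually_elim
    case (elim w)
    then obtain B where B: "0 \<le> B" "(SUP n. ?f n w) = ennreal B" by (cases "SUP n. ?f n w") auto
    show ?case
    proof
      fix t
      let ?e = "exp (- (3 * alpha / 2) * t)"
      have "card S \<le> nat \<lceil>B / ?e\<rceil>" if S: "S \<subseteq> present t w" "finite S" for S
      proof -
        have "S \<subseteq> labels" using S(1) by (auto simp: present_def)
        then obtain n where n: "S \<subseteq> labels_upto n" using finite_subset_labels_upto[OF S(2)] by blast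
        have "ennreal (real (card S) * ?e) = (\<Sum>u\<in>S. ennreal ?e)"
          by (simp add: ennreal_mult ennreal_of_nat_eq_real_of_nat)
        also have "\<dots> \<le> (\<Sum>u\<in>S. ennreal (lyapunov 1 0 0 u w))"
        proof (intro sum_mono ennreal_leI)
          fix u assume "u \<in> S"
          then have "born w u" "birth w u \<le> t" using S(1) by (auto simp: present_def)
          then show "?e \<le> lyapunov 1 0 0 u w" using alpha_pos by (simp add: lyapunov_def score_def)
        qed
        also have "\<dots> \<le> ?f n w" by (rule sum_mono2[OF _ n]) auto
        also have "\<dots> \<le> ennreal B" unfolding B(2)[symmetric] by (rule SUP_upper) simp
        finally have "real (card S) * ?e \<le> B" using B(1) by (simp only: ennreal_le_iff)
        then have "real (card S) \<le> B / ?e" by (simp add: pos_le_divide_eq)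
        then show ?thesis by linarith
      qed
      then show "finite (present t w)" using finite_if_finite_subsets_card_bdd by meson
    qed
  qed
qed

text \<open>One index \<open>n\<close> serves both as truncation and as dyadic resolution, and the
  Borel-Cantelli lemma is applied to the lower limits \<open>L k\<close> in \<open>n\<close>. A
  point outside \<open>L k\<close> lies outside \<open>E k n\<close> for arbitrarily large
  \<open>n\<close>; there the truncation is exact and the grid contains any given dyadic
  grid.\<close>

lemma AE_oscillation:
  "AE w in Q. \<exists>k0. \<forall>k\<ge>k0. \<forall>q j. j \<le> 2 ^ q \<longrightarrow>
     \<bar>PhiI c x (real k + real j / 2 ^ q) w - PhiI c x (real k) w\<bar> \<le> exp (- (alpha / 8) * real k)"
proof -
  obtain C where C: "C \<ge> 0" "\<And>n (p::nat) \<tau> \<epsilon>. 0 \<le> \<tau> 0 \<Longrightarrow> (\<forall>i j. i \<le> j \<longrightarrow> \<tau> i \<le> \<tau> j) \<Longrightarrow> 0 < \<epsilon> \<Longrightarrow>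
     Q.P.prob {w \<in> space Q. \<exists>j\<le>p. \<epsilon> < \<bar>Phi c x (labels_upto n) (\<tau> j) w - Phi c x (labels_upto n) (\<tau> 0) w\<bar>}
       \<le> C * exp (- (alpha / 2) * \<tau> 0) / \<epsilon>\<^sup>2"
    using Phi_maximal[of c x] by meson
  \<comment> \<open>The square of the threshold decays at rate \<open>alpha / 4\<close>. Dividing
    the variance bound of rate \<open>alpha / 2\<close> by it leaves a summable rate
    \<open>alpha / 4\<close>, and the thresholds themselves are summable.\<close>
  define \<epsilon> where "\<epsilon> k = exp (- (alpha / 8) * real k)" for k :: nat
  define E where "E k n = {w \<in> space Q. \<exists>j\<le>2 ^ n. \<epsilon> k < \<bar>Phi c x (labels_upto n) (real k + real j / 2 ^ n) w - Phi c x (labels_upto n) (real k) w\<bar>}" for k n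
  have Em: "E k n \<in> sets Q" for k n
  proof -
    have "E k n = (\<Union>j\<in>{..2 ^ n}. {w \<in> space Q. \<epsilon> k < \<bar>Phi c x (labels_upto n) (real k + real j / 2 ^ n) w - Phi c x (labels_upto n) (real k) w\<bar>})"
      by (auto simp: E_def)
    also have "\<dots> \<in> sets Q"
      by (intro sets.finite_UN borel_measurable_less borel_measurable_const borel_measurable_abs borel_measurable_diff Phi_measurable labels_upto_subset) simp
    finally show ?thesis .
  qed
  have Ep: "Q.P.prob (E k n) \<le> C * exp (- (alpha / 4) * real k)" for k n
  proof -
    have "Q.P.prob (E k n) \<le> C * exp (- (alpha / 2) * real k) / (\<epsilon> k)\<^sup>2"
      using C(2)[of "\<lambda>j. real k + real j / 2 ^ n" "\<epsilon> k" "2 ^ n" n]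
      by (simp add: E_def \<epsilon>_def divide_right_mono)
    also have "\<dots> = C * (exp (- (alpha / 2) * real k) / (\<epsilon> k)\<^sup>2)" by simp
    also have "exp (- (alpha / 2) * real k) / (\<epsilon> k)\<^sup>2 = exp (- (alpha / 4) * real k)"
      unfolding \<epsilon>_def exp_double[symmetric] exp_diff[symmetric] by (rule arg_cong[where f = exp]) (simp add: field_simps)
    finally show ?thesis .
  qed
  define L where "L k = (\<Union>m. \<Inter>n\<in>{m..}. E k n)" for k
  have Lm: "L k \<in> sets Q" for k unfolding L_def by (rule Q.P.prob_liminf_le(1)[OF Em Ep])
  have Lp: "Q.P.prob (L k) \<le> C * exp (- (alpha / 4) * real k)" for k
    unfolding L_def by (rule Q.P.prob_liminf_le(2)[OF Em Ep])
  have "summable (\<lambda>k. C * exp (- (alpha / 4)) ^ k)"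
    using alpha_pos by (intro summable_mult summable_geometric) simp
  moreover have "exp (- (alpha / 4)) ^ k = exp (- (alpha / 4) * real k)" for k
    by (simp add: exp_of_nat_mult[symmetric] mult.commute)
  ultimately have "summable (\<lambda>k. C * exp (- (alpha / 4) * real k))" by simp
  then have "summable (\<lambda>k. Q.P.prob (L k))"
    by (rule summable_comparison_test'[where N = 0]) (use Lp in simp)
  then have "AE w in Q. \<forall>\<^sub>F k in sequentially. w \<in> space Q - L k"
    by (intro borel_cantelli_AE1 Lm) (simp_all add: Q.P.emeasure_eq_measure)
  with AE_finite_present show ?thesis
  proof eventually_elim
    case (elim w)
    then obtain k0 where k0: "\<And>k. k0 \<le> k \<Longrightarrow> w \<in> space Q - L k" by (auto simp: eventually_sequentially)
    show ?case
    proof (intro exI[of _ k0] allI impI)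
      fix k q j :: nat assume k: "k0 \<le> k" and j: "j \<le> 2 ^ q"
      have "present (real k + 1) w \<subseteq> labels" by (auto simp: present_def)
      then obtain m where m: "present (real k + 1) w \<subseteq> labels_upto m"
        using finite_subset_labels_upto[of "present (real k + 1) w"] elim(1) by meson
      have "w \<notin> (\<Inter>n\<in>{max m q..}. E k n)" using k0[OF k] by (auto simp: L_def)
      then obtain n where n: "max m q \<le> n" "w \<notin> E k n" by auto
      have F: "present (real k + 1) w \<subseteq> labels_upto n" using m labels_upto_mono[of m n] n(1) by auto
      let ?t = "real k + real j / 2 ^ q"
      have jq: "real j / 2 ^ q \<le> 1" using j by (simp add: divide_le_eq_1)
      have t: "?t = real k + real (j * 2 ^ (n - q)) / 2 ^ n"
      proof -
        have p: "(2::real) ^ n = 2 ^ q * 2 ^ (n - q)" using n(1) by (simp add: power_add[symmetric])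
        show ?thesis unfolding p by simp
      qed
      have "j * 2 ^ (n - q) \<le> 2 ^ q * 2 ^ (n - q)" using j by (rule mult_right_mono) simp
      then have le: "j * 2 ^ (n - q) \<le> 2 ^ n" using n(1) by (simp add: power_add[symmetric])
      have "w \<in> space Q" using k0[OF k] by simp
      with n(2) le have "\<not> \<epsilon> k < \<bar>Phi c x (labels_upto n) ?t w - Phi c x (labels_upto n) (real k) w\<bar>"
        unfolding t E_def by blast
      moreover have "Phi c x (labels_upto n) ?t w = PhiI c x ?t w" by (rule Phi_eq_PhiI[OF F]) (use jq in simp)
      moreover have "Phi c x (labels_upto n) (real k) w = PhiI c x (real k) w" by (rule Phi_eq_PhiI[OF F]) simp
      ultimately show "\<bar>PhiI c x ?t w - PhiI c x (real k) w\<bar> \<le> exp (- (alpha / 8) * real k)"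
        by (simp only: \<epsilon>_def not_less)
    qed
  qed
qed

end

section \<open>Positivity of the limit on survival\<close>

context particle_law
begin

text \<open>For a particle not dead by \<open>s\<close>, the factor \<open>H\<close> is almost
  surely a function of its motion alone, hence independent of its lifetime and offspring. The same
  \<open>g\<close> serves every \<phi> vanishing on particles dead by \<open>s\<close>, so an
  integral of squared increments can be compared with one of survival and then translated back into
  \<open>H\<close>.\<close>

lemma nn_integral_adapted:
  assumes w: "w \<in> space Q" and u: "u \<in> labels"
    and H: "adapted s H" "H \<in> borel_measurable Q"
  obtains g where "g \<in> borel_measurable PZ"
    "\<And>\<phi>. (\<And>d. life d \<le> s - birth w u \<Longrightarrow> \<phi> d = 0) \<Longrightarrow>
      (\<integral>\<^sup>+d. \<phi> d * ennreal (H (w(u := d))) \<partial>P0) = (\<integral>\<^sup>+d. g (fst d) * \<phi> d \<partial>P0)"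
proof -
  define a where "a = s - birth w u"
  define g where "g z = ennreal (H (w(u := (stopped a z, max 0 a + 1, 0, \<lambda>_. 0))))" for z
  have "(\<lambda>z. (stopped a z, max 0 a + 1, 0, \<lambda>_. 0)) \<in> path_space \<rightarrow>\<^sub>M particle_space"
    by (intro measurable_Pair stopped_measurable measurable_const) (auto simp: space_pair_measure space_PiM)
  then have "(\<lambda>z. (stopped a z, max 0 a + 1, 0, \<lambda>_. 0)) \<in> PZ \<rightarrow>\<^sub>M P0"
    by (simp only: measurable_cong_sets[OF sets_PZ sets_P0])
  from measurable_compose[OF measurable_compose[OF measurable_compose[OF this upd_measurable[OF u w]] H(2)] measurable_ennreal]
  have gm: "g \<in> borel_measurable PZ" unfolding g_def .
  have ad: "AE d in P0. s < birth w u + life d \<longrightarrow> H (w(u := d)) = H (w(u := stop_particle (s - birth w u) d))"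
    using H(1) w u unfolding adapted_def by meson
  have "(\<integral>\<^sup>+d. \<phi> d * ennreal (H (w(u := d))) \<partial>P0) = (\<integral>\<^sup>+d. g (fst d) * \<phi> d \<partial>P0)"
    if \<phi>: "\<And>d. life d \<le> s - birth w u \<Longrightarrow> \<phi> d = 0" for \<phi>
  proof (rule nn_integral_cong_AE)
    show "AE d in P0. \<phi> d * ennreal (H (w(u := d))) = g (fst d) * \<phi> d"
      using ad
    proof eventually_elim
      case (elim d)
      show ?case
      proof (cases "s < birth w u + life d")
        case True
        then have "H (w(u := d)) = H (w(u := stop_particle (s - birth w u) d))" using elim by (rule mp[rotated])
        then have "ennreal (H (w(u := d))) = g (fst d)" by (simp only: g_def stop_particle_def a_def)
        then show ?thesis by (simp only: mult.commute)
      next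
        case False
        then have "\<phi> d = 0" by (intro \<phi>) simp
        then show ?thesis by simp
      qed
    qed
  qed
  then show thesis by (rule that[OF gm])
qed

text \<open>Weights the particles not dead by \<open>s\<close>, whose terms can still change. Those
  alive at \<open>s\<close> and those born later are separated in
  \<open>reach_split\<close>.\<close>

definition reach :: "real \<Rightarrow> nat list \<Rightarrow> (nat list \<Rightarrow> particle) \<Rightarrow> ennreal" where
  "reach s u w = (if born w u \<and> s < birth w u + life (w u) then ennreal (exp (- (2 * alpha) * max (birth w u) s)) else 0)"

definition alive_weight :: "real \<Rightarrow> nat list \<Rightarrow> (nat list \<Rightarrow> particle) \<Rightarrow> ennreal" where
  "alive_weight s u w = (if born w u \<and> birth w u \<le> s \<and> s < birth w u + life (w u) then ennreal (exp (- (2 * alpha) * s)) else 0)"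

definition later_weight :: "real \<Rightarrow> nat list \<Rightarrow> (nat list \<Rightarrow> particle) \<Rightarrow> ennreal" where
  "later_weight s u w = (if born w u \<and> s < birth w u then ennreal (exp (- (2 * alpha) * birth w u)) else 0)"

lemma reach_split: "reach s u w = later_weight s u w + alive_weight s u w"
proof -
  consider "birth w u \<le> s" "\<not> s < birth w u" "max (birth w u) s = s"
    | "\<not> birth w u \<le> s" "s < birth w u" "max (birth w u) s = birth w u" "s < birth w u + life (w u)"
    using life_nonneg[of "w u"] by linarith
  then show ?thesis
    by cases (simp_all only: reach_def later_weight_def alive_weight_def if_True if_False simp_thms add_0_left add_0_right)
qed

lemma life_component_measurable: "u \<in> labels \<Longrightarrow> (\<lambda>w. life (w u)) \<in> borel_measurable Q"
  by (rule measurable_compose[OF component_measurable_space life_measurable])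

lemma weights_measurable:
  assumes u: "u \<in> labels"
  shows "reach s u \<in> borel_measurable Q" "alive_weight s u \<in> borel_measurable Q" "later_weight s u \<in> borel_measurable Q"
proof -
  note [measurable] = birth_measurable[OF u] born_measurable[OF u] life_component_measurable[OF u]
  show "reach s u \<in> borel_measurable Q" unfolding reach_def[abs_def] by measurable
  show "alive_weight s u \<in> borel_measurable Q" unfolding alive_weight_def[abs_def] by measurable
  show "later_weight s u \<in> borel_measurable Q" unfolding later_weight_def[abs_def] by measurable
qed

lemma reach_upd:
  "reach s u (w(u := d)) = (if born w u then ennreal (exp (- (2 * alpha) * max (birth w u) s)) * indicator {s - birth w u<..} (life d) else 0)"
  by (auto simp: reach_def born_upd birth_upd split: split_indicator)

lemma exp_max_split: "exp (- (2 * alpha) * b) * exp (- (2 * alpha) * max 0 (s - b)) = exp (- (2 * alpha) * max b s)"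
proof -
  have "b + max 0 (s - b) = max b s" by (simp add: max_def)
  then show ?thesis unfolding exp_add[symmetric] distrib_left[symmetric] by simp
qed

text \<open>A conditional second moment: given the history up to \<open>s\<close>, the increment of
  a particle is at most of order its squared discount, and zero if it is dead. The adapted factor
  becomes a function of the motion, as \<open>nn_integral_innov_count\<close> demands.\<close>

lemma nn_integral_dinc_count:
  assumes u: "u \<in> labels" and st: "s \<le> t"
    and H: "adapted s H" "H \<in> borel_measurable Q"
  shows "(\<integral>\<^sup>+w. ennreal ((dinc 0 1 s t u w)\<^sup>2) * ennreal (H w) \<partial>Q) \<le>
    ennreal (\<integral>p. (1 + real (fst p))\<^sup>2 \<partial>PO) * (\<integral>\<^sup>+w. reach s u w * ennreal (H w) \<partial>Q)"
proof -
  let ?C = "\<integral>p. (1 + real (fst p))\<^sup>2 \<partial>PO"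
  have C0: "0 \<le> ?C" by (rule Bochner_Integration.integral_nonneg) simp
  have Hm: "(\<lambda>w. ennreal (H w)) \<in> borel_measurable Q" by (rule measurable_compose[OF H(2) measurable_ennreal])
  have dm: "(\<lambda>w. ennreal ((dinc 0 1 s t u w)\<^sup>2) * ennreal (H w)) \<in> borel_measurable Q"
    by (rule borel_measurable_times_ennreal[OF measurable_compose[OF borel_measurable_power[OF dinc_measurable[OF u]] measurable_ennreal] Hm])
  have rm: "(\<lambda>w. reach s u w * ennreal (H w)) \<in> borel_measurable Q"
    by (rule borel_measurable_times_ennreal[OF weights_measurable(1)[OF u] Hm])
  have inner: "(\<integral>\<^sup>+d. ennreal ((dinc 0 1 s t u (w(u := d)))\<^sup>2) * ennreal (H (w(u := d))) \<partial>P0) \<le>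
      ennreal ?C * (\<integral>\<^sup>+d. reach s u (w(u := d)) * ennreal (H (w(u := d))) \<partial>P0)" if w: "w \<in> space Q" for w
  proof (cases "born w u")
    case False then show ?thesis by (simp add: dinc_upd_self)
  next
    case True
    define b where "b = birth w u"
    obtain g where g: "g \<in> borel_measurable PZ"
      and ad: "\<And>\<phi>. (\<And>d. life d \<le> s - birth w u \<Longrightarrow> \<phi> d = 0) \<Longrightarrow>
        (\<integral>\<^sup>+d. \<phi> d * ennreal (H (w(u := d))) \<partial>P0) = (\<integral>\<^sup>+d. g (fst d) * \<phi> d \<partial>P0)"
    proof (rule nn_integral_adapted[OF w u H])
      fix g assume 1: "g \<in> borel_measurable PZ"
        and 2: "\<And>\<phi>. (\<And>d. life d \<le> s - birth w u \<Longrightarrow> \<phi> d = 0) \<Longrightarrow>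
          (\<integral>\<^sup>+d. \<phi> d * ennreal (H (w(u := d))) \<partial>P0) = (\<integral>\<^sup>+d. g (fst d) * \<phi> d \<partial>P0)"
      show thesis by (rule that[OF 1 2])
    qed
    have y: "score drift 0 1 w u = 1" by (simp add: score_def)
    have gm: "(\<lambda>d. g (fst d)) \<in> borel_measurable P0" by (rule measurable_compose[OF measurable_fst g])
    have im: "(\<lambda>d. innov 0 r 1 d) \<in> borel_measurable P0" for r
      by (rule innov_measurable_raw) (auto simp: measurable_cong_sets[OF sets_P0 refl])
    have lm: "(\<lambda>d. indicator {s - b<..} (life d) :: ennreal) \<in> borel_measurable P0"
      using measurable_compose[OF life_measurable borel_measurable_indicator[of "{s - b<..}" borel]]
      by (simp add: measurable_cong_sets[OF sets_P0 refl])
    let ?i = "\<lambda>d. ennreal ((innov 0 (t - b) 1 d - innov 0 (s - b) 1 d)\<^sup>2)"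
    have sq: "ennreal ((dinc 0 1 s t u (w(u := d)))\<^sup>2) = ennreal (exp (- (2 * alpha) * b)) * ?i d" for d
    proof -
      have "(exp (- alpha * b))\<^sup>2 = exp (- (2 * alpha) * b)" by (simp add: exp_double[symmetric])
      then have "(dinc 0 1 s t u (w(u := d)))\<^sup>2 = exp (- (2 * alpha) * b) * (innov 0 (t - b) 1 d - innov 0 (s - b) 1 d)\<^sup>2"
        using True unfolding dinc_upd_self y b_def[symmetric] by (simp only: if_True power_mult_distrib)
      then show ?thesis by (simp only: ennreal_mult'[OF exp_ge_zero])
    qed
    have "(\<integral>\<^sup>+d. ennreal ((dinc 0 1 s t u (w(u := d)))\<^sup>2) * ennreal (H (w(u := d))) \<partial>P0) =
        (\<integral>\<^sup>+d. g (fst d) * ennreal ((dinc 0 1 s t u (w(u := d)))\<^sup>2) \<partial>P0)"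
    proof (rule ad)
      fix d assume d: "life d \<le> s - birth w u"
      then have "innov 0 (t - b) 1 d = innov 0 (s - b) 1 d"
      proof -
        have "\<not> s - b < life d" "\<not> t - b < life d" "\<not> s - b < 0" "\<not> t - b < 0"
          using d st life_nonneg[of d] unfolding b_def by linarith+
        then show ?thesis by (simp only: innov_def contrib_def if_False)
      qed
      then show "ennreal ((dinc 0 1 s t u (w(u := d)))\<^sup>2) = 0" unfolding sq by simp
    qed
    also have "\<dots> = (\<integral>\<^sup>+d. ennreal (exp (- (2 * alpha) * b)) * (g (fst d) * ?i d) \<partial>P0)"
      unfolding sq by (simp only: mult.left_commute)
    also have "\<dots> = ennreal (exp (- (2 * alpha) * b)) * (\<integral>\<^sup>+d. g (fst d) * ?i d \<partial>P0)"
      by (rule nn_integral_cmult, rule borel_measurable_times_ennreal[OF gm measurable_compose[OF borel_measurable_power[OF borel_measurable_diff[OF im im]] measurable_ennreal]])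
    also have "\<dots> \<le> ennreal (exp (- (2 * alpha) * b)) *
        (ennreal (?C * exp (- (2 * alpha) * max 0 (s - b))) * (\<integral>\<^sup>+d. g (fst d) * indicator {s - b<..} (life d) \<partial>P0))"
    proof (rule mult_left_mono)
      show "(\<integral>\<^sup>+d. g (fst d) * ?i d \<partial>P0) \<le>
          ennreal (?C * exp (- (2 * alpha) * max 0 (s - b))) * (\<integral>\<^sup>+d. g (fst d) * indicator {s - b<..} (life d) \<partial>P0)"
      proof (cases "0 \<le> t - b")
        case True then show ?thesis using st by (intro nn_integral_innov_count[OF g]) auto
      next
        case False then show ?thesis using st by (simp add: innov_def)
      qed
    qed simp
    also have "(\<integral>\<^sup>+d. g (fst d) * indicator {s - b<..} (life d) \<partial>P0) = (\<integral>\<^sup>+d. indicator {s - b<..} (life d) * ennreal (H (w(u := d))) \<partial>P0)"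
      by (rule ad[symmetric]) (simp add: b_def)
    also have "ennreal (exp (- (2 * alpha) * b)) * (ennreal (?C * exp (- (2 * alpha) * max 0 (s - b))) * (\<integral>\<^sup>+d. indicator {s - b<..} (life d) * ennreal (H (w(u := d))) \<partial>P0)) =
        ennreal ?C * (ennreal (exp (- (2 * alpha) * max b s)) * (\<integral>\<^sup>+d. indicator {s - b<..} (life d) * ennreal (H (w(u := d))) \<partial>P0))"
      unfolding exp_max_split[of b s, symmetric] ennreal_mult'[OF C0] ennreal_mult'[OF exp_ge_zero] by (simp only: mult_ac)
    also have "ennreal (exp (- (2 * alpha) * max b s)) * (\<integral>\<^sup>+d. indicator {s - b<..} (life d) * ennreal (H (w(u := d))) \<partial>P0) =
        (\<integral>\<^sup>+d. ennreal (exp (- (2 * alpha) * max b s)) * (indicator {s - b<..} (life d) * ennreal (H (w(u := d)))) \<partial>P0)"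
      by (rule nn_integral_cmult[symmetric], rule borel_measurable_times_ennreal[OF lm measurable_compose[OF upd_measurable[OF u w] Hm]])
    also have "\<dots> = (\<integral>\<^sup>+d. reach s u (w(u := d)) * ennreal (H (w(u := d))) \<partial>P0)"
      unfolding reach_upd b_def using True by (simp only: if_True mult.assoc)
    finally show ?thesis .
  qed
  have "(\<integral>\<^sup>+w. ennreal ((dinc 0 1 s t u w)\<^sup>2) * ennreal (H w) \<partial>Q) =
      (\<integral>\<^sup>+w. (\<integral>\<^sup>+d. ennreal ((dinc 0 1 s t u (w(u := d)))\<^sup>2) * ennreal (H (w(u := d))) \<partial>P0) \<partial>Q)"
    by (rule Q.nn_integral_resample[OF u dm])
  also have "\<dots> \<le> (\<integral>\<^sup>+w. ennreal ?C * (\<integral>\<^sup>+d. reach s u (w(u := d)) * ennreal (H (w(u := d))) \<partial>P0) \<partial>Q)"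
    by (rule nn_integral_mono) (rule inner)
  also have "\<dots> = ennreal ?C * (\<integral>\<^sup>+w. (\<integral>\<^sup>+d. reach s u (w(u := d)) * ennreal (H (w(u := d))) \<partial>P0) \<partial>Q)"
  proof (rule nn_integral_cmult)
    have "(\<lambda>p. (\<lambda>w. reach s u w * ennreal (H w)) ((\<lambda>(d, w). w(u := d)) (snd p, fst p))) \<in> borel_measurable (Q \<Otimes>\<^sub>M P0)"
      by (rule measurable_compose[OF measurable_compose[OF measurable_Pair[OF measurable_snd measurable_fst] Q.measurable_fun_upd_PiM[OF u]] rm])
    then have "case_prod (\<lambda>w d. reach s u (w(u := d)) * ennreal (H (w(u := d)))) \<in> borel_measurable (Q \<Otimes>\<^sub>M P0)"
      by (simp add: split_beta')
    then show "(\<lambda>w. \<integral>\<^sup>+d. reach s u (w(u := d)) * ennreal (H (w(u := d))) \<partial>P0) \<in> borel_measurable Q"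
      by (rule P0.borel_measurable_nn_integral)
  qed
  also have "(\<integral>\<^sup>+w. (\<integral>\<^sup>+d. reach s u (w(u := d)) * ennreal (H (w(u := d))) \<partial>P0) \<partial>Q) = (\<integral>\<^sup>+w. reach s u w * ennreal (H w) \<partial>Q)"
    by (rule Q.nn_integral_resample[OF u rm, symmetric])
  finally show ?thesis .
qed

text \<open>Children born after \<open>s\<close> have a parent not dead by \<open>s\<close>. By
  memorylessness their expected weight at rate \<open>2 * alpha\<close> is at most the ratio
  \<open>mean_children * lam / (lam + 2 * alpha)\<close>, which is less than 1, of the
  parent's.\<close>

lemma sum_later_weight:
  assumes u: "u \<in> labels" and H: "adapted s H" "H \<in> borel_measurable Q"
  shows "(\<Sum>i=1..n. \<integral>\<^sup>+w. later_weight s (u @ [i]) w * ennreal (H w) \<partial>Q) \<le>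
    ennreal (mean_children * lam / (lam + 2 * alpha)) * (\<integral>\<^sup>+w. reach s u w * ennreal (H w) \<partial>Q)"
proof -
  let ?\<rho> = "mean_children * lam / (lam + 2 * alpha)"
  have \<rho>0: "0 \<le> ?\<rho>" using mean_children_gt_1 lam_pos alpha_pos by simp
  have Hm: "(\<lambda>w. ennreal (H w)) \<in> borel_measurable Q" by (rule measurable_compose[OF H(2) measurable_ennreal])
  have ui: "u @ [i] \<in> labels" if "i \<in> {1..n}" for i using u that by (simp add: labels_append)
  have bm: "(\<lambda>w. later_weight s (u @ [i]) w * ennreal (H w)) \<in> borel_measurable Q" if "i \<in> {1..n}" for i
    by (rule borel_measurable_times_ennreal[OF weights_measurable(3)[OF ui[OF that]] Hm])
  have sm: "(\<lambda>w. \<Sum>i=1..n. later_weight s (u @ [i]) w * ennreal (H w)) \<in> borel_measurable Q"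
    by (rule borel_measurable_sum) (rule bm)
  have rm: "(\<lambda>w. reach s u w * ennreal (H w)) \<in> borel_measurable Q"
    by (rule borel_measurable_times_ennreal[OF weights_measurable(1)[OF u] Hm])
  have inner: "(\<integral>\<^sup>+d. (\<Sum>i=1..n. later_weight s (u @ [i]) (w(u := d)) * ennreal (H (w(u := d)))) \<partial>P0) \<le>
      ennreal ?\<rho> * (\<integral>\<^sup>+d. reach s u (w(u := d)) * ennreal (H (w(u := d))) \<partial>P0)" if w: "w \<in> space Q" for w
  proof (cases "born w u")
    case False then show ?thesis by (simp add: later_weight_def born_upd)
  next
    case True
    define b where "b = birth w u"
    obtain g where g: "g \<in> borel_measurable PZ"
      and ad: "\<And>\<phi>. (\<And>d. life d \<le> s - birth w u \<Longrightarrow> \<phi> d = 0) \<Longrightarrow>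
        (\<integral>\<^sup>+d. \<phi> d * ennreal (H (w(u := d))) \<partial>P0) = (\<integral>\<^sup>+d. g (fst d) * \<phi> d \<partial>P0)"
    proof (rule nn_integral_adapted[OF w u H])
      fix g assume 1: "g \<in> borel_measurable PZ"
        and 2: "\<And>\<phi>. (\<And>d. life d \<le> s - birth w u \<Longrightarrow> \<phi> d = 0) \<Longrightarrow>
          (\<integral>\<^sup>+d. \<phi> d * ennreal (H (w(u := d))) \<partial>P0) = (\<integral>\<^sup>+d. g (fst d) * \<phi> d \<partial>P0)"
      show thesis by (rule that[OF 1 2])
    qed
    have gm: "(\<lambda>d. g (fst d)) \<in> borel_measurable P0" by (rule measurable_compose[OF measurable_fst g])
    have lm: "(\<lambda>d. indicator {s - b<..} (life d) :: ennreal) \<in> borel_measurable P0"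
      using measurable_compose[OF life_measurable borel_measurable_indicator[of "{s - b<..}" borel]]
      by (simp add: measurable_cong_sets[OF sets_P0 refl])
    let ?\<phi> = "\<lambda>d. ennreal (exp (- (2 * alpha) * life d)) * indicator {s - b<..} (life d) * ennreal (real (children d))"
    have phim: "?\<phi> \<in> borel_measurable P0"
    proof -
      have "?\<phi> \<in> borel_measurable particle_space" by measurable
      then show ?thesis by (simp only: measurable_cong_sets[OF sets_P0 refl])
    qed
    have pw: "(\<Sum>i=1..n. later_weight s (u @ [i]) (w(u := d)) * ennreal (H (w(u := d)))) \<le>
        ennreal (exp (- (2 * alpha) * b)) * ?\<phi> d * ennreal (H (w(u := d)))" for d
    proof -
      have e: "exp (- (2 * alpha) * (b + life d)) = exp (- (2 * alpha) * b) * exp (- (2 * alpha) * life d)"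
        unfolding exp_add[symmetric] by (rule arg_cong[where f = exp]) (simp add: algebra_simps)
      let ?e = "ennreal (exp (- (2 * alpha) * (b + life d))) * indicator {s - b<..} (life d)"
      have "later_weight s (u @ [i]) (w(u := d)) = (if i \<le> children d then ?e else 0)" for i
        using True by (auto simp: later_weight_def born_upd birth_upd b_def split: split_indicator)
      then have "(\<Sum>i=1..n. later_weight s (u @ [i]) (w(u := d))) = (\<Sum>i=1..n. if i \<le> children d then ?e else 0)"
        by (simp only:)
      also have "\<dots> = (\<Sum>i\<in>{i\<in>{1..n}. i \<le> children d}. ?e)"
        by (rule sum.inter_filter[symmetric]) simp
      also have "\<dots> \<le> (\<Sum>i=1..children d. ?e)"
        by (rule sum_mono2) auto
      also have "\<dots> = ?e * ennreal (real (children d))"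
        by (simp add: ennreal_of_nat_eq_real_of_nat mult.commute)
      also have "\<dots> = ennreal (exp (- (2 * alpha) * b)) * ?\<phi> d"
        unfolding e ennreal_mult'[OF exp_ge_zero] by (simp only: mult.assoc)
      finally show ?thesis unfolding sum_distrib_right[symmetric] by (rule mult_right_mono) simp
    qed
    have "(\<integral>\<^sup>+d. (\<Sum>i=1..n. later_weight s (u @ [i]) (w(u := d)) * ennreal (H (w(u := d)))) \<partial>P0) \<le>
        (\<integral>\<^sup>+d. (ennreal (exp (- (2 * alpha) * b)) * ?\<phi> d) * ennreal (H (w(u := d))) \<partial>P0)"
      by (rule nn_integral_mono) (rule pw)
    also have "\<dots> = (\<integral>\<^sup>+d. g (fst d) * (ennreal (exp (- (2 * alpha) * b)) * ?\<phi> d) \<partial>P0)"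
      by (rule ad) (simp add: b_def)
    also have "\<dots> = (\<integral>\<^sup>+d. ennreal (exp (- (2 * alpha) * b)) * (g (fst d) * ?\<phi> d) \<partial>P0)"
      by (simp only: mult.left_commute)
    also have "\<dots> = ennreal (exp (- (2 * alpha) * b)) * (\<integral>\<^sup>+d. g (fst d) * ?\<phi> d \<partial>P0)"
      by (rule nn_integral_cmult, rule borel_measurable_times_ennreal[OF gm phim])
    also have "(\<integral>\<^sup>+d. g (fst d) * ?\<phi> d \<partial>P0) = ennreal (?\<rho> * exp (- (2 * alpha) * max 0 (s - b))) * (\<integral>\<^sup>+d. g (fst d) * indicator {s - b<..} (life d) \<partial>P0)"
      by (rule nn_integral_offspring_gt[OF g]) (use alpha_pos in simp)
    also have "(\<integral>\<^sup>+d. g (fst d) * indicator {s - b<..} (life d) \<partial>P0) = (\<integral>\<^sup>+d. indicator {s - b<..} (life d) * ennreal (H (w(u := d))) \<partial>P0)"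
      by (rule ad[symmetric]) (simp add: b_def)
    also have "ennreal (exp (- (2 * alpha) * b)) * (ennreal (?\<rho> * exp (- (2 * alpha) * max 0 (s - b))) * (\<integral>\<^sup>+d. indicator {s - b<..} (life d) * ennreal (H (w(u := d))) \<partial>P0)) =
        ennreal ?\<rho> * (ennreal (exp (- (2 * alpha) * max b s)) * (\<integral>\<^sup>+d. indicator {s - b<..} (life d) * ennreal (H (w(u := d))) \<partial>P0))"
      unfolding exp_max_split[of b s, symmetric] ennreal_mult'[OF \<rho>0] ennreal_mult'[OF exp_ge_zero] by (simp only: mult_ac)
    also have "ennreal (exp (- (2 * alpha) * max b s)) * (\<integral>\<^sup>+d. indicator {s - b<..} (life d) * ennreal (H (w(u := d))) \<partial>P0) =
        (\<integral>\<^sup>+d. ennreal (exp (- (2 * alpha) * max b s)) * (indicator {s - b<..} (life d) * ennreal (H (w(u := d)))) \<partial>P0)"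
      by (rule nn_integral_cmult[symmetric], rule borel_measurable_times_ennreal[OF lm measurable_compose[OF upd_measurable[OF u w] Hm]])
    also have "\<dots> = (\<integral>\<^sup>+d. reach s u (w(u := d)) * ennreal (H (w(u := d))) \<partial>P0)"
      unfolding reach_upd b_def using True by (simp only: if_True mult.assoc)
    finally show ?thesis .
  qed
  have "(\<Sum>i=1..n. \<integral>\<^sup>+w. later_weight s (u @ [i]) w * ennreal (H w) \<partial>Q) = (\<integral>\<^sup>+w. (\<Sum>i=1..n. later_weight s (u @ [i]) w * ennreal (H w)) \<partial>Q)"
    by (rule nn_integral_sum[symmetric]) (rule bm)
  also have "\<dots> = (\<integral>\<^sup>+w. (\<integral>\<^sup>+d. (\<Sum>i=1..n. later_weight s (u @ [i]) (w(u := d)) * ennreal (H (w(u := d)))) \<partial>P0) \<partial>Q)"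
    by (rule Q.nn_integral_resample[OF u sm])
  also have "\<dots> \<le> (\<integral>\<^sup>+w. ennreal ?\<rho> * (\<integral>\<^sup>+d. reach s u (w(u := d)) * ennreal (H (w(u := d))) \<partial>P0) \<partial>Q)"
    by (rule nn_integral_mono) (rule inner)
  also have "\<dots> = ennreal ?\<rho> * (\<integral>\<^sup>+w. (\<integral>\<^sup>+d. reach s u (w(u := d)) * ennreal (H (w(u := d))) \<partial>P0) \<partial>Q)"
  proof (rule nn_integral_cmult)
    have "(\<lambda>p. (\<lambda>w. reach s u w * ennreal (H w)) ((\<lambda>(d, w). w(u := d)) (snd p, fst p))) \<in> borel_measurable (Q \<Otimes>\<^sub>M P0)"
      by (rule measurable_compose[OF measurable_compose[OF measurable_Pair[OF measurable_snd measurable_fst] Q.measurable_fun_upd_PiM[OF u]] rm])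
    then have "case_prod (\<lambda>w d. reach s u (w(u := d)) * ennreal (H (w(u := d)))) \<in> borel_measurable (Q \<Otimes>\<^sub>M P0)"
      by (simp add: split_beta')
    then show "(\<lambda>w. \<integral>\<^sup>+d. reach s u (w(u := d)) * ennreal (H (w(u := d))) \<partial>P0) \<in> borel_measurable Q"
      by (rule P0.borel_measurable_nn_integral)
  qed
  also have "(\<integral>\<^sup>+w. (\<integral>\<^sup>+d. reach s u (w(u := d)) * ennreal (H (w(u := d))) \<partial>P0) \<partial>Q) = (\<integral>\<^sup>+w. reach s u w * ennreal (H w) \<partial>Q)"
    by (rule Q.nn_integral_resample[OF u rm, symmetric])
  finally show ?thesis .
qed

text \<open>Particles born after \<open>s\<close> form a subcritical weighted tree over those alive
  at \<open>s\<close>, so their total weight is at most a constant multiple of the weight of the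
  latter. The variance after \<open>s\<close>, given the history, is thus controlled by the number
  living at \<open>s\<close>.\<close>

lemma conditional_variance:
  "\<exists>C\<ge>0. \<forall>n s t H B. 0 \<le> s \<longrightarrow> s \<le> t \<longrightarrow> adapted s H \<longrightarrow> H \<in> borel_measurable Q \<longrightarrow> (\<forall>w. 0 \<le> H w \<and> H w \<le> B) \<longrightarrow>
     (\<Sum>u\<in>labels_upto n. \<integral>\<^sup>+w. ennreal ((dinc 0 1 s t u w)\<^sup>2) * ennreal (H w) \<partial>Q) \<le>
     ennreal C * (\<integral>\<^sup>+w. ennreal (exp (- (2 * alpha) * s) * real (card (labels_upto n \<inter> living s w)) * H w) \<partial>Q)"
proof -
  define C where "C = (\<integral>p. (1 + real (fst p))\<^sup>2 \<partial>PO)"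
  have C: "0 \<le> C" unfolding C_def by (rule Bochner_Integration.integral_nonneg) simp
  define \<rho> where "\<rho> = mean_children * lam / (lam + 2 * alpha)"
  have \<rho>: "0 \<le> \<rho>" "\<rho> < 1"
    using mean_children_gt_1 lam_pos alpha_pos offspring_ratio_lt_1[of "2 * alpha"] by (auto simp: \<rho>_def)
  have main: "(\<Sum>u\<in>labels_upto n. \<integral>\<^sup>+w. ennreal ((dinc 0 1 s t u w)\<^sup>2) * ennreal (H w) \<partial>Q) \<le>
     ennreal (C * (1 / (1 - \<rho>) + 1)) * (\<integral>\<^sup>+w. ennreal (exp (- (2 * alpha) * s) * real (card (labels_upto n \<inter> living s w)) * H w) \<partial>Q)"
    if s: "0 \<le> s" and st: "s \<le> t" and H: "adapted s H" "H \<in> borel_measurable Q" "\<And>w. 0 \<le> H w \<and> H w \<le> B" for n s t H B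
  proof -
    let ?F = "labels_upto n"
    have Hm: "(\<lambda>w. ennreal (H w)) \<in> borel_measurable Q" by (rule measurable_compose[OF H(2) measurable_ennreal])
    define \<beta> where "\<beta> u = (\<integral>\<^sup>+w. later_weight s u w * ennreal (H w) \<partial>Q)" for u
    define \<eta> where "\<eta> u = (\<integral>\<^sup>+w. alive_weight s u w * ennreal (H w) \<partial>Q)" for u
    have am: "(\<lambda>w. alive_weight s u w * ennreal (H w)) \<in> borel_measurable Q" if "u \<in> ?F" for u
      by (rule borel_measurable_times_ennreal[OF weights_measurable(2)[OF labels_uptoD[OF that]] Hm])
    have reach: "(\<integral>\<^sup>+w. reach s u w * ennreal (H w) \<partial>Q) = \<beta> u + \<eta> u" if u: "u \<in> ?F" for u
      unfolding \<beta>_def \<eta>_def reach_split distrib_right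
      by (rule nn_integral_add[OF borel_measurable_times_ennreal[OF weights_measurable(3)[OF labels_uptoD[OF u]] Hm] am[OF u]])
    \<comment> \<open>Later births are the unknown of the recursion and the particles alive at
      \<open>s\<close> its source. The root is born at time 0 and so has no later weight.\<close>
    have "(\<Sum>u\<in>?F. \<beta> u) \<le> ennreal (1 / (1 - \<rho>)) * (\<beta> [] + (\<Sum>u\<in>?F. \<eta> u))"
    proof (rule sum_labels_upto_le[OF _ \<rho>])
      show "(\<Sum>i=1..n. \<beta> (u @ [i])) \<le> ennreal \<rho> * (\<beta> u + \<eta> u)" if "u \<in> ?F" for u
        unfolding reach[OF that, symmetric] \<rho>_def unfolding \<beta>_def
        by (rule sum_later_weight[OF labels_uptoD[OF that] H(1,2)])
      have "\<beta> [] = 0" using s by (simp add: \<beta>_def later_weight_def)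
      then show "\<beta> [] < \<infinity>" by simp
      fix u assume "u \<in> ?F"
      have "\<eta> u \<le> (\<integral>\<^sup>+w. ennreal B \<partial>Q)"
        unfolding \<eta>_def
      proof (rule nn_integral_mono)
        fix w
        have "alive_weight s u w \<le> 1"
          using s alpha_pos by (auto simp: alive_weight_def)
        then have "alive_weight s u w * ennreal (H w) \<le> 1 * ennreal B"
          using H(3) by (intro mult_mono ennreal_leI) auto
        then show "alive_weight s u w * ennreal (H w) \<le> ennreal B" by simp
      qed
      also have "\<dots> < \<infinity>" by (simp add: Q.P.emeasure_space_1)
      finally show "\<eta> u < \<infinity>" .
    qed
    moreover have "\<beta> [] = 0" using s by (simp add: \<beta>_def later_weight_def)
    ultimately have sum\<beta>: "(\<Sum>u\<in>?F. \<beta> u) \<le> ennreal (1 / (1 - \<rho>)) * (\<Sum>u\<in>?F. \<eta> u)" by simp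
    have "(\<Sum>u\<in>?F. \<integral>\<^sup>+w. ennreal ((dinc 0 1 s t u w)\<^sup>2) * ennreal (H w) \<partial>Q) \<le> (\<Sum>u\<in>?F. ennreal C * (\<beta> u + \<eta> u))"
    proof (rule sum_mono)
      fix u assume u: "u \<in> ?F"
      show "(\<integral>\<^sup>+w. ennreal ((dinc 0 1 s t u w)\<^sup>2) * ennreal (H w) \<partial>Q) \<le> ennreal C * (\<beta> u + \<eta> u)"
        unfolding reach[OF u, symmetric] C_def by (rule nn_integral_dinc_count[OF labels_uptoD[OF u] st H(1,2)])
    qed
    also have "\<dots> = ennreal C * ((\<Sum>u\<in>?F. \<beta> u) + (\<Sum>u\<in>?F. \<eta> u))"
      by (simp only: sum_distrib_left[symmetric] sum.distrib)
    also have "\<dots> \<le> ennreal C * (ennreal (1 / (1 - \<rho>)) * (\<Sum>u\<in>?F. \<eta> u) + 1 * (\<Sum>u\<in>?F. \<eta> u))"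
      by (intro mult_left_mono add_mono sum\<beta>) auto
    also have "\<dots> = ennreal C * ((ennreal (1 / (1 - \<rho>)) + ennreal 1) * (\<Sum>u\<in>?F. \<eta> u))"
      by (simp only: distrib_right ennreal_1)
    also have "ennreal (1 / (1 - \<rho>)) + ennreal 1 = ennreal (1 / (1 - \<rho>) + 1)"
      by (rule ennreal_plus[symmetric]) (use \<rho> in auto)
    also have "ennreal C * (ennreal (1 / (1 - \<rho>) + 1) * (\<Sum>u\<in>?F. \<eta> u)) = ennreal (C * (1 / (1 - \<rho>) + 1)) * (\<Sum>u\<in>?F. \<eta> u)"
      unfolding ennreal_mult'[OF C] by (simp only: mult.assoc)
    also have "(\<Sum>u\<in>?F. \<eta> u) = (\<integral>\<^sup>+w. (\<Sum>u\<in>?F. alive_weight s u w * ennreal (H w)) \<partial>Q)"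
      unfolding \<eta>_def by (rule nn_integral_sum[symmetric]) (rule am)
    also have "\<dots> = (\<integral>\<^sup>+w. ennreal (exp (- (2 * alpha) * s) * real (card (?F \<inter> living s w)) * H w) \<partial>Q)"
    proof (rule nn_integral_cong)
      fix w
      have "(\<Sum>u\<in>?F. alive_weight s u w) = (\<Sum>u\<in>?F. if u \<in> living s w then ennreal (exp (- (2 * alpha) * s)) else 0)"
        by (rule sum.cong[OF refl]) (auto simp: alive_weight_def living_def dest: labels_uptoD)
      also have "\<dots> = (\<Sum>u\<in>{u\<in>?F. u \<in> living s w}. ennreal (exp (- (2 * alpha) * s)))"
        by (rule sum.inter_filter[symmetric]) simp
      also have "{u\<in>?F. u \<in> living s w} = ?F \<inter> living s w" by auto
      also have "(\<Sum>u\<in>?F \<inter> living s w. ennreal (exp (- (2 * alpha) * s))) = ennreal (exp (- (2 * alpha) * s)) * ennreal (real (card (?F \<inter> living s w)))"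
        by (simp add: ennreal_of_nat_eq_real_of_nat mult.commute)
      finally show "(\<Sum>u\<in>?F. alive_weight s u w * ennreal (H w)) = ennreal (exp (- (2 * alpha) * s) * real (card (?F \<inter> living s w)) * H w)"
        using H(3)[of w] by (simp only: sum_distrib_right[symmetric]) (simp add: ennreal_mult[symmetric])
    qed
    finally show ?thesis .
  qed
  show ?thesis
    by (intro exI[of _ "C * (1 / (1 - \<rho>) + 1)"] conjI allI impI, (use C \<rho> in simp), rule main) (assumption | erule spec)+
qed

text \<open>Chebyshev's inequality relative to the value at time \<open>s\<close>. A drop to half
  costs the factor 4; of the two powers of the value in the denominator, one cancels the number
  alive by \<open>Phi_count_ge\<close> and the other yields \<open>1 / K\<close>.\<close>

lemma count_ratio_prob:
  "\<exists>C\<ge>0. \<forall>n s t K. 0 \<le> s \<longrightarrow> s \<le> t \<longrightarrow> 0 < K \<longrightarrow>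
     Q.P.prob {w \<in> space Q. K * exp (- alpha * s) \<le> Phi 0 1 (labels_upto n) s w \<and>
        Phi 0 1 (labels_upto n) t w \<le> Phi 0 1 (labels_upto n) s w / 2} \<le> C / K"
proof -
  obtain C where C: "C \<ge> 0" "\<And>n s t H B. 0 \<le> s \<Longrightarrow> s \<le> t \<Longrightarrow> adapted s H \<Longrightarrow> H \<in> borel_measurable Q \<Longrightarrow> (\<forall>w. 0 \<le> H w \<and> H w \<le> B) \<Longrightarrow>
     (\<Sum>u\<in>labels_upto n. \<integral>\<^sup>+w. ennreal ((dinc 0 1 s t u w)\<^sup>2) * ennreal (H w) \<partial>Q) \<le>
     ennreal C * (\<integral>\<^sup>+w. ennreal (exp (- (2 * alpha) * s) * real (card (labels_upto n \<inter> living s w)) * H w) \<partial>Q)"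
    using conditional_variance by meson
  have main: "Q.P.prob {w \<in> space Q. K * exp (- alpha * s) \<le> Phi 0 1 (labels_upto n) s w \<and>
        Phi 0 1 (labels_upto n) t w \<le> Phi 0 1 (labels_upto n) s w / 2} \<le> (4 * C) / K"
    if s: "0 \<le> s" and st: "s \<le> t" and K: "0 < K" for n s t K
  proof -
    let ?F = "labels_upto n"
    note F = finite_labels_upto[of n] labels_upto_subset[of n]
    define \<Phi> where "\<Phi> = Phi 0 1 ?F s"
    define \<Psi> where "\<Psi> = Phi 0 1 ?F t"
    define m where "m = K * exp (- alpha * s)"
    have m: "0 < m" using K by (simp add: m_def)
    \<comment> \<open>Normalising by the squared value is multiplication by an adapted weight,
      bounded because it is cut off where the value is below \<open>m\<close>.\<close>
    define H where "H w = (if m \<le> \<Phi> w then 1 / (\<Phi> w)\<^sup>2 else 0)" for w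
    have \<Phi>m: "\<Phi> \<in> borel_measurable Q" "\<Psi> \<in> borel_measurable Q"
      unfolding \<Phi>_def \<Psi>_def by (rule Phi_measurable[OF F(2)])+
    have Ha: "adapted s H"
      unfolding H_def[abs_def] \<Phi>_def by (rule adapted_compose1[OF adapted_Phi[OF F order_refl], where f = "\<lambda>y. if m \<le> y then 1 / y\<^sup>2 else 0"])
    have Hm: "H \<in> borel_measurable Q"
      unfolding H_def[abs_def]
      by (intro measurable_If borel_measurable_divide borel_measurable_power borel_measurable_const borel_measurable_le \<Phi>m)
    have Hb: "0 \<le> H w \<and> H w \<le> 1 / m\<^sup>2" for w
      using m by (auto simp: H_def intro!: divide_left_mono power_mono)
    define E where "E = {w \<in> space Q. m \<le> \<Phi> w \<and> \<Psi> w \<le> \<Phi> w / 2}"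
    have Em: "E \<in> sets Q"
      unfolding E_def
      by (intro sets.sets_Collect_conj borel_measurable_le borel_measurable_divide borel_measurable_const \<Phi>m)
    have sq: "(\<integral>w. (\<Psi> w - \<Phi> w)\<^sup>2 * H w \<partial>Q) = (\<Sum>u\<in>?F. \<integral>w. (dinc 0 1 s t u w)\<^sup>2 * H w \<partial>Q)"
      "integrable Q (\<lambda>w. (\<Psi> w - \<Phi> w)\<^sup>2 * H w)"
      unfolding \<Phi>_def \<Psi>_def
      by (rule Phi_increment_square[OF F st order_trans[OF s st] Ha Hm, of "1 / m\<^sup>2"], use Hb in simp)+
    have "emeasure Q E \<le> (\<integral>\<^sup>+w. ennreal 4 * ennreal ((\<Psi> w - \<Phi> w)\<^sup>2 * H w) \<partial>Q)"
    proof -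
      have "emeasure Q E = (\<integral>\<^sup>+w. indicator E w \<partial>Q)" using Em by simp
      also have "\<dots> \<le> (\<integral>\<^sup>+w. ennreal 4 * ennreal ((\<Psi> w - \<Phi> w)\<^sup>2 * H w) \<partial>Q)"
      proof (rule nn_integral_mono)
        fix w
        show "indicator E w \<le> ennreal 4 * ennreal ((\<Psi> w - \<Phi> w)\<^sup>2 * H w)"
        proof (cases "w \<in> E")
          case True
          then have h: "m \<le> \<Phi> w" "\<Psi> w \<le> \<Phi> w / 2" by (auto simp: E_def)
          then have pos: "0 < \<Phi> w" using m by simp
          have "(\<Phi> w / 2)\<^sup>2 \<le> (\<Phi> w - \<Psi> w)\<^sup>2" using h pos by (intro power_mono) auto
          then have "(\<Phi> w)\<^sup>2 \<le> 4 * (\<Psi> w - \<Phi> w)\<^sup>2" by (simp add: power_divide power2_commute)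
          then have "1 \<le> 4 * ((\<Psi> w - \<Phi> w)\<^sup>2 * H w)" using h pos by (simp add: H_def)
          then have "ennreal 1 \<le> ennreal (4 * ((\<Psi> w - \<Phi> w)\<^sup>2 * H w))" by (rule ennreal_leI)
          then show ?thesis using True Hb[of w] by (simp add: ennreal_mult)
        qed simp
      qed
      finally show ?thesis .
    qed
    also have "\<dots> = ennreal 4 * (\<integral>\<^sup>+w. ennreal ((\<Psi> w - \<Phi> w)\<^sup>2 * H w) \<partial>Q)"
      by (rule nn_integral_cmult, rule measurable_compose[OF borel_measurable_integrable[OF sq(2)] measurable_ennreal])
    also have "(\<integral>\<^sup>+w. ennreal ((\<Psi> w - \<Phi> w)\<^sup>2 * H w) \<partial>Q) = ennreal (\<integral>w. (\<Psi> w - \<Phi> w)\<^sup>2 * H w \<partial>Q)"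
      by (rule nn_integral_eq_integral[OF sq(2)], rule AE_I2) (use Hb in simp)
    also have "\<dots> = (\<Sum>u\<in>?F. ennreal (\<integral>w. (dinc 0 1 s t u w)\<^sup>2 * H w \<partial>Q))"
      unfolding sq(1) by (rule sum_ennreal[symmetric], rule Bochner_Integration.integral_nonneg) (use Hb in simp)
    also have "\<dots> = (\<Sum>u\<in>?F. \<integral>\<^sup>+w. ennreal ((dinc 0 1 s t u w)\<^sup>2) * ennreal (H w) \<partial>Q)"
    proof (rule sum.cong[OF refl])
      fix u assume u: "u \<in> ?F"
      have i: "integrable Q (\<lambda>w. (dinc 0 1 s t u w)\<^sup>2 * H w)"
        by (rule integrable_times_bounded[OF dinc_square_integrable[OF labels_uptoD[OF u] st order_trans[OF s st]] Hm, of "1 / m\<^sup>2"]) (use Hb in simp)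
      have "ennreal (\<integral>w. (dinc 0 1 s t u w)\<^sup>2 * H w \<partial>Q) = (\<integral>\<^sup>+w. ennreal ((dinc 0 1 s t u w)\<^sup>2 * H w) \<partial>Q)"
        by (rule nn_integral_eq_integral[OF i, symmetric], rule AE_I2) (use Hb in simp)
      also have "\<dots> = (\<integral>\<^sup>+w. ennreal ((dinc 0 1 s t u w)\<^sup>2) * ennreal (H w) \<partial>Q)"
        by (rule nn_integral_cong) (use Hb in \<open>simp add: ennreal_mult\<close>)
      finally show "ennreal (\<integral>w. (dinc 0 1 s t u w)\<^sup>2 * H w \<partial>Q) = \<dots>" .
    qed
    also have "\<dots> \<le> ennreal C * (\<integral>\<^sup>+w. ennreal (exp (- (2 * alpha) * s) * real (card (?F \<inter> living s w)) * H w) \<partial>Q)"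
      by (rule C(2)[OF s st Ha Hm, of "1 / m\<^sup>2"]) (use Hb in simp)
    also have "(\<integral>\<^sup>+w. ennreal (exp (- (2 * alpha) * s) * real (card (?F \<inter> living s w)) * H w) \<partial>Q) \<le> (\<integral>\<^sup>+w. ennreal (1 / K) \<partial>Q)"
    proof (rule nn_integral_mono, rule ennreal_leI)
      fix w
      show "exp (- (2 * alpha) * s) * real (card (?F \<inter> living s w)) * H w \<le> 1 / K"
      proof (cases "m \<le> \<Phi> w")
        case True
        then have pos: "0 < \<Phi> w" using m by simp
        have "exp (- (2 * alpha) * s) = exp (- alpha * s) * exp (- alpha * s)"
          unfolding exp_add[symmetric] by (rule arg_cong[where f = exp]) simp
        then have "exp (- (2 * alpha) * s) * real (card (?F \<inter> living s w)) * H w =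
            exp (- alpha * s) * ((exp (- alpha * s) * real (card (?F \<inter> living s w))) * H w)" by (simp only: mult.assoc)
        also have "\<dots> \<le> exp (- alpha * s) * (\<Phi> w * H w)"
          unfolding \<Phi>_def using Hb by (intro mult_left_mono mult_right_mono Phi_count_ge[OF s]) auto
        also have "\<Phi> w * H w = 1 / \<Phi> w" using True pos by (simp add: H_def power2_eq_square)
        also have "exp (- alpha * s) * (1 / \<Phi> w) \<le> exp (- alpha * s) * (1 / m)"
          using True m pos by (intro mult_left_mono divide_left_mono) auto
        also have "\<dots> = 1 / K" by (simp add: m_def)
        finally show ?thesis .
      next
        case False then show ?thesis using K by (simp add: H_def)
      qed
    qed
    also have "(\<integral>\<^sup>+w. ennreal (1 / K) \<partial>Q) = ennreal (1 / K)" by (simp add: Q.P.emeasure_space_1)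
    finally have "emeasure Q E \<le> ennreal 4 * (ennreal C * ennreal (1 / K))" by (simp add: mult_left_mono)
    also have "\<dots> = ennreal (4 * C / K)" using C(1) K by (simp only: ennreal_mult'[symmetric] ennreal_numeral[symmetric] zero_le_numeral times_divide_eq_right mult_1_right mult.assoc)
    finally have "Q.P.prob E \<le> 4 * C / K" using C(1) K by (simp add: Q.P.emeasure_eq_measure)
    then show ?thesis by (simp add: E_def m_def \<Phi>_def \<Psi>_def)
  qed
  show ?thesis
    by (intro exI[of _ "4 * C"] conjI allI impI, (use C(1) in simp), rule main) simp_all
qed

text \<open>On survival with vanishing limit, for every \<open>K\<close> and all large
  \<open>T\<close> the premise of \<open>count_ratio_prob\<close> holds; then for all large
  \<open>T'\<close> the value has fallen below half, and for all large \<open>n\<close> the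
  truncation is exact. Three nested lower limits keep the bound
  \<open>C / real (Suc K)\<close>.\<close>

lemma AE_count_limit_nonzero:
  "AE w in Q. \<not> ((\<lambda>T. PhiI 0 1 (real T) w) \<longlonglongrightarrow> 0 \<and>
     filterlim (\<lambda>T. exp (alpha * real T) * PhiI 0 1 (real T) w) at_top sequentially)"
proof -
  obtain C where C: "C \<ge> 0" "\<And>n s t K. 0 \<le> s \<Longrightarrow> s \<le> t \<Longrightarrow> 0 < K \<Longrightarrow>
     Q.P.prob {w \<in> space Q. K * exp (- alpha * s) \<le> Phi 0 1 (labels_upto n) s w \<and>
        Phi 0 1 (labels_upto n) t w \<le> Phi 0 1 (labels_upto n) s w / 2} \<le> C / K"
    using count_ratio_prob by meson
  define E where "E K T T' n = {w \<in> space Q. real (Suc K) * exp (- alpha * real T) \<le> Phi 0 1 (labels_upto n) (real T) w \<and>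
        Phi 0 1 (labels_upto n) (real (T + T')) w \<le> Phi 0 1 (labels_upto n) (real T) w / 2}" for K T T' n :: nat
  have Em: "E K T T' n \<in> sets Q" for K T T' n
    unfolding E_def
    by (intro sets.sets_Collect_conj borel_measurable_le borel_measurable_divide borel_measurable_const Phi_measurable labels_upto_subset)
  have Ep: "Q.P.prob (E K T T' n) \<le> C / real (Suc K)" for K T T' n
    unfolding E_def by (rule C(2)) simp_all
  define E1 where "E1 K T T' = (\<Union>m. \<Inter>n\<in>{m..}. E K T T' n)" for K T T'
  have E1: "E1 K T T' \<in> sets Q" "Q.P.prob (E1 K T T') \<le> C / real (Suc K)" for K T T'
    unfolding E1_def by (rule Q.P.prob_liminf_le[OF Em Ep])+
  define E2 where "E2 K T = (\<Union>m. \<Inter>T'\<in>{m..}. E1 K T T')" for K T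
  have E2: "E2 K T \<in> sets Q" "Q.P.prob (E2 K T) \<le> C / real (Suc K)" for K T
    unfolding E2_def by (rule Q.P.prob_liminf_le[OF E1])+
  define E3 where "E3 K = (\<Union>m. \<Inter>T\<in>{m..}. E2 K T)" for K
  have E3: "E3 K \<in> sets Q" "Q.P.prob (E3 K) \<le> C / real (Suc K)" for K
    unfolding E3_def by (rule Q.P.prob_liminf_le[OF E2])+
  have I: "(\<Inter>K. E3 K) \<in> sets Q" using E3(1) by (intro sets.countable_INT) auto
  have "Q.P.prob (\<Inter>K. E3 K) \<le> C * (1 / real (Suc K))" for K
    using order_trans[OF Q.P.finite_measure_mono[OF _ E3(1)[of K], of "\<Inter>K. E3 K"] E3(2)[of K]] by auto
  moreover have "(\<lambda>K. C * (1 / real (Suc K))) \<longlonglongrightarrow> C * 0"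
    using LIMSEQ_inverse_real_of_nat by (intro tendsto_mult tendsto_const) (simp add: inverse_eq_divide)
  ultimately have "Q.P.prob (\<Inter>K. E3 K) \<le> C * 0"
    by (intro LIMSEQ_le_const) auto
  then have "Q.P.prob (\<Inter>K. E3 K) = 0" using measure_nonneg[of Q "\<Inter>K. E3 K"] by linarith
  then have "(\<Inter>K. E3 K) \<in> null_sets Q"
    using I by (simp add: null_sets_def Q.P.emeasure_eq_measure)
  then have "AE w in Q. w \<notin> (\<Inter>K. E3 K)" by (rule AE_not_in)
  with AE_finite_present AE_space show ?thesis
  proof eventually_elim
    case (elim w)
    show ?case
    proof
      assume bad: "(\<lambda>T. PhiI 0 1 (real T) w) \<longlonglongrightarrow> 0 \<and> filterlim (\<lambda>T. exp (alpha * real T) * PhiI 0 1 (real T) w) at_top sequentially"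
      have "w \<in> E3 K" for K
      proof -
        have "\<forall>\<^sub>F T in sequentially. real (Suc K) \<le> exp (alpha * real T) * PhiI 0 1 (real T) w"
          using bad by (simp only: filterlim_at_top)
        then obtain m where m: "\<And>T. m \<le> T \<Longrightarrow> real (Suc K) \<le> exp (alpha * real T) * PhiI 0 1 (real T) w"
          unfolding eventually_sequentially by meson
        have "w \<in> E2 K T" if T: "m \<le> T" for T
        proof -
          have "real (Suc K) * exp (- alpha * real T) \<le> (exp (alpha * real T) * PhiI 0 1 (real T) w) * exp (- alpha * real T)"
            by (rule mult_right_mono[OF m[OF T]]) simp
          also have "\<dots> = PhiI 0 1 (real T) w" by (simp add: exp_minus)
          finally have ge: "real (Suc K) * exp (- alpha * real T) \<le> PhiI 0 1 (real T) w" .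
          have "0 < real (Suc K) * exp (- alpha * real T)" by simp
          then have pos: "0 < PhiI 0 1 (real T) w / 2" using ge by linarith
          have "\<forall>\<^sub>F T' in sequentially. PhiI 0 1 (real T') w < PhiI 0 1 (real T) w / 2"
            using bad pos by (intro order_tendstoD(2)[where y = 0]) auto
          then obtain m' where m': "\<And>T'. m' \<le> T' \<Longrightarrow> PhiI 0 1 (real T') w < PhiI 0 1 (real T) w / 2"
            unfolding eventually_sequentially by meson
          have "w \<in> E1 K T T'" if T': "m' \<le> T'" for T'
          proof -
            have "present (real (T + T')) w \<subseteq> labels" by (auto simp: present_def)
            then obtain N where N: "present (real (T + T')) w \<subseteq> labels_upto N"
              using finite_subset_labels_upto[of "present (real (T + T')) w"] elim(1) by meson
            have "w \<in> E K T T' n" if n: "N \<le> n" for n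
            proof -
              have P: "present (real (T + T')) w \<subseteq> labels_upto n" using N labels_upto_mono[OF n] by (rule subset_trans)
              have "Phi 0 1 (labels_upto n) (real T) w = PhiI 0 1 (real T) w" by (rule Phi_eq_PhiI[OF P]) simp
              moreover have "Phi 0 1 (labels_upto n) (real (T + T')) w = PhiI 0 1 (real (T + T')) w" by (rule Phi_eq_PhiI[OF P]) simp
              moreover have "PhiI 0 1 (real (T + T')) w \<le> PhiI 0 1 (real T) w / 2" using m'[of "T + T'"] T' by simp
              ultimately show ?thesis using ge elim(2) by (simp add: E_def)
            qed
            then show ?thesis by (auto simp: E1_def)
          qed
          then show ?thesis by (auto simp: E2_def)
        qed
        then show ?thesis by (auto simp: E3_def)
      qed
      then show False using elim(3) by simp
    qed
  qed
qed

end

section \<open>Convergence of the averages\<close>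

lemma continuous_at_right_shift:
  fixes f :: "real \<Rightarrow> real"
  assumes "continuous (at_right (t - b)) f"
  shows "continuous (at_right t) (\<lambda>t. f (t - b))"
proof -
  have "((\<lambda>t. t - b) \<longlongrightarrow> t - b) (at_right t)" by (intro tendsto_intros)
  moreover have "\<forall>\<^sub>F s in at_right t. s - b \<in> {t - b<..} \<and> s - b \<noteq> t - b"
    using eventually_at_right_less[of t] by eventually_elim simp
  ultimately have "filterlim (\<lambda>t. t - b) (at_right (t - b)) (at_right t)" by (simp only: filterlim_at)
  with assms show ?thesis unfolding continuous_within by (rule filterlim_compose)
qed

context particle_law
begin

text \<open>At birth and at death the contribution takes its new value at the instant itself, and
  after death it is constant; in between it inherits right-continuity from the motion.\<close>

lemma innov_right_continuous:
  assumes z: "\<And>s. 0 \<le> s \<Longrightarrow> continuous (at_right s) (fst d)"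
  shows "continuous (at_right s) (\<lambda>s. innov c s x d)"
proof -
  consider "s < 0" | "0 \<le> s" "s < life d" | "0 \<le> s" "life d \<le> s" by linarith
  then show ?thesis
  proof cases
    case 1
    then have "\<forall>\<^sub>F r in at_right s. innov c r x d = innov c s x d"
      using eventually_at_right_real[of s 0] by (auto simp: innov_def elim!: eventually_mono)
    then show ?thesis unfolding continuous_within by (rule tendsto_eventually)
  next
    case 3
    have "\<forall>\<^sub>F r in at_right s. innov c r x d = innov c s x d"
      using eventually_at_right_less[of s] by eventually_elim (use 3 in \<open>simp add: innov_def contrib_def\<close>)
    then show ?thesis unfolding continuous_within by (rule tendsto_eventually)
  next
    case 2
    let ?h = "\<lambda>r. exp (- alpha * r) * (1 * (x + c * (fst d r - drift * r)) + c * 0) - x"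
    have eq: "innov c r x d = ?h r" if "0 \<le> r" "r < life d" for r
      using that eval_right_eq[OF that(1) z[OF that(1)]] by (simp only: innov_def contrib_def weight_def) simp
    have "(fst d \<longlongrightarrow> fst d s) (at_right s)" using z[OF 2(1)] by (simp only: continuous_within)
    then have "(?h \<longlongrightarrow> ?h s) (at_right s)" by (intro tendsto_intros)
    moreover have "\<forall>\<^sub>F r in at_right s. ?h r = innov c r x d"
      using eventually_at_right_real[OF 2(2)] by eventually_elim (use 2 in \<open>simp add: eq\<close>)
    ultimately show ?thesis
      unfolding continuous_within eq[OF 2] by (rule Lim_transform_eventually)
  qed
qed

lemma incr_right_continuous:
  assumes "\<And>s. 0 \<le> s \<Longrightarrow> continuous (at_right s) (fst (w v))"
  shows "continuous (at_right t) (\<lambda>t. incr c x t v w)"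
proof -
  have "continuous (at_right t) (\<lambda>t. innov c (t - birth w v) (score drift c x w v) (w v))"
    by (rule continuous_at_right_shift[OF innov_right_continuous[OF assms]])
  then show ?thesis
    unfolding incr_def by (cases "born w v") (auto intro!: continuous_intros)
qed

text \<open>The index set changes with time, but one finite truncation covers all particles born up
  to \<open>t + 1\<close>, so just to the right of \<open>t\<close> the sum has a fixed index
  set.\<close>

lemma PhiI_right_continuous:
  assumes w: "\<And>v s. v \<in> labels \<Longrightarrow> 0 \<le> s \<Longrightarrow> continuous (at_right s) (fst (w v))"
    and fin: "finite (present (t + 1) w)"
  shows "continuous (at_right t) (\<lambda>t. PhiI c x t w)"
proof -
  have "present (t + 1) w \<subseteq> labels" by (auto simp: present_def)
  then obtain n where n: "present (t + 1) w \<subseteq> labels_upto n"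
    using finite_subset_labels_upto[OF fin] by blast
  have eq: "Phi c x (labels_upto n) s w = PhiI c x s w" if "s \<le> t + 1" for s
    by (rule Phi_eq_PhiI[OF n that])
  have "continuous (at_right t) (\<lambda>t. Phi c x (labels_upto n) t w)"
    unfolding Phi_def
    by (intro continuous_intros incr_right_continuous w) (auto dest: labels_uptoD)
  then have "((\<lambda>s. Phi c x (labels_upto n) s w) \<longlongrightarrow> PhiI c x t w) (at_right t)"
    unfolding continuous_within by (simp add: eq)
  moreover have "\<forall>\<^sub>F s in at_right t. Phi c x (labels_upto n) s w = PhiI c x s w"
    using eventually_at_right_real[of t "t + 1"] by (auto elim!: eventually_mono simp: eq)
  ultimately show ?thesis
    unfolding continuous_within by (rule Lim_transform_eventually)
qed

text \<open>Path regularity is a premise inside the almost-everywhere statement, because it need not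
  be an event of the product space. It is discharged after pulling back to the original probability
  space.\<close>

lemma AE_PhiI_tendsto:
  "AE w in Q. (\<forall>v\<in>labels. \<forall>s\<ge>0. continuous (at_right s) (fst (w v))) \<longrightarrow>
     (\<exists>L. ((\<lambda>t. PhiI c x t w) \<longlongrightarrow> L) at_top)"
  using AE_finite_present AE_oscillation[of c x]
proof eventually_elim
  case (elim w)
  then obtain k0 where k0: "\<forall>k\<ge>k0. \<forall>q j. j \<le> 2 ^ q \<longrightarrow>
      \<bar>PhiI c x (real k + real j / 2 ^ q) w - PhiI c x (real k) w\<bar> \<le> exp (- (alpha / 8) * real k)"
    by meson
  have "summable (\<lambda>k. exp (- (alpha / 8)) ^ k)" using alpha_pos by (intro summable_geometric) simp
  then have sum: "summable (\<lambda>k. exp (- (alpha / 8) * real k))"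
    by (simp only: exp_of_nat2_mult)
  show ?case
  proof
    assume w: "\<forall>v\<in>labels. \<forall>s\<ge>0. continuous (at_right s) (fst (w v))"
    show "\<exists>L. ((\<lambda>t. PhiI c x t w) \<longlongrightarrow> L) at_top"
    proof (rule tendsto_at_top_of_dyadic_oscillation[OF _ sum])
      show "continuous (at_right t) (\<lambda>t. PhiI c x t w)" for t
        using w elim(1) by (intro PhiI_right_continuous) auto
      show "\<bar>PhiI c x (real k + real j / 2 ^ q) w - PhiI c x (real k) w\<bar> \<le> exp (- (alpha / 8) * real k)"
        if "k0 \<le> k" "j \<le> 2 ^ q" for k q j
        using k0 that by simp
    qed
  qed
qed

lemma AE_average_tendsto:
  "AE w in Q. (\<forall>v\<in>labels. \<forall>s\<ge>0. continuous (at_right s) (fst (w v))) \<longrightarrow>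
     filterlim (\<lambda>t. card (living t w)) at_top at_top \<longrightarrow>
     (\<exists>L. ((\<lambda>t. (\<Sum>v\<in>living t w. place 1 0 t w v) / real (card (living t w))) \<longlongrightarrow> L) at_top)"
  using AE_PhiI_tendsto[of 1 0] AE_PhiI_tendsto[of 0 1] AE_finite_present AE_count_limit_nonzero
proof eventually_elim
  case (elim w)
  show ?case
  proof (intro impI)
    assume w: "\<forall>v\<in>labels. \<forall>s\<ge>0. continuous (at_right s) (fst (w v))"
      and card: "filterlim (\<lambda>t. card (living t w)) at_top at_top"
    obtain Y where Y: "((\<lambda>t. PhiI 1 0 t w) \<longlongrightarrow> Y) at_top" using elim(1) w by meson
    obtain W where W: "((\<lambda>t. PhiI 0 1 t w) \<longlongrightarrow> W) at_top" using elim(2) w by meson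
    have Phi1: "PhiI 0 1 t w = exp (- alpha * t) * real (card (living t w))" if "0 \<le> t" for t
      using PhiI_eq[OF that, of w 0 1] elim(3) by (simp add: place_def score_def)
    have Phi0: "PhiI 1 0 t w = exp (- alpha * t) * (\<Sum>v\<in>living t w. place 1 0 t w v)" if "0 \<le> t" for t
      using PhiI_eq[OF that, of w 1 0] elim(3) by simp
    have "filterlim (\<lambda>T. card (living (real T) w)) at_top sequentially"
      by (rule filterlim_compose[OF card filterlim_real_sequentially])
    then have "filterlim (\<lambda>T. real (card (living (real T) w))) at_top sequentially"
      by (rule filterlim_compose[OF filterlim_real_sequentially])
    moreover have "exp (alpha * real T) * PhiI 0 1 (real T) w = real (card (living (real T) w))" for T
      by (simp add: Phi1 exp_minus)
    ultimately have "filterlim (\<lambda>T. exp (alpha * real T) * PhiI 0 1 (real T) w) at_top sequentially" by simp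
    moreover have "(\<lambda>T. PhiI 0 1 (real T) w) \<longlonglongrightarrow> W"
      by (rule filterlim_compose[OF W filterlim_real_sequentially])
    \<comment> \<open>A zero \<open>W\<close> with diverging population is excluded along integer
      times.\<close>
    ultimately have "W \<noteq> 0" using elim(4) by blast
    with Y W have "((\<lambda>t. PhiI 1 0 t w / PhiI 0 1 t w) \<longlongrightarrow> Y / W) at_top" by (rule tendsto_divide)
    moreover have "\<forall>\<^sub>F t in at_top. PhiI 1 0 t w / PhiI 0 1 t w =
        (\<Sum>v\<in>living t w. place 1 0 t w v) / real (card (living t w))"
      using eventually_ge_at_top[of 0] by eventually_elim (simp add: Phi0 Phi1)
    ultimately have "((\<lambda>t. (\<Sum>v\<in>living t w. place 1 0 t w v) / real (card (living t w))) \<longlongrightarrow> Y / W) at_top"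
      by (rule Lim_transform_eventually)
    then show "\<exists>L. ((\<lambda>t. (\<Sum>v\<in>living t w. place 1 0 t w v) / real (card (living t w))) \<longlongrightarrow> L) at_top" ..
  qed
qed

end

section \<open>Transfer to the branching process\<close>

text \<open>The product law is obtained in two steps: for the last two variables, and then for the
  first against the sigma-algebra that the last two generate together.\<close>

lemma (in prob_space) distr_triple_indep:
  assumes X: "X \<in> M \<rightarrow>\<^sub>M S" and Y: "Y \<in> M \<rightarrow>\<^sub>M T" and W: "W \<in> M \<rightarrow>\<^sub>M U"
    and ind: "indep_sets (\<lambda>k. [{X -` B \<inter> space M | B. B \<in> sets S}, {Y -` B \<inter> space M | B. B \<in> sets T},
       {W -` B \<inter> space M | B. B \<in> sets U}] ! k) {..<3}"
  shows "distr M (S \<Otimes>\<^sub>M T \<Otimes>\<^sub>M U) (\<lambda>\<omega>. (X \<omega>, Y \<omega>, W \<omega>)) = distr M S X \<Otimes>\<^sub>M distr M T Y \<Otimes>\<^sub>M distr M U W"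
proof -
  define E where "E = (\<lambda>k. [{X -` B \<inter> space M | B. B \<in> sets S}, {Y -` B \<inter> space M | B. B \<in> sets T},
       {W -` B \<inter> space M | B. B \<in> sets U}] ! k)"
  have E: "E 0 = {X -` B \<inter> space M | B. B \<in> sets S}" "E (Suc 0) = {Y -` B \<inter> space M | B. B \<in> sets T}"
    "E 2 = {W -` B \<inter> space M | B. B \<in> sets U}"
    by (simp_all add: E_def numeral_2_eq_2)
  have indE: "indep_sets E {..<3}" using ind by (simp only: E_def)
  have YW: "(\<lambda>\<omega>. (Y \<omega>, W \<omega>)) \<in> M \<rightarrow>\<^sub>M T \<Otimes>\<^sub>M U" by (rule measurable_Pair[OF Y W])
  interpret DX: prob_space "distr M S X" by (rule prob_space_distr[OF X])
  interpret DY: prob_space "distr M T Y" by (rule prob_space_distr[OF Y])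
  interpret DW: prob_space "distr M U W" by (rule prob_space_distr[OF W])
  interpret DYW: prob_space "distr M (T \<Otimes>\<^sub>M U) (\<lambda>\<omega>. (Y \<omega>, W \<omega>))" by (rule prob_space_distr[OF YW])
  have pair: "distr M T Y \<Otimes>\<^sub>M distr M U W = distr M (T \<Otimes>\<^sub>M U) (\<lambda>\<omega>. (Y \<omega>, W \<omega>))"
  proof (rule pair_measure_eqI[OF DY.sigma_finite_measure_axioms DW.sigma_finite_measure_axioms])
    fix b c assume "b \<in> sets (distr M T Y)" "c \<in> sets (distr M U W)"
    then have b: "b \<in> sets T" and c: "c \<in> sets U" by simp_all
    have "prob (\<Inter>j\<in>{1, 2::nat}. (if j = 1 then Y -` b \<inter> space M else W -` c \<inter> space M)) =
        (\<Prod>j\<in>{1, 2::nat}. prob (if j = 1 then Y -` b \<inter> space M else W -` c \<inter> space M))"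
      by (rule indep_setsD[OF indE]) (use b c E in auto)
    moreover have "(Y -` b \<inter> space M) \<inter> (W -` c \<inter> space M) = (\<lambda>\<omega>. (Y \<omega>, W \<omega>)) -` (b \<times> c) \<inter> space M" by auto
    ultimately have "prob (Y -` b \<inter> space M) * prob (W -` c \<inter> space M) = prob ((\<lambda>\<omega>. (Y \<omega>, W \<omega>)) -` (b \<times> c) \<inter> space M)"
      by (simp add: Int_commute)
    then show "emeasure (distr M T Y) b * emeasure (distr M U W) c = emeasure (distr M (T \<Otimes>\<^sub>M U) (\<lambda>\<omega>. (Y \<omega>, W \<omega>))) (b \<times> c)"
      using b c by (simp add: emeasure_distr[OF Y] emeasure_distr[OF W] emeasure_distr[OF YW] emeasure_eq_measure ennreal_mult[symmetric])
  qed simp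
  have "distr M S X \<Otimes>\<^sub>M distr M (T \<Otimes>\<^sub>M U) (\<lambda>\<omega>. (Y \<omega>, W \<omega>)) = distr M (S \<Otimes>\<^sub>M T \<Otimes>\<^sub>M U) (\<lambda>\<omega>. (X \<omega>, Y \<omega>, W \<omega>))"
  proof (rule pair_measure_eqI[OF DX.sigma_finite_measure_axioms DYW.sigma_finite_measure_axioms])
    fix a b assume "a \<in> sets (distr M S X)" "b \<in> sets (distr M (T \<Otimes>\<^sub>M U) (\<lambda>\<omega>. (Y \<omega>, W \<omega>)))"
    then have a: "a \<in> sets S" and b: "b \<in> sets (T \<Otimes>\<^sub>M U)" by simp_all
    let ?I = "\<lambda>j::nat. if j = 0 then {0} else {1, 2::nat}"
    have st: "Int_stable {V -` B \<inter> space M | B. B \<in> sets R}" for V :: "'a \<Rightarrow> 'z" and R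
    proof (rule Int_stableI)
      fix p q assume "p \<in> {V -` B \<inter> space M | B. B \<in> sets R}" "q \<in> {V -` B \<inter> space M | B. B \<in> sets R}"
      then obtain B C where "B \<in> sets R" "C \<in> sets R" "p = V -` B \<inter> space M" "q = V -` C \<inter> space M" by auto
      then show "p \<inter> q \<in> {V -` B \<inter> space M | B. B \<in> sets R}"
        by (intro CollectI exI[of _ "B \<inter> C"]) auto
    qed
    \<comment> \<open>The indices are regrouped into \<open>{0}\<close> and \<open>{1, 2}\<close>;
      the systems are intersection-stable, so independence passes to the generated
      sigma-algebras.\<close>
    have "indep_sets (\<lambda>j. sigma_sets (space M) (\<Union>i\<in>?I j. E i)) {0, 1}"
    proof (rule indep_sets_collect_sigma)
      show "indep_sets E (\<Union>j\<in>{0, 1}. ?I j)" using indE by (rule indep_sets_mono_index[rotated]) auto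
      show "Int_stable (E i)" if "j \<in> {0, 1}" "i \<in> ?I j" for i j
        using that st[of X S] st[of Y T] st[of W U] E by (auto split: if_splits)
      show "disjoint_family_on ?I {0, 1}" by (auto simp: disjoint_family_on_def)
    qed
    note split = indep_setsD[OF this, of "{0, 1}" "\<lambda>j. if j = 0 then X -` a \<inter> space M else (\<lambda>\<omega>. (Y \<omega>, W \<omega>)) -` b \<inter> space M"]
    have inX: "X -` a \<inter> space M \<in> sigma_sets (space M) (E 0)" using a E by auto
    define R where "R = sigma (space M) (E 1 \<union> E 2)"
    have "E 1 \<union> E 2 \<subseteq> Pow (space M)" using E by auto
    then have R: "sets R = sigma_sets (space M) (E 1 \<union> E 2)" "space R = space M" by (simp_all add: R_def)
    have "Y \<in> R \<rightarrow>\<^sub>M T"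
      using measurable_space[OF Y] by (intro measurableI) (auto simp: R E intro!: sigma_sets.Basic UnI1)
    moreover have "W \<in> R \<rightarrow>\<^sub>M U"
      using measurable_space[OF W] by (intro measurableI) (auto simp: R E intro!: sigma_sets.Basic UnI2)
    ultimately have YR: "Y \<in> R \<rightarrow>\<^sub>M T" "W \<in> R \<rightarrow>\<^sub>M U" .
    from measurable_sets[OF measurable_Pair[OF YR] b]
    have inYW: "(\<lambda>\<omega>. (Y \<omega>, W \<omega>)) -` b \<inter> space M \<in> sigma_sets (space M) (E 1 \<union> E 2)" by (simp add: R)
    have "prob ((X -` a \<inter> space M) \<inter> ((\<lambda>\<omega>. (Y \<omega>, W \<omega>)) -` b \<inter> space M)) = prob (X -` a \<inter> space M) * prob ((\<lambda>\<omega>. (Y \<omega>, W \<omega>)) -` b \<inter> space M)"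
      using split inX inYW by (simp add: Int_commute)
    moreover have "(X -` a \<inter> space M) \<inter> ((\<lambda>\<omega>. (Y \<omega>, W \<omega>)) -` b \<inter> space M) = (\<lambda>\<omega>. (X \<omega>, Y \<omega>, W \<omega>)) -` (a \<times> b) \<inter> space M" by auto
    ultimately show "emeasure (distr M S X) a * emeasure (distr M (T \<Otimes>\<^sub>M U) (\<lambda>\<omega>. (Y \<omega>, W \<omega>))) b =
        emeasure (distr M (S \<Otimes>\<^sub>M T \<Otimes>\<^sub>M U) (\<lambda>\<omega>. (X \<omega>, Y \<omega>, W \<omega>))) (a \<times> b)"
      using a b by (simp add: emeasure_distr[OF X] emeasure_distr[OF YW] emeasure_distr[OF measurable_Pair[OF X YW]] emeasure_eq_measure ennreal_mult[symmetric])
  qed simp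
  then show ?thesis by (simp only: pair)
qed

section \<open>Laws of the motion, of one particle and of all particles\<close>

context square_integrable_levy_process
begin

text \<open>The stopped path is a function of the path on \<open>{0..s}\<close>, of which the
  increment is independent; the mean of the increment is linear by \<open>mean_eq\<close>.\<close>

lemma path_law_increment:
  assumes st: "0 \<le> s" "s \<le> t" and g: "g \<in> borel_measurable path_space" and B: "\<And>z. \<bar>g z\<bar> \<le> B"
  shows "(\<integral>z. (z t - z s) * g (stopped s z) \<partial>path_law) = expectation (X 1) * (t - s) * (\<integral>z. g (stopped s z) \<partial>path_law)"
proof -
  let ?P = "\<lambda>\<omega>. \<lambda>r\<in>{0..}. X r \<omega>" and ?Y = "\<lambda>\<omega>. \<lambda>r\<in>{0..s}. X r \<omega>"
  define h where "h y = g (\<lambda>r\<in>{0..}. y (min r s))" for y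
  have "(\<lambda>y. \<lambda>r\<in>{0..}. y (min r s)) \<in> PiM {0..s} (\<lambda>_. borel) \<rightarrow>\<^sub>M path_space"
    using st by (intro measurable_restrict measurable_component_singleton) auto
  from measurable_compose[OF this g] have hm: "h \<in> borel_measurable (PiM {0..s} (\<lambda>_. borel))"
    unfolding h_def[abs_def] .
  have eq: "g (stopped s (?P \<omega>)) = h (?Y \<omega>)" for \<omega>
    unfolding h_def stopped_def by (rule arg_cong[where f = g]) (use st in \<open>auto simp: fun_eq_iff restrict_def min_def\<close>)
  have gm: "(\<lambda>z. g (stopped s z)) \<in> borel_measurable path_space" by (rule measurable_compose[OF stopped_measurable g])
  have hX: "(\<lambda>\<omega>. h (?Y \<omega>)) \<in> borel_measurable M"
    using measurable_compose[OF path_measurable gm] unfolding eq .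
  have int: "integrable M (\<lambda>\<omega>. h (?Y \<omega>))"
    by (rule integrable_const_bound[of _ B, OF _ hX]) (use B in \<open>simp add: h_def\<close>)
  have m: "(\<lambda>z. (z t - z s) * g (stopped s z)) \<in> borel_measurable path_space"
    by (intro borel_measurable_times borel_measurable_diff path_component_measurable gm)
  have "(\<integral>z. (z t - z s) * g (stopped s z) \<partial>path_law) = expectation (\<lambda>\<omega>. (X t \<omega> - X s \<omega>) * h (?Y \<omega>))"
    unfolding path_law_def integral_distr[OF path_measurable m] using st by (simp only: eq) simp
  also have "\<dots> = expectation (\<lambda>\<omega>. X t \<omega> - X s \<omega>) * expectation (\<lambda>\<omega>. h (?Y \<omega>))"
    by (rule indep_var_lebesgue_integral[OF indep_increment_past[OF st hm] integrable_increment[OF st] int])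
  also have "expectation (\<lambda>\<omega>. X t \<omega> - X s \<omega>) = expectation (X t) - expectation (X s)"
    using st by (intro Bochner_Integration.integral_diff integrable_X) auto
  also have "\<dots> = expectation (X 1) * (t - s)"
    using mean_eq[of s] mean_eq[of t] st by (simp add: algebra_simps)
  also have "expectation (\<lambda>\<omega>. h (?Y \<omega>)) = (\<integral>z. g (stopped s z) \<partial>path_law)"
    unfolding path_law_def integral_distr[OF path_measurable gm] by (simp only: eq)
  finally show ?thesis .
qed

end

context branching_levy_process
begin

lemma particle_data_measurable: "v \<in> labels \<Longrightarrow> particle_data Z A N D v \<in> M \<rightarrow>\<^sub>M particle_space"
  using indep_particles by (auto simp: indep_vars_def)

lemma ingredients_measurable:
  assumes "v \<in> labels"
  shows "motion Z v \<in> M \<rightarrow>\<^sub>M path_space" "A v \<in> borel_measurable M" "offspring N D v \<in> M \<rightarrow>\<^sub>M offspring_space"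
proof -
  note d = particle_data_measurable[OF assms]
  note s = measurable_compose[OF d measurable_snd]
  show "motion Z v \<in> M \<rightarrow>\<^sub>M path_space"
    using measurable_compose[OF d measurable_fst] by (simp add: particle_data_def)
  show "A v \<in> borel_measurable M" "offspring N D v \<in> M \<rightarrow>\<^sub>M offspring_space"
    using measurable_compose[OF s measurable_fst] measurable_compose[OF s measurable_snd] by (simp_all add: particle_data_def)
qed

lemma jump_sum_offspring: "jump_sum (offspring N D v \<omega>) = (\<Sum>i=1..N v \<omega>. D (v @ [i]) \<omega>)"
  by (simp add: jump_sum_def offspring_def)

lemma jump_square_sum_offspring: "jump_square_sum (offspring N D v \<omega>) = (\<Sum>i=1..N v \<omega>. (D (v @ [i]) \<omega>)\<^sup>2)"
  by (simp add: jump_square_sum_def offspring_def)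

lemma eval_right_motion:
  assumes "cadlag (\<lambda>s. Z v s \<omega>)" "0 \<le> s"
  shows "eval_right (motion Z v \<omega>) s = Z v s \<omega>"
  using assms by (auto simp: motion_def cadlag_def intro!: eval_right_eq)

text \<open>Statements about paths pass to the law at fixed times only; there the cadlag property
  makes \<open>eval_right\<close> agree with evaluation almost surely.\<close>

lemma particle_law_initial:
  assumes l: "0 < l"
  shows "particle_law (distr M path_space (motion Z [])) (distr M offspring_space (offspring N D [])) l (expectation (Z [] 1))"
proof -
  interpret L: square_integrable_levy_process M "Z []"
    using levy[of "[]"] Z_square_integrable by (simp add: square_integrable_levy_process_def square_integrable_levy_process_axioms_def)
  note mm = ingredients_measurable(1)[OF Nil_labels] and om = ingredients_measurable(3)[OF Nil_labels]
  have law: "distr M path_space (motion Z []) = L.path_law"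
    by (simp add: L.path_law_def motion_def[abs_def])
  have val: "motion Z [] \<omega> s = Z [] s \<omega>" if "0 \<le> s" for s \<omega> using that by (simp add: motion_def)
  have fm: "(\<lambda>p. real (fst p)) \<in> borel_measurable offspring_space"
    by (rule measurable_compose[OF measurable_fst]) simp
  show ?thesis
  proof (intro particle_law.intro particle_law_axioms.intro)
    show "prob_space (distr M path_space (motion Z []))" by (rule prob_space_distr[OF mm])
    show "prob_space (distr M offspring_space (offspring N D []))" by (rule prob_space_distr[OF om])
    show "0 < l" by (rule l)
    show "AE z in distr M path_space (motion Z []). z 0 = 0"
    proof (subst AE_distr_iff[OF mm])
      show "{z \<in> space path_space. z 0 = 0} \<in> sets path_space"
        by (rule borel_measurable_eq[OF path_component_measurable borel_measurable_const])
    qed (use L.start_zero in \<open>simp add: val\<close>)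
    fix s :: real assume s: "0 \<le> s"
    show "AE z in distr M path_space (motion Z []). eval_right z s = z s"
    proof (subst AE_distr_iff[OF mm])
      have "(\<lambda>z. eval_right z s) \<in> borel_measurable path_space"
        using measurable_compose[OF measurable_Pair[OF measurable_ident measurable_const] eval_right_measurable, of s] by simp
      from borel_measurable_eq[OF this path_component_measurable]
      show "{z \<in> space path_space. eval_right z s = z s} \<in> sets path_space" .
      show "AE \<omega> in M. eval_right (motion Z [] \<omega>) s = motion Z [] \<omega> s"
        using L.cadlag_paths by eventually_elim (simp add: eval_right_motion s val)
    qed
    have sm: "(\<lambda>z. (z s)\<^sup>2) \<in> borel_measurable path_space" for s :: real
      by (rule borel_measurable_power[OF path_component_measurable])
    show "integrable (distr M path_space (motion Z [])) (\<lambda>z. (z s)\<^sup>2)"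
      unfolding integrable_distr_eq[OF mm sm] using L.square_integrable[OF s] by (simp add: val s)
  next
    have sm: "(\<lambda>z. (z s)\<^sup>2) \<in> borel_measurable path_space" for s :: real
      by (rule borel_measurable_power[OF path_component_measurable])
    show "\<exists>C\<ge>0. \<forall>s\<ge>0. (\<integral>z. (z s)\<^sup>2 \<partial>distr M path_space (motion Z [])) \<le> C * (1 + s\<^sup>2)"
    proof (intro exI[of _ "2 * variance (Z [] 1) + (expectation (Z [] 1))\<^sup>2"] conjI allI impI)
      show "0 \<le> 2 * variance (Z [] 1) + (expectation (Z [] 1))\<^sup>2"
        using variance_positive[of "Z [] 1"] by simp
      fix r :: real assume r: "0 \<le> r"
      show "(\<integral>z. (z r)\<^sup>2 \<partial>distr M path_space (motion Z [])) \<le> (2 * variance (Z [] 1) + (expectation (Z [] 1))\<^sup>2) * (1 + r\<^sup>2)"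
        unfolding integral_distr[OF mm sm] val[OF r] by (rule L.second_moment_le[OF r])
    qed
  next
    fix s t B :: real and g :: "(real \<Rightarrow> real) \<Rightarrow> real"
    assume "0 \<le> s" "s \<le> t" "g \<in> borel_measurable path_space" "\<And>z. \<bar>g z\<bar> \<le> B"
    then show "(\<integral>z. (z t - z s) * g (stopped s z) \<partial>distr M path_space (motion Z [])) =
        expectation (Z [] 1) * (t - s) * (\<integral>z. g (stopped s z) \<partial>distr M path_space (motion Z []))"
      unfolding law by (rule L.path_law_increment)
  next
    show "integrable (distr M offspring_space (offspring N D [])) (\<lambda>p. (real (fst p))\<^sup>2)"
      unfolding integrable_distr_eq[OF om borel_measurable_power[OF fm]] using N_square_integrable by (simp add: offspring_def)
    show "integrable (distr M offspring_space (offspring N D [])) (\<lambda>p. (jump_sum p)\<^sup>2)"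
      unfolding integrable_distr_eq[OF om borel_measurable_power[OF jump_sum_measurable]] jump_sum_offspring using D_sum_square_integrable by simp
    show "integrable (distr M offspring_space (offspring N D [])) jump_square_sum"
      unfolding integrable_distr_eq[OF om jump_square_sum_measurable] jump_square_sum_offspring using D_square_sum_integrable by simp
    show "1 < (\<integral>p. real (fst p) \<partial>distr M offspring_space (offspring N D []))"
      unfolding integral_distr[OF om fm] using supercritical by (simp add: offspring_def)
  qed simp_all
qed

lemma distr_initial_particle:
  assumes "distributed M lborel (A []) (exponential_density l)"
  shows "distr M particle_space (particle_data Z A N D []) =
    distr M path_space (motion Z []) \<Otimes>\<^sub>M density lborel (exponential_density l) \<Otimes>\<^sub>M distr M offspring_space (offspring N D [])"
proof -
  have "distr M borel (A []) = density lborel (exponential_density l)"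
    using distributed_distr_eq_density[OF assms] distr_cong[of M M borel lborel "A []" "A []"] by simp
  then show ?thesis
    using distr_triple_indep[OF ingredients_measurable[OF Nil_labels] indep_ingredients]
    by (simp add: particle_data_def[abs_def])
qed

lemma distr_particles:
  "distr M (PiM labels (\<lambda>_. particle_space)) (\<lambda>\<omega>. \<lambda>v\<in>labels. particle_data Z A N D v \<omega>) =
    PiM labels (\<lambda>_. distr M particle_space (particle_data Z A N D []))"
proof -
  have ne: "labels \<noteq> {}" by (rule ex_in_conv[THEN iffD1], rule exI, rule Nil_labels)
  have "distr M (PiM labels (\<lambda>_. particle_space)) (\<lambda>\<omega>. \<lambda>v\<in>labels. particle_data Z A N D v \<omega>) =
      PiM labels (\<lambda>v. distr M particle_space (particle_data Z A N D v))"
    by (rule indep_vars_iff_distr_eq_PiM'[OF ne particle_data_measurable, THEN iffD1, OF _ indep_particles])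
  also have "\<dots> = PiM labels (\<lambda>_. distr M particle_space (particle_data Z A N D []))"
    by (rule PiM_cong[OF refl identically_distributed])
  finally show ?thesis .
qed

end

section \<open>Pathwise identification with the tree on the product space\<close>

lemma sum_strict_prefix: "(\<Sum>u | strict_prefix u v. f u) = (\<Sum>m<length v. f (take m v))"
proof (rule sum.reindex_cong[OF _ _ refl])
  show "inj_on (\<lambda>m. take m v) {..<length v}"
    by (rule inj_onI) (metis length_take lessThan_iff min.strict_order_iff min.commute)
  show "{u. strict_prefix u v} = (\<lambda>m. take m v) ` {..<length v}"
    by (auto simp: strict_prefix_iff_take)
qed

lemma sum_prefix: "(\<Sum>u | prefix u v. f u) = (\<Sum>u | strict_prefix u v. f u) + (f v :: real)"
proof -
  have "{u. prefix u v} = insert v {u. strict_prefix u v}" by (auto simp: strict_prefix_def)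
  moreover have "finite {u. strict_prefix u v}" by (rule finite_subset[of _ "set (prefixes v)"]) (auto simp: strict_prefix_def)
  ultimately show ?thesis by (simp add: strict_prefix_def)
qed

lemma sum_prefix_nonempty: "(\<Sum>u | strict_prefix [] u \<and> prefix u v. f u) = (\<Sum>m<length v. f (take (Suc m) v))"
proof (rule sum.reindex_cong[OF _ _ refl])
  show "inj_on (\<lambda>m. take (Suc m) v) {..<length v}"
  proof (rule inj_onI)
    fix a b assume "a \<in> {..<length v}" "b \<in> {..<length v}" "take (Suc a) v = take (Suc b) v"
    then have "length (take (Suc a) v) = length (take (Suc b) v)" "a < length v" "b < length v" by simp_all
    then show "a = b" unfolding length_take by linarith
  qed
  have "strict_prefix [] u \<and> prefix u v \<longleftrightarrow> (\<exists>m<length v. u = take (Suc m) v)" for u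
  proof
    assume u: "strict_prefix [] u \<and> prefix u v"
    then have "u = take (length u) v" "length u \<le> length v" "0 < length u"
      by (auto simp: prefix_def)
    then show "\<exists>m<length v. u = take (Suc m) v"
      by (intro exI[of _ "length u - 1"]) (simp add: Suc_le_eq[symmetric])
  next
    assume "\<exists>m<length v. u = take (Suc m) v"
    then show "strict_prefix [] u \<and> prefix u v" by (auto simp: take_is_prefix strict_prefix_def)
  qed
  then show "{u. strict_prefix [] u \<and> prefix u v} = (\<lambda>m. take (Suc m) v) ` {..<length v}" by auto
qed

context branching_levy_process
begin

lemma movement_rate_eq:
  assumes l: "0 < l" and A: "distributed M lborel (A []) (exponential_density l)"
  shows "movement_rate M Z A N D = expectation (Z [] 1) + l * (\<integral>p. jump_sum p \<partial>distr M offspring_space (offspring N D []))"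
  unfolding movement_rate_def branching_rate_def exponential_distributed_expectation[OF l A]
    integral_distr[OF ingredients_measurable(3)[OF Nil_labels] jump_sum_measurable] jump_sum_offspring
  by simp

text \<open>For positive lifetimes and cadlag paths the absolute value in \<open>life\<close>
  disappears and \<open>eval_right\<close> is evaluation. Jumps along the ancestral line of an
  existing particle are read at indices of existing children, where they are the displacements
  \<open>D\<close>.\<close>

lemma
  fixes \<omega>
  defines "w \<equiv> \<lambda>v\<in>labels. particle_data Z A N D v \<omega>"
  assumes A: "\<And>v. v \<in> labels \<Longrightarrow> 0 < A v \<omega>" and Z: "\<And>v. v \<in> labels \<Longrightarrow> cadlag (\<lambda>s. Z v s \<omega>)"
  shows pathwise_alive: "{v \<in> labels. born w v \<and> birth w v \<le> t \<and> t < birth w v + life (w v)} = alive A N t \<omega>"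
    and pathwise_position: "v \<in> alive A N t \<omega> \<Longrightarrow>
      (\<Sum>m<length v. step r (w (take m v)) (v ! m)) + (eval_right (fst (w v)) (t - birth w v) - r * (t - birth w v)) =
      position Z A D v t \<omega> - r * t"
proof -
  have w: "w v = (motion Z v \<omega>, A v \<omega>, offspring N D v \<omega>)" if "v \<in> labels" for v
    using that by (simp add: w_def particle_data_def)
  have life: "life (w v) = A v \<omega>" if "v \<in> labels" for v
    using A[OF that] by (simp add: w that life_def)
  have birth: "birth w v = (\<Sum>u | strict_prefix u v. A u \<omega>)" if "v \<in> labels" for v
    unfolding birth_def sum_strict_prefix by (intro sum.cong refl life take_labels that)
  have born: "born w v \<longleftrightarrow> v \<in> particles N \<omega>" if "v \<in> labels" for v
    using that by (simp add: born_def particles_def children_def w take_labels offspring_def)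
  have "v \<in> labels" if "v \<in> particles N \<omega>" for v using that by (simp add: particles_def)
  then show "{v \<in> labels. born w v \<and> birth w v \<le> t \<and> t < birth w v + life (w v)} = alive A N t \<omega>"
    by (auto simp: alive_def sum_prefix birth born life)
  show "(\<Sum>m<length v. step r (w (take m v)) (v ! m)) + (eval_right (fst (w v)) (t - birth w v) - r * (t - birth w v)) =
      position Z A D v t \<omega> - r * t" if "v \<in> alive A N t \<omega>"
  proof -
    have v: "v \<in> labels" and vN: "\<And>m. m < length v \<Longrightarrow> v ! m \<le> N (take m v) \<omega>" and t: "birth w v \<le> t"
      using that by (auto simp: alive_def particles_def birth)
    have step: "step r (w (take m v)) (v ! m) = Z (take m v) (A (take m v) \<omega>) \<omega> - r * A (take m v) \<omega> + D (take (Suc m) v) \<omega>"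
      if m: "m < length v" for m
    proof -
      have tl: "take m v \<in> labels" by (rule take_labels[OF v])
      have "jump (w (take m v)) (v ! m) = D (take (Suc m) v) \<omega>"
        using vN[OF m] labels_nth_pos[OF v m] by (simp add: jump_def w tl offspring_def take_Suc_conv_app_nth[OF m])
      moreover have "eval_right (fst (w (take m v))) (life (w (take m v))) = Z (take m v) (A (take m v) \<omega>) \<omega>"
        using eval_right_motion[OF Z[OF tl] less_imp_le[OF A[OF tl]]] by (simp add: w tl life_def abs_of_pos[OF A[OF tl]])
      ultimately show ?thesis by (simp add: step_def life tl)
    qed
    have "(\<Sum>m<length v. step r (w (take m v)) (v ! m)) =
        (\<Sum>m<length v. Z (take m v) (A (take m v) \<omega>) \<omega> - r * A (take m v) \<omega> + D (take (Suc m) v) \<omega>)"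
      by (rule sum.cong) (simp_all add: step)
    also have "\<dots> = (\<Sum>u | strict_prefix u v. Z u (A u \<omega>) \<omega>) - r * birth w v + (\<Sum>u | strict_prefix [] u \<and> prefix u v. D u \<omega>)"
      by (simp add: birth[OF v] sum_strict_prefix sum_prefix_nonempty sum.distrib sum_subtractf sum_distrib_left)
    finally have "(\<Sum>m<length v. step r (w (take m v)) (v ! m)) =
        (\<Sum>u | strict_prefix u v. Z u (A u \<omega>) \<omega>) - r * birth w v + (\<Sum>u | strict_prefix [] u \<and> prefix u v. D u \<omega>)" .
    moreover have "eval_right (fst (w v)) (t - birth w v) = Z v (t - birth w v) \<omega>"
      using eval_right_motion[OF Z[OF v], of "t - birth w v"] t by (simp add: w v)
    ultimately show ?thesis
      unfolding position_def birth[OF v, symmetric] by (simp add: algebra_simps)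
  qed
qed

text \<open>The exponential law is assumed for the initial particle; equality of the laws of
  particle data passes it on to every label.\<close>

lemma AE_lifetime_pos:
  assumes A: "distributed M lborel (A []) (exponential_density l)"
    and v: "v \<in> labels"
  shows "AE \<omega> in M. 0 < A v \<omega>"
proof -
  have "distr M borel (A v) = distr (distr M particle_space (particle_data Z A N D v)) borel (fst \<circ> snd)" if "v \<in> labels" for v
    using distr_distr[OF measurable_comp[OF measurable_snd measurable_fst] particle_data_measurable[OF that]]
    by (simp add: comp_def particle_data_def)
  then have "distr M borel (A v) = distr M borel (A [])"
    using identically_distributed[OF v] v Nil_labels by simp
  also have "\<dots> = density lborel (exponential_density l)"
    using distributed_distr_eq_density[OF A] distr_cong[of M M borel lborel "A []" "A []"] by simp
  finally have d: "distr M borel (A v) = density lborel (exponential_density l)" .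
  have "AE a in distr M borel (A v). 0 < a"
    unfolding d using AE_lborel_singleton[of 0]
    by (subst AE_density) (auto simp: exponential_density_def elim!: eventually_mono)
  then show ?thesis by (rule AE_distrD[OF ingredients_measurable(2)[OF v]])
qed

text \<open>The statement on the product space is pulled back along the map from a sample point to
  all particle data, whose law is \<open>Q\<close>. The labels are countable, so lifetimes are
  positive and paths cadlag for all of them at once.\<close>

lemma AE_average_position_tendsto:
  "AE \<omega> in M. filterlim (\<lambda>t. card (alive A N t \<omega>)) at_top at_top \<longrightarrow>
    (\<exists>L. ((\<lambda>t. (\<Sum>v\<in>alive A N t \<omega>. position Z A D v t \<omega> - movement_rate M Z A N D * t)
       / real (card (alive A N t \<omega>))) \<longlongrightarrow> L) at_top)"
proof -
  obtain l where l: "0 < l" and A: "distributed M lborel (A []) (exponential_density l)"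
    using A_exponential by blast
  interpret particle_law "distr M path_space (motion Z [])" "distr M offspring_space (offspring N D [])" l "expectation (Z [] 1)"
    by (rule particle_law_initial[OF l])
  have r: "movement_rate M Z A N D = drift"
    by (simp only: movement_rate_eq[OF l A] drift_def mean_jump_def)
  have wm: "(\<lambda>\<omega>. \<lambda>v\<in>labels. particle_data Z A N D v \<omega>) \<in> M \<rightarrow>\<^sub>M PiM labels (\<lambda>_. particle_space)"
    by (rule measurable_restrict) (rule particle_data_measurable)
  have law: "distr M (PiM labels (\<lambda>_. particle_space)) (\<lambda>\<omega>. \<lambda>v\<in>labels. particle_data Z A N D v \<omega>) = Q"
    unfolding distr_particles distr_initial_particle[OF A] ..
  have main: "AE \<omega> in M. (\<forall>v\<in>labels. \<forall>s\<ge>0. continuous (at_right s) (fst ((\<lambda>v\<in>labels. particle_data Z A N D v \<omega>) v))) \<longrightarrow>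
     filterlim (\<lambda>t. card (living t (\<lambda>v\<in>labels. particle_data Z A N D v \<omega>))) at_top at_top \<longrightarrow>
     (\<exists>L. ((\<lambda>t. (\<Sum>v\<in>living t (\<lambda>v\<in>labels. particle_data Z A N D v \<omega>). place 1 0 t (\<lambda>v\<in>labels. particle_data Z A N D v \<omega>) v) /
       real (card (living t (\<lambda>v\<in>labels. particle_data Z A N D v \<omega>)))) \<longlongrightarrow> L) at_top)"
    using AE_average_tendsto unfolding law[symmetric] by (rule AE_distrD[OF wm])
  have count: "countable labels" by simp
  have "AE \<omega> in M. \<forall>v\<in>labels. 0 < A v \<omega>"
    using AE_lifetime_pos[OF A] count by (simp add: AE_ball_countable)
  moreover have "AE \<omega> in M. \<forall>v\<in>labels. cadlag (\<lambda>s. Z v s \<omega>)"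
    using levy_process.cadlag_paths[OF levy] count by (simp add: AE_ball_countable)
  ultimately show ?thesis
    using main
  proof eventually_elim
    case (elim \<omega>)
    define w where "w = (\<lambda>v\<in>labels. particle_data Z A N D v \<omega>)"
    have Apos: "\<And>v. v \<in> labels \<Longrightarrow> 0 < A v \<omega>" and cad: "\<And>v. v \<in> labels \<Longrightarrow> cadlag (\<lambda>s. Z v s \<omega>)"
      using elim(1,2) by simp_all
    have right: "\<forall>v\<in>labels. \<forall>s\<ge>0. continuous (at_right s) (fst (w v))"
    proof (intro ballI allI impI)
      fix v and s :: real assume v: "v \<in> labels" and s: "0 \<le> s"
      have "((\<lambda>s. Z v s \<omega>) \<longlongrightarrow> Z v s \<omega>) (at_right s)"
        using cad[OF v] s by (simp add: cadlag_def continuous_within)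
      moreover have "\<forall>\<^sub>F r in at_right s. Z v r \<omega> = motion Z v \<omega> r"
        using eventually_at_right_less[of s] by eventually_elim (use s in \<open>simp add: motion_def\<close>)
      ultimately have "(motion Z v \<omega> \<longlongrightarrow> Z v s \<omega>) (at_right s)" by (rule Lim_transform_eventually)
      then show "continuous (at_right s) (fst (w v))"
        using v s by (simp add: continuous_within w_def particle_data_def motion_def)
    qed
    have alive: "living t w = alive A N t \<omega>" for t
      unfolding living_def w_def by (rule pathwise_alive[OF Apos cad])
    have place: "place 1 0 t w v = position Z A D v t \<omega> - movement_rate M Z A N D * t" if "v \<in> alive A N t \<omega>" for v t
      unfolding place_def score_def r w_def using pathwise_position[OF Apos cad that] by simp
    have "(\<Sum>v\<in>alive A N t \<omega>. place 1 0 t w v) = (\<Sum>v\<in>alive A N t \<omega>. position Z A D v t \<omega> - movement_rate M Z A N D * t)" for t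
      by (rule sum.cong[OF refl place])
    with mp[OF elim(3)[folded w_def] right] show ?case
      unfolding alive by (simp only: simp_thms)
  qed
qed

end

theorem theorem3p1:
  fixes M :: "'a measure"
    and Z :: "nat list \<Rightarrow> real \<Rightarrow> 'a \<Rightarrow> real"
    and A :: "nat list \<Rightarrow> 'a \<Rightarrow> real"
    and N :: "nat list \<Rightarrow> 'a \<Rightarrow> nat"
    and D :: "nat list \<Rightarrow> 'a \<Rightarrow> real"
  assumes "branching_levy_process M Z A N D"
  shows "AE \<omega> in M.
    filterlim (\<lambda>t. card (alive A N t \<omega>)) at_top at_top \<longrightarrow>
    (\<exists>L::real. ((\<lambda>t. (\<Sum>v\<in>alive A N t \<omega>. position Z A D v t \<omega> - movement_rate M Z A N D * t)
                       / real (card (alive A N t \<omega>))) \<longlongrightarrow> L) at_top)"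
  by (rule branching_levy_process.AE_average_position_tendsto[OF assms])

end
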